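(* Let $\mathcal X\subseteq\mathbb R^d$, $k\in\mathbb N$, $\phi\in\{\phi_{\mathsf S},\phi_{\mathsf R}\}$, $h:\mathbb R\to\bar{\mathbb R}$, and write $\mathcal G:=\mathcal G_k^*(\phi)$. Assume that $\bar C(|\mathcal G|,\mathcal X)<\infty$, that $h$ is differentiable on $\big[\underline C(\mathcal G,\mathcal X),\bar C(\mathcal G,\mathcal X)\big]$ with derivative $h'$, and that $\bar C(|h'\circ\mathcal G|,\mathcal X)<\infty$. Then there is a universal constant $c>0$ such that for every $n\in\mathbb N$ and every $\delta\ge 0$, $$\sup_{\substack{\mu,\nu\in\mathcal P(\mathcal X):\\ \mathsf D_{h,\mathcal G}(\mu,\nu)<\infty}}\mathbb P\Big(\big|\hat{\mathsf D}_{h,\mathcal G}(X^n,Y^n)-\mathsf D_{h,\mathcal G}(\mu,\nu)\big|\ge \delta+E\,n^{-1/2}\Big)\le c\,e^{-n\delta^2/V},$$ where $$V=c\,\bar C(|\mathcal G|,\mathcal X)^2\big(\bar C(|h'\circ\mathcal G|,\mathcal X)+1\big)^2,$$ $$E=c\,k\sqrt{d(\|\mathcal X\|+1)}\,\big(\bar C(|h'\circ\mathcal G|,\mathcal X)+1\big)\sqrt{\bar C(|\mathcal G|,\mathcal X)} .$$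
   Context: $\mathcal P(\mathcal X)$ is the set of Borel probability measures on $\mathcal X$; $\|\mathcal X\|:=\sup_{x\in\mathcal X}\|x\|_\infty$; $\bar{\mathbb R}$ is the extended real line. Neural network class: for $k\in\mathbb N$, $a_1,a_2,a_3,a_4\ge 0$ and $\phi:\mathbb R\to\mathbb R$, $\mathcal G_k(a_1,a_2,a_3,a_4,\phi)$ is the set of functions $g:\mathbb R^d\to\mathbb R$ of the form $g(x)=\sum_{i=1}^k\beta_i\phi(w_i\cdot x+b_i)+w_0\cdot x+b_0$ with $\|w_i\|_1\le a_1$, $|b_i|\le a_1$, $|\beta_i|\le a_2$ for $1\le i\le k$, $|b_0|\le a_3$, $\|w_0\|_1\le a_4$. Set $\mathcal G_k^*(\phi):=\mathcal G_k(1,1,1,0,\phi)$. Activations: $\phi_{\mathsf S}(z)=(1+e^{-z})^{-1}$, $\phi_{\mathsf R}(z)=\max\{z,0\}$. For a class $\mathcal F$ of functions on $\mathcal X$: $\underline C(\mathcal F,\mathcal X)=\inf_{x\in\mathcal X,f\in\mathcal F}f(x)$, $\bar C(\mathcal F,\mathcal X)=\sup_{x\in\mathcal X,f\in\mathcal F}f(x)$; $|\mathcal F|=\{|f|:f\in\mathcal F\}$, $|h'\circ\mathcal F|=\{|h'\circ f|:f\in\mathcal F\}$. Divergence and estimator: $\mathsf D_{h,\mathcal G}(\mu,\nu)=\sup_{g\in\mathcal G}\mathbb E_\mu[g]-\mathbb E_\nu[h\circ g]$ and $\hat{\mathsf D}_{h,\mathcal G}(X^n,Y^n)=\sup_{g\in\mathcal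 G}\frac1n\sum_{i=1}^n[g(X_i)-h\circ g(Y_i)]$, where $X_1,\dots,X_n$ are i.i.d. from $\mu$ and $Y_1,\dots,Y_n$ are i.i.d. from $\nu$ (the two samples independent). *)

theory Defs
  imports "HOL-Probability.Probability"
begin

text \<open>
  The dimension \<open>d\<close> has to be quantified inside the statement (the constant is universal, in
  particular independent of \<open>d\<close>), so vectors of \<open>\<real>\<^sup>d\<close> are extensional functions on \<open>{..<d}\<close>
  instead of elements of a type. The Borel sigma-algebra of \<open>\<real>\<^sup>d\<close> is the finite product of
  copies of \<^const>\<open>borel\<close>.
\<close>

definition euclid :: "nat \<Rightarrow> (nat \<Rightarrow> real) set" where
  "euclid d = {..<d} \<rightarrow>\<^sub>E UNIV"

definition borel_euclid :: "nat \<Rightarrow> (nat \<Rightarrow> real) measure" where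
  "borel_euclid d = (\<Pi>\<^sub>M i\<in>{..<d}. borel)"

definition dot :: "nat \<Rightarrow> (nat \<Rightarrow> real) \<Rightarrow> (nat \<Rightarrow> real) \<Rightarrow> real" where
  "dot d u x = (\<Sum>j<d. u j * x j)"

definition l1norm :: "nat \<Rightarrow> (nat \<Rightarrow> real) \<Rightarrow> real" where
  "l1norm d u = (\<Sum>j<d. \<bar>u j\<bar>)"

definition supnorm_set :: "nat \<Rightarrow> (nat \<Rightarrow> real) set \<Rightarrow> ereal" where
  "supnorm_set d X = (SUP x\<in>X. SUP j\<in>{..<d}. ereal \<bar>x j\<bar>)"

text \<open>
  Borel probability measures on an arbitrary, not necessarily Borel, set \<open>X\<close>: the Borel
  sigma-algebra of the subspace \<open>X\<close> is the trace of the one of \<open>\<real>\<^sup>d\<close>.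
\<close>

definition prob_measures :: "nat \<Rightarrow> (nat \<Rightarrow> real) set \<Rightarrow> (nat \<Rightarrow> real) measure set" where
  "prob_measures d X = {\<mu>. prob_space \<mu> \<and> sets \<mu> = sets (restrict_space (borel_euclid d) X)}"

definition sigmoid :: "real \<Rightarrow> real" where
  "sigmoid z = inverse (1 + exp (- z))"

definition relu :: "real \<Rightarrow> real" where
  "relu z = max z 0"

definition nn_class ::
    "nat \<Rightarrow> nat \<Rightarrow> real \<Rightarrow> real \<Rightarrow> real \<Rightarrow> real \<Rightarrow> (real \<Rightarrow> real) \<Rightarrow> ((nat \<Rightarrow> real) \<Rightarrow> real) set" where
  "nn_class d k a1 a2 a3 a4 \<phi> =
     {g. \<exists>\<beta> w b w0 b0.
        (\<forall>i\<in>{1..k}. l1norm d (w i) \<le> a1 \<and> \<bar>b i\<bar> \<le> a1 \<and> \<bar>\<beta> i\<bar> \<le> a2) \<and>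
        \<bar>b0\<bar> \<le> a3 \<and> l1norm d w0 \<le> a4 \<and>
        g = (\<lambda>x. (\<Sum>i=1..k. \<beta> i * \<phi> (dot d (w i) x + b i)) + dot d w0 x + b0)}"

definition nn_star :: "nat \<Rightarrow> nat \<Rightarrow> (real \<Rightarrow> real) \<Rightarrow> ((nat \<Rightarrow> real) \<Rightarrow> real) set" where
  "nn_star d k \<phi> = nn_class d k 1 1 1 0 \<phi>"

definition C_lower :: "('a \<Rightarrow> real) set \<Rightarrow> 'a set \<Rightarrow> ereal" where
  "C_lower F X = (INF (x, f)\<in>X \<times> F. ereal (f x))"

definition C_upper :: "('a \<Rightarrow> real) set \<Rightarrow> 'a set \<Rightarrow> ereal" where
  "C_upper F X = (SUP (x, f)\<in>X \<times> F. ereal (f x))"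

definition abs_funs :: "('a \<Rightarrow> real) set \<Rightarrow> ('a \<Rightarrow> real) set" where
  "abs_funs F = (\<lambda>f x. \<bar>f x\<bar>) ` F"

definition comp_funs :: "(real \<Rightarrow> real) \<Rightarrow> ('a \<Rightarrow> real) set \<Rightarrow> ('a \<Rightarrow> real) set" where
  "comp_funs h' F = (\<lambda>f. h' \<circ> f) ` F"

definition value_interval :: "('a \<Rightarrow> real) set \<Rightarrow> 'a set \<Rightarrow> real set" where
  "value_interval F X = {t. C_lower F X \<le> ereal t \<and> ereal t \<le> C_upper F X}"

text \<open>
  Differentiability of an extended-real-valued function on a set: finite there and
  differentiable as a real function, with one-sided derivatives at the endpoints of an interval.
\<close>

definition ereal_has_deriv_on :: "(real \<Rightarrow> ereal) \<Rightarrow> (real \<Rightarrow> real) \<Rightarrow> real set \<Rightarrow> bool" where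
  "ereal_has_deriv_on h h' S \<longleftrightarrow>
     (\<forall>t\<in>S. \<bar>h t\<bar> \<noteq> \<infinity>) \<and>
     (\<forall>t\<in>S. ((\<lambda>s. real_of_ereal (h s)) has_real_derivative h' t) (at t within S))"

text \<open>
  The integral of the positive part minus the integral of the negative part
  (\<^const>\<open>e2ennreal\<close> sends negative numbers to 0).
\<close>

definition ereal_expectation :: "'a measure \<Rightarrow> ('a \<Rightarrow> ereal) \<Rightarrow> ereal" where
  "ereal_expectation \<mu> f =
     enn2ereal (\<integral>\<^sup>+x. e2ennreal (f x) \<partial>\<mu>) - enn2ereal (\<integral>\<^sup>+x. e2ennreal (- f x) \<partial>\<mu>)"

definition divergence ::
    "(real \<Rightarrow> ereal) \<Rightarrow> ('a \<Rightarrow> real) set \<Rightarrow> 'a measure \<Rightarrow> 'a measure \<Rightarrow> ereal" where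
  "divergence h G \<mu> \<nu> =
     (SUP g\<in>G. ereal_expectation \<mu> (\<lambda>x. ereal (g x)) - ereal_expectation \<nu> (\<lambda>y. h (g y)))"

definition divergence_est ::
    "(real \<Rightarrow> ereal) \<Rightarrow> ('a \<Rightarrow> real) set \<Rightarrow> nat \<Rightarrow> (nat \<Rightarrow> 'a) \<Rightarrow> (nat \<Rightarrow> 'a) \<Rightarrow> ereal" where
  "divergence_est h G n xs ys =
     (SUP g\<in>G. ereal (1 / real n) * (\<Sum>i=1..n. ereal (g (xs i)) - h (g (ys i))))"

text \<open>
  Joint law of \<open>X_1, ..., X_n\<close> i.i.d. from \<open>\<mu>\<close> and, independently, \<open>Y_1, ..., Y_n\<close> i.i.d. from \<open>\<nu>\<close>.
\<close>

definition sample_measure ::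
    "nat \<Rightarrow> 'a measure \<Rightarrow> 'a measure \<Rightarrow> ((nat \<Rightarrow> 'a) \<times> (nat \<Rightarrow> 'a)) measure" where
  "sample_measure n \<mu> \<nu> = (\<Pi>\<^sub>M i\<in>{1..n}. \<mu>) \<Otimes>\<^sub>M (\<Pi>\<^sub>M i\<in>{1..n}. \<nu>)"

text \<open>Only used for nonnegative arguments.\<close>

definition ereal_sqrt :: "ereal \<Rightarrow> ereal" where
  "ereal_sqrt x = (if x = \<infinity> then \<infinity> else ereal (sqrt (real_of_ereal x)))"

definition V_const :: "real \<Rightarrow> (real \<Rightarrow> real) \<Rightarrow> ('a \<Rightarrow> real) set \<Rightarrow> 'a set \<Rightarrow> ereal" where
  "V_const c h' G X =
     ereal c * (C_upper (abs_funs G) X)^2 * (C_upper (abs_funs (comp_funs h' G)) X + 1)^2"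

text \<open>Infinite when \<open>X\<close> is unbounded, which can happen for the sigmoid activation.\<close>

definition E_const ::
    "real \<Rightarrow> nat \<Rightarrow> nat \<Rightarrow> (real \<Rightarrow> real) \<Rightarrow> ((nat \<Rightarrow> real) \<Rightarrow> real) set \<Rightarrow> (nat \<Rightarrow> real) set \<Rightarrow> ereal" where
  "E_const c d k h' G X =
     ereal c * ereal (real k) * ereal_sqrt (ereal (real d) * (supnorm_set d X + 1)) *
     (C_upper (abs_funs (comp_funs h' G)) X + 1) * ereal_sqrt (C_upper (abs_funs G) X)"

end

theory Submission
  imports Defs
begin

text \<open>
  Write \<open>C\<close> for the supremum of the absolute values of the networks on \<open>X\<close>, \<open>L\<close> for the bound on \<open>h'\<close>,
  \<open>\<Lambda> = L + 1\<close> and \<open>M\<close> for the sup norm of \<open>X\<close>. On the values of the networks, which form an interval,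
  \<open>h\<close> is \<open>L\<close>-Lipschitz. The difference between the estimator and the divergence is at most the
  supremum over \<open>g\<close> of the difference between the empirical and the true mean of \<open>g\<close>, plus the same
  for \<open>h \<circ> g\<close>. For a single \<open>g\<close> both are sub-Gaussian, with variance proxy of order
  \<open>\<Lambda>\<^sup>2 C\<^sup>2 / n\<close>; what has to be paid for is the supremum.

  All estimates are made for moment generating functions, so that the mean and the fluctuations of the
  supremum are treated at the same time: if \<open>E exp (\<lambda> sup) \<le> A exp (\<kappa> \<lambda>\<^sup>2)\<close>, then Markov's inequality gives a Gaussian tail with the
  prefactor \<open>A\<close>. At the level \<open>t = \<delta> + E / sqrt n\<close> one has \<open>t\<^sup>2 \<ge> \<delta>\<^sup>2 + E\<^sup>2 / n\<close>, so the tail splits into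
  the desired bound for \<open>\<delta>\<close> and a factor \<open>exp (- E\<^sup>2 / (c \<Lambda>\<^sup>2 C\<^sup>2))\<close>, which absorbs \<open>A\<close>
  (lemma \<open>net_absorbed\<close>). So one needs \<open>ln A\<close> to be at most of order \<open>d (M + 1)\<close> for the sigmoid and
  of order \<open>d\<close> for the rectifier, for which \<open>C\<close> itself grows like \<open>k (M + 1)\<close>.

  The bound on the moment generating function is obtained in three moves. Symmetrization replaces the
  centred sums by sums with random signs. Contraction (the comparison theorem of Ledoux and Talagrand)
  removes \<open>h\<close> and, later, the activation, which leaves suprema of linear functionals over an
  \<open>l\<^sub>1\<close>-ball; those are attained at the \<open>2 d\<close> vertices. For the rectifier this suffices. For
  the sigmoid it would cost a factor \<open>M\<close> where only \<open>sqrt M\<close> is allowed, because the sigmoid is bounded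
  by 1 while its argument ranges over an interval of length of order \<open>M\<close>. Hence contraction is
  applied only to the increments of the activation around the centres of a net of radius
  \<open>1 / (M + 1)\<close> in the parameter space, at which scale the linear increments are bounded by 1, and
  the centres are treated one by one (lemma \<open>neuron_sign_mean_le\<close>). A single scale is
  enough: a net made of integer points of an \<open>l\<^sub>1\<close>-ball of radius of order \<open>d (M + 1)\<close> has
  only \<open>exp (O (d (M + 1)))\<close> elements.

  The supremum over all networks is an uncountable one, and the event of the theorem need not be
  measurable. It is covered by a measurable event that involves finitely many networks, since the
  networks are totally bounded in the uniform norm on \<open>X\<close> when \<open>X\<close> is bounded. When \<open>X\<close> is unbounded,
  \<open>E\<close> is infinite and the event is empty.
\<close>

section \<open>Averages over random signs\<close>

text \<open>
  The expectation of \<open>Q\<close> at independent uniform signs indexed by \<open>I\<close>. A finite sum instead of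
  a product measure keeps measurability questions out of the deterministic part of the argument.
\<close>

definition sign_mean :: "'i set \<Rightarrow> (('i \<Rightarrow> real) \<Rightarrow> real) \<Rightarrow> real" where
  "sign_mean I Q = (\<Sum>\<epsilon>\<in>I \<rightarrow>\<^sub>E {-1, 1}. Q \<epsilon>) / 2 ^ card I"

lemma sign_mean_empty: "sign_mean {} Q = Q (\<lambda>_. undefined)"
  by (simp add: sign_mean_def)

lemma sign_mean_insert:
  assumes "finite I" "j \<notin> I"
  shows "sign_mean (insert j I) Q = (sign_mean I (\<lambda>\<epsilon>. Q (\<epsilon>(j := 1))) + sign_mean I (\<lambda>\<epsilon>. Q (\<epsilon>(j := -1)))) / 2"
proof -
  have inj: "inj_on (\<lambda>(y, g). g(j := y)) ({-1, 1::real} \<times> (I \<rightarrow>\<^sub>E {-1, 1}))"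
    using inj_combinator[of j I "\<lambda>_. {-1, 1::real}"] assms(2) by simp
  have "(\<Sum>\<epsilon>\<in>insert j I \<rightarrow>\<^sub>E {-1, 1}. Q \<epsilon>)
      = (\<Sum>(y, \<epsilon>)\<in>{-1, 1} \<times> (I \<rightarrow>\<^sub>E {-1, 1}). Q (\<epsilon>(j := y)))"
    unfolding PiE_insert_eq by (subst sum.reindex[OF inj]) (simp add: case_prod_beta)
  also have "\<dots> = (\<Sum>y\<in>{-1, 1}. \<Sum>\<epsilon>\<in>I \<rightarrow>\<^sub>E {-1, 1}. Q (\<epsilon>(j := y)))"
    by (simp add: sum.cartesian_product)
  finally show ?thesis
    using assms by (simp add: sign_mean_def add_divide_distrib)
qed

lemma sign_mean_mono:
  assumes "\<And>\<epsilon>. \<epsilon> \<in> I \<rightarrow>\<^sub>E {-1, 1} \<Longrightarrow> Q \<epsilon> \<le> R \<epsilon>"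
  shows "sign_mean I Q \<le> sign_mean I R"
  unfolding sign_mean_def by (intro divide_right_mono sum_mono assms) auto

lemma sign_mean_add: "sign_mean I (\<lambda>\<epsilon>. Q \<epsilon> + R \<epsilon>) = sign_mean I Q + sign_mean I R"
  by (simp add: sign_mean_def sum.distrib add_divide_distrib)

lemma sign_mean_cmult: "sign_mean I (\<lambda>\<epsilon>. c * Q \<epsilon>) = c * sign_mean I Q"
  by (simp add: sign_mean_def sum_distrib_left)

lemma sign_mean_divide: "sign_mean I (\<lambda>\<epsilon>. Q \<epsilon> / c) = sign_mean I Q / c"
  by (simp add: sign_mean_def sum_divide_distrib[symmetric])

lemma sign_mean_sum: "sign_mean I (\<lambda>\<epsilon>. \<Sum>c\<in>N. Q c \<epsilon>) = (\<Sum>c\<in>N. sign_mean I (Q c))"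
  by (simp add: sign_mean_def sum.swap[of _ N] sum_divide_distrib)

lemma sum_sign_upd:
  assumes "finite I" "j \<notin> I"
  shows "(\<Sum>i\<in>insert j I. (\<epsilon>(j := y)) i * t i) = y * t j + (\<Sum>i\<in>I. \<epsilon> i * (t i :: real))"
proof -
  have "(\<Sum>i\<in>I. (\<epsilon>(j := y)) i * t i) = (\<Sum>i\<in>I. \<epsilon> i * t i)"
    by (rule sum.cong) (use assms in auto)
  thus ?thesis using assms by simp
qed

text \<open>
  This is Hoeffding's lemma for a uniform sign, that is, for a two-point law with \<open>p = 1/2\<close>.
\<close>

lemma cosh_le_exp_square: "cosh x \<le> exp (x\<^sup>2 / 2)" for x :: real
proof -
  have *: "cosh x \<le> exp (x\<^sup>2 / 2)" if "x \<ge> 0" for x :: real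
  proof -
    have "- (2 * x) * (1/2) + ln (1 + 1/2 * (exp (2 * x) - 1)) \<le> (2 * x)\<^sup>2 / 8"
      by (rule Hoeffdings_lemma_aux) (use that in auto)
    hence "ln (1 + 1/2 * (exp (2 * x) - 1)) \<le> x + x\<^sup>2 / 2"
      by (simp add: power2_eq_square)
    moreover have "1 + 1/2 * (exp (2 * x) - 1) > 0"
      by (simp add: field_simps add_pos_pos)
    ultimately have "1 + 1/2 * (exp (2 * x) - 1) \<le> exp (x + x\<^sup>2 / 2)"
      by (metis exp_le_cancel_iff exp_ln)
    moreover have "1 + 1/2 * (exp (2 * x) - 1) = exp x * cosh x"
      by (simp add: cosh_def field_simps exp_minus mult_exp_exp)
    ultimately show ?thesis
      by (simp add: exp_add)
  qed
  show ?thesis using *[of x] *[of "-x"] by (cases "x \<ge> 0") auto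
qed

text \<open>
  The signs are independent, so the left-hand side is the product of the \<open>cosh (t i)\<close>.
\<close>

lemma sign_mean_exp_le:
  assumes "finite I"
  shows "sign_mean I (\<lambda>\<epsilon>. exp (\<Sum>i\<in>I. \<epsilon> i * t i)) \<le> exp ((\<Sum>i\<in>I. (t i)\<^sup>2) / 2)"
  using assms
proof (induction I)
  case empty
  show ?case by (simp add: sign_mean_empty)
next
  case (insert j I)
  let ?Q = "\<lambda>\<epsilon>. exp (\<Sum>i\<in>I. \<epsilon> i * t i)"
  have "sign_mean (insert j I) (\<lambda>\<epsilon>. exp (\<Sum>i\<in>insert j I. \<epsilon> i * t i))
      = (sign_mean I (\<lambda>\<epsilon>. exp (t j) * ?Q \<epsilon>) + sign_mean I (\<lambda>\<epsilon>. exp (- t j) * ?Q \<epsilon>)) / 2"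
    unfolding sign_mean_insert[OF insert.hyps] sum_sign_upd[OF insert.hyps] by (simp add: exp_add exp_diff exp_minus field_simps)
  also have "\<dots> = cosh (t j) * sign_mean I ?Q"
    by (simp add: sign_mean_cmult cosh_def field_simps)
  also have "\<dots> \<le> exp ((t j)\<^sup>2 / 2) * exp ((\<Sum>i\<in>I. (t i)\<^sup>2) / 2)"
    by (intro mult_mono cosh_le_exp_square insert.IH) (auto simp: sign_mean_def intro!: sum_nonneg divide_nonneg_nonneg)
  finally show ?case
    using insert.hyps by (simp add: exp_add add_divide_distrib)
qed

lemma sign_mean_exp_uniform_le:
  assumes "finite I" "\<And>i. i \<in> I \<Longrightarrow> \<bar>t i\<bar> \<le> b"
  shows "sign_mean I (\<lambda>\<epsilon>. exp (\<Sum>i\<in>I. \<epsilon> i * t i)) \<le> exp (real (card I) * b\<^sup>2 / 2)"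
proof -
  have "(\<Sum>i\<in>I. (t i)\<^sup>2) \<le> real (card I) * b\<^sup>2"
    by (rule sum_bounded_above) (use assms(2) abs_le_square_iff in fastforce)
  thus ?thesis
    by (intro order_trans[OF sign_mean_exp_le[OF assms(1)]]) simp
qed

section \<open>Contraction\<close>

lemma Max_image_le:
  assumes "finite T" "T \<noteq> {}" "\<And>g. g \<in> T \<Longrightarrow> f g \<le> (b :: real)"
  shows "(MAX g\<in>T. f g) \<le> b"
  using assms by simp

lemma Max_image_ge:
  assumes "finite T" "g \<in> T"
  shows "f g \<le> (MAX g\<in>T. f g :: real)"
  using assms by simp

text \<open>
  Convexity and monotonicity of \<open>exp\<close>: the increment over an interval grows when the interval is moved
  to the right and enlarged. This is the only property of \<open>exp\<close> that the contraction principle needs.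
\<close>

lemma exp_increment_mono:
  fixes p q u v :: real
  assumes "p \<le> q" "0 \<le> u" "u \<le> v"
  shows "exp (p + u) - exp p \<le> exp (q + v) - exp q"
proof -
  have "exp p * (exp u - 1) \<le> exp q * (exp v - 1)"
    using assms by (intro mult_mono) auto
  thus ?thesis by (simp add: exp_add algebra_simps)
qed

text \<open>
  Let \<open>g\<close> and \<open>g'\<close> maximize the two terms on the left. If \<open>t g\<close> and \<open>t g'\<close> have different signs, \<open>\<bar>s\<bar> \<le> \<bar>t\<bar>\<close>
  settles the matter termwise. Otherwise one of the two exponentials may grow when \<open>s\<close> is replaced
  by \<open>\<plusminus>t\<close> and the other one shrink; the Lipschitz condition makes the growing increment the longer one,
  and maximality of \<open>g\<close> and \<open>g'\<close> places it further to the right.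
\<close>

lemma contraction_step:
  assumes T: "finite T" "T \<noteq> {}"
    and lip: "\<And>g g'. g \<in> T \<Longrightarrow> g' \<in> T \<Longrightarrow> \<bar>s g - s g'\<bar> \<le> \<bar>t g - (t g' :: real)\<bar>"
    and le: "\<And>g. g \<in> T \<Longrightarrow> \<bar>s g\<bar> \<le> \<bar>t g\<bar>"
  shows "(MAX g\<in>T. exp (a g + s g)) + (MAX g\<in>T. exp (a g - s g))
       \<le> (MAX g\<in>T. exp (a g + t g)) + (MAX g\<in>T. exp (a g - t g))"
    (is "?S1 + ?S2 \<le> ?T1 + ?T2")
proof -
  have "?S1 \<in> (\<lambda>g. exp (a g + s g)) ` T" "?S2 \<in> (\<lambda>g. exp (a g - s g)) ` T"
    using T by (auto intro!: Max_in)
  then obtain g g' where g: "g \<in> T" "?S1 = exp (a g + s g)" and g': "g' \<in> T" "?S2 = exp (a g' - s g')"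
    by blast
  have m1: "a g' + s g' \<le> a g + s g"
    using Max_image_ge[OF T(1) g'(1), of "\<lambda>g. exp (a g + s g)"] g(2) by simp
  have m2: "a g - s g \<le> a g' - s g'"
    using Max_image_ge[OF T(1) g(1), of "\<lambda>g. exp (a g - s g)"] g'(2) by simp
  have up: "exp (a x + t x) \<le> ?T1" "exp (a x - t x) \<le> ?T2" if "x \<in> T" for x
    using Max_image_ge[OF T(1) that, of "\<lambda>g. exp (a g + t g)"]
      Max_image_ge[OF T(1) that, of "\<lambda>g. exp (a g - t g)"] by auto
  have bd: "\<bar>s g\<bar> \<le> \<bar>t g\<bar>" "\<bar>s g'\<bar> \<le> \<bar>t g'\<bar>" "\<bar>s g - s g'\<bar> \<le> \<bar>t g - t g'\<bar>"
    using lip le g g' by auto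
  have fin1: ?thesis if "exp (a g + s g) + exp (a g' - s g') \<le> exp (a g + t g) + exp (a g' - t g')"
    using that up[OF g(1)] up[OF g'(1)] unfolding g(2) g'(2) by linarith
  have fin2: ?thesis if "exp (a g + s g) + exp (a g' - s g') \<le> exp (a g - t g) + exp (a g' + t g')"
    using that up[OF g(1)] up[OF g'(1)] unfolding g(2) g'(2) by linarith
  consider "t g \<ge> t g'" "t g' \<ge> 0" | "t g' \<ge> t g" "t g \<ge> 0" | "t g \<ge> 0" "t g' \<le> 0"
    | "t g \<le> 0" "t g' \<ge> 0" | "t g \<le> t g'" "t g' \<le> 0" | "t g' \<le> t g" "t g \<le> 0"
    by linarith
  then show ?thesis
  proof cases
    case 1
    have "exp ((a g' - t g') + (t g' - s g')) - exp (a g' - t g') \<le> exp ((a g + s g) + (t g - s g)) - exp (a g + s g)"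
      by (rule exp_increment_mono) (use 1 bd m1 in linarith)+
    thus ?thesis by (intro fin1) simp
  next
    case 2
    have "exp ((a g - t g) + (s g + t g)) - exp (a g - t g) \<le> exp ((a g' - s g') + (s g' + t g')) - exp (a g' - s g')"
      by (rule exp_increment_mono) (use 2 bd m2 in linarith)+
    thus ?thesis by (intro fin2) (simp add: algebra_simps)
  next
    case 3
    thus ?thesis using bd by (intro fin1 add_mono) auto
  next
    case 4
    thus ?thesis using bd by (intro fin2 add_mono) auto
  next
    case 5
    have "exp ((a g' + t g') + (- t g' - s g')) - exp (a g' + t g') \<le> exp ((a g + s g) + (- t g - s g)) - exp (a g + s g)"
      by (rule exp_increment_mono) (use 5 bd m1 in linarith)+
    thus ?thesis by (intro fin2) simp
  next
    case 6
    have "exp ((a g + t g) + (s g - t g)) - exp (a g + t g) \<le> exp ((a g' - s g') + (s g' - t g')) - exp (a g' - s g')"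
      by (rule exp_increment_mono) (use 6 bd m2 in linarith)+
    thus ?thesis by (intro fin1) simp
  qed
qed

text \<open>
  The contraction principle, obtained by treating one sign at a time: given the other signs,
  their contribution is part of the offset \<open>a\<close>, which is therefore arbitrary in the induction.
\<close>

lemma contraction:
  assumes I: "finite I" and T: "finite T" "T \<noteq> {}"
    and lip: "\<And>i g g'. i \<in> I \<Longrightarrow> g \<in> T \<Longrightarrow> g' \<in> T \<Longrightarrow> \<bar>s i g - s i g'\<bar> \<le> \<bar>t i g - (t i g' :: real)\<bar>"
    and le: "\<And>i g. i \<in> I \<Longrightarrow> g \<in> T \<Longrightarrow> \<bar>s i g\<bar> \<le> \<bar>t i g\<bar>"
  shows "sign_mean I (\<lambda>\<epsilon>. MAX g\<in>T. exp (a g + (\<Sum>i\<in>I. \<epsilon> i * s i g)))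
       \<le> sign_mean I (\<lambda>\<epsilon>. MAX g\<in>T. exp (a g + (\<Sum>i\<in>I. \<epsilon> i * t i g)))"
  using I lip le
proof (induction I arbitrary: a)
  case empty
  show ?case by simp
next
  case (insert j I)
  have "sign_mean (insert j I) (\<lambda>\<epsilon>. MAX g\<in>T. exp (a g + (\<Sum>i\<in>insert j I. \<epsilon> i * s i g)))
     = (sign_mean I (\<lambda>\<epsilon>. MAX g\<in>T. exp ((a g + s j g) + (\<Sum>i\<in>I. \<epsilon> i * s i g)))
      + sign_mean I (\<lambda>\<epsilon>. MAX g\<in>T. exp ((a g - s j g) + (\<Sum>i\<in>I. \<epsilon> i * s i g)))) / 2"
    unfolding sign_mean_insert[OF insert.hyps] sum_sign_upd[OF insert.hyps] by (simp add: algebra_simps)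
  also have "\<dots> \<le> (sign_mean I (\<lambda>\<epsilon>. MAX g\<in>T. exp ((a g + s j g) + (\<Sum>i\<in>I. \<epsilon> i * t i g)))
      + sign_mean I (\<lambda>\<epsilon>. MAX g\<in>T. exp ((a g - s j g) + (\<Sum>i\<in>I. \<epsilon> i * t i g)))) / 2"
    using insert.prems by (intro divide_right_mono add_mono insert.IH) auto
  also have "\<dots> = sign_mean I (\<lambda>\<epsilon>. ((MAX g\<in>T. exp ((a g + (\<Sum>i\<in>I. \<epsilon> i * t i g)) + s j g))
      + (MAX g\<in>T. exp ((a g + (\<Sum>i\<in>I. \<epsilon> i * t i g)) - s j g))) / 2)"
    by (simp add: sign_mean_add sign_mean_divide algebra_simps)
  also have "\<dots> \<le> sign_mean I (\<lambda>\<epsilon>. ((MAX g\<in>T. exp ((a g + (\<Sum>i\<in>I. \<epsilon> i * t i g)) + t j g))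
      + (MAX g\<in>T. exp ((a g + (\<Sum>i\<in>I. \<epsilon> i * t i g)) - t j g))) / 2)"
    using insert.prems T by (intro sign_mean_mono divide_right_mono contraction_step) auto
  also have "\<dots> = (sign_mean I (\<lambda>\<epsilon>. MAX g\<in>T. exp ((a g + t j g) + (\<Sum>i\<in>I. \<epsilon> i * t i g)))
      + sign_mean I (\<lambda>\<epsilon>. MAX g\<in>T. exp ((a g - t j g) + (\<Sum>i\<in>I. \<epsilon> i * t i g)))) / 2"
    by (simp add: sign_mean_add sign_mean_divide algebra_simps)
  also have "\<dots> = sign_mean (insert j I) (\<lambda>\<epsilon>. MAX g\<in>T. exp (a g + (\<Sum>i\<in>insert j I. \<epsilon> i * t i g)))"
    unfolding sign_mean_insert[OF insert.hyps] sum_sign_upd[OF insert.hyps] by (simp add: algebra_simps)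
  finally show ?case .
qed

section \<open>Symmetrization\<close>

text \<open>
  Convexity bounds the exponential of \<open>f - E f\<close>, shifted by \<open>b\<close>, by the mean of the exponentials with
  \<open>2 f\<close> and \<open>- 2 E f\<close> in its place; Jensen's inequality then moves the latter expectation outside.
  The two resulting terms are the two values of one random sign.
\<close>

lemma symmetrization_step:
  assumes "prob_space \<mu>" and T: "finite T" "T \<noteq> {}"
    and meas [measurable]: "\<And>g. g \<in> T \<Longrightarrow> f g \<in> borel_measurable \<mu>"
    and bnd: "\<And>g y. g \<in> T \<Longrightarrow> y \<in> space \<mu> \<Longrightarrow> \<bar>f g y\<bar> \<le> (K :: real)"
  shows "(\<integral>\<^sup>+y. ennreal (MAX g\<in>T. exp (b g + (f g y - (\<integral>z. f g z \<partial>\<mu>)))) \<partial>\<mu>)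
       \<le> (\<integral>\<^sup>+y. ennreal (((MAX g\<in>T. exp (b g + 2 * f g y)) + (MAX g\<in>T. exp (b g - 2 * f g y))) / 2) \<partial>\<mu>)"
proof -
  interpret prob_space \<mu> by fact
  have pos: "0 \<le> (MAX g\<in>T. exp (u g :: real))" for u
    using T by (meson Max_image_ge all_not_in_conv exp_ge_zero order_trans)
  define e where "e = (\<lambda>g. \<integral>z. f g z \<partial>\<mu>)"
  have int: "integrable \<mu> (f g)" if "g \<in> T" for g
    by (rule integrable_const_bound[where B = K]) (use that bnd in \<open>auto intro!: AE_I2\<close>)
  have inte: "integrable \<mu> (\<lambda>y. exp (b g - 2 * f g y))" if "g \<in> T" for g
  proof (rule integrable_const_bound[where B = "exp (b g + 2 * K)"])
    have "b g - 2 * f g y \<le> b g + 2 * K" if "y \<in> space \<mu>" for y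
      using bnd[OF \<open>g \<in> T\<close> that] by linarith
    thus "AE y in \<mu>. norm (exp (b g - 2 * f g y)) \<le> exp (b g + 2 * K)"
      by (intro AE_I2) simp
  qed (use that in measurable)
  have jensen: "ennreal (MAX g\<in>T. exp (b g - 2 * e g)) \<le> (\<integral>\<^sup>+y. ennreal (MAX g\<in>T. exp (b g - 2 * f g y)) \<partial>\<mu>)"
  proof -
    have "(MAX g\<in>T. exp (b g - 2 * e g)) \<in> (\<lambda>g. exp (b g - 2 * e g)) ` T"
      using T by (intro Max_in) auto
    then obtain g where g: "g \<in> T" "(MAX g\<in>T. exp (b g - 2 * e g)) = exp (b g - 2 * e g)"
      by blast
    have "exp (1 * (\<integral>y. b g - 2 * f g y \<partial>\<mu>)) \<le> (\<integral>y. exp (1 * (b g - 2 * f g y)) \<partial>\<mu>)"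
      by (rule jensens_inequality[where I = UNIV])
        (use int[OF g(1)] inte[OF g(1)] convex_on_exp[of 1] in auto)
    also have "(\<integral>y. b g - 2 * f g y \<partial>\<mu>) = b g - 2 * e g"
      using int[OF g(1)] by (simp add: e_def prob_space)
    finally have "ennreal (exp (b g - 2 * e g)) \<le> ennreal (\<integral>y. exp (b g - 2 * f g y) \<partial>\<mu>)"
      by (simp add: ennreal_leI)
    also have "\<dots> = (\<integral>\<^sup>+y. ennreal (exp (b g - 2 * f g y)) \<partial>\<mu>)"
      using inte[OF g(1)] by (intro nn_integral_eq_integral[symmetric]) auto
    also have "\<dots> \<le> (\<integral>\<^sup>+y. ennreal (MAX g\<in>T. exp (b g - 2 * f g y)) \<partial>\<mu>)"
      using Max_image_ge[OF T(1) g(1)] by (intro nn_integral_mono ennreal_leI)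
    finally show ?thesis using g(2) by simp
  qed
  have split: "(MAX g\<in>T. exp (b g + (f g y - e g)))
      \<le> (MAX g\<in>T. exp (b g + 2 * f g y)) / 2 + (MAX g\<in>T. exp (b g - 2 * e g)) / 2" for y
  proof (rule Max_image_le[OF T])
    fix g assume g: "g \<in> T"
    have mid: "exp ((p + q) / 2) \<le> exp p / 2 + exp q / 2" for p q :: real
      using convex_onD[OF convex_on_exp[of 1], of "1/2" p q] by (simp add: field_simps)
    have "exp (b g + (f g y - e g)) \<le> exp (b g + 2 * f g y) / 2 + exp (b g - 2 * e g) / 2"
    proof -
      have "b g + (f g y - e g) = ((b g + 2 * f g y) + (b g - 2 * e g)) / 2"
        by (simp add: field_simps)
      thus ?thesis by (simp only: mid)
    qed
    also have "\<dots> \<le> (MAX g\<in>T. exp (b g + 2 * f g y)) / 2 + (MAX g\<in>T. exp (b g - 2 * e g)) / 2"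
      using Max_image_ge[OF T(1) g] by (intro add_mono divide_right_mono) auto
    finally show "exp (b g + (f g y - e g)) \<le> \<dots>" .
  qed
  have "(\<integral>\<^sup>+y. ennreal (MAX g\<in>T. exp (b g + (f g y - e g))) \<partial>\<mu>)
      \<le> (\<integral>\<^sup>+y. ennreal ((MAX g\<in>T. exp (b g + 2 * f g y)) / 2 + (MAX g\<in>T. exp (b g - 2 * e g)) / 2) \<partial>\<mu>)"
    by (intro nn_integral_mono ennreal_leI split)
  also have "\<dots> = (\<integral>\<^sup>+y. ennreal ((MAX g\<in>T. exp (b g + 2 * f g y)) / 2) \<partial>\<mu>)
      + ennreal (MAX g\<in>T. exp (b g - 2 * e g)) / 2"
    using pos T by (simp add: ennreal_plus divide_ennreal[symmetric] nn_integral_add emeasure_space_1)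
  also have "\<dots> \<le> (\<integral>\<^sup>+y. ennreal ((MAX g\<in>T. exp (b g + 2 * f g y)) / 2) \<partial>\<mu>)
      + (\<integral>\<^sup>+y. ennreal (MAX g\<in>T. exp (b g - 2 * f g y)) \<partial>\<mu>) / 2"
    by (intro add_left_mono divide_right_mono_ennreal jensen)
  also have "\<dots> = (\<integral>\<^sup>+y. ennreal ((MAX g\<in>T. exp (b g + 2 * f g y)) / 2) \<partial>\<mu>)
      + (\<integral>\<^sup>+y. ennreal ((MAX g\<in>T. exp (b g - 2 * f g y)) / 2) \<partial>\<mu>)"
    using pos T by (simp add: nn_integral_divide[symmetric] divide_ennreal[symmetric])
  also have "\<dots> = (\<integral>\<^sup>+y. ennreal (((MAX g\<in>T. exp (b g + 2 * f g y)) + (MAX g\<in>T. exp (b g - 2 * f g y))) / 2) \<partial>\<mu>)"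
    using pos T by (simp add: nn_integral_add[symmetric] ennreal_plus[symmetric] add_divide_distrib del: ennreal_plus)
  finally show ?thesis by (simp add: e_def)
qed

text \<open>
  One sample is symmetrized at a time. The offset \<open>a\<close> absorbs the terms of the other samples, and
  Fubini's theorem allows the new coordinate to be integrated either first or last.
\<close>

lemma symmetrization:
  assumes "prob_space \<mu>" and T: "finite T" "T \<noteq> {}" and I: "finite I"
    and meas [measurable]: "\<And>g. g \<in> T \<Longrightarrow> f g \<in> borel_measurable \<mu>"
    and bnd: "\<And>g y. g \<in> T \<Longrightarrow> y \<in> space \<mu> \<Longrightarrow> \<bar>f g y\<bar> \<le> (K :: real)"
  shows "(\<integral>\<^sup>+x. ennreal (MAX g\<in>T. exp (a g + (\<Sum>i\<in>I. f g (x i) - (\<integral>z. f g z \<partial>\<mu>)))) \<partial>(\<Pi>\<^sub>M i\<in>I. \<mu>))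
       \<le> (\<integral>\<^sup>+x. ennreal (sign_mean I (\<lambda>\<epsilon>. MAX g\<in>T. exp (a g + (\<Sum>i\<in>I. \<epsilon> i * (2 * f g (x i)))))) \<partial>(\<Pi>\<^sub>M i\<in>I. \<mu>))"
  using I
proof (induction I arbitrary: a)
  case empty
  show ?case by (simp add: sign_mean_empty)
next
  case (insert j I)
  note fin = T(1) insert.hyps(1)
  interpret prob_space \<mu> by fact
  interpret product_sigma_finite "\<lambda>_. \<mu>" by standard
  define e where "e = (\<lambda>g. \<integral>z. f g z \<partial>\<mu>)"
  define Q where "Q = (\<lambda>a x. sign_mean I (\<lambda>\<epsilon>. MAX g\<in>T. exp (a g + (\<Sum>i\<in>I. \<epsilon> i * (2 * f g (x i))))))"
  have neq: "i \<in> I \<Longrightarrow> i \<noteq> j" for i using insert.hyps by auto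
  have upd: "(\<Sum>i\<in>insert j I. f g ((x(j := y)) i) - e g) = (f g y - e g) + (\<Sum>i\<in>I. f g (x i) - e g)" for g x y
    using insert.hyps by (simp cong: sum.cong if_cong add: neq)
  have updQ: "sign_mean (insert j I) (\<lambda>\<epsilon>. MAX g\<in>T. exp (a g + (\<Sum>i\<in>insert j I. \<epsilon> i * (2 * f g ((x(j := y)) i)))))
      = (Q (\<lambda>g. a g + 2 * f g y) x + Q (\<lambda>g. a g - 2 * f g y) x) / 2" for x y
  proof -
    have "(\<Sum>i\<in>insert j I. (\<epsilon>(j := s)) i * (2 * f g ((x(j := y)) i))) = s * (2 * f g y) + (\<Sum>i\<in>I. \<epsilon> i * (2 * f g (x i)))" for s \<epsilon> g
      unfolding sum_sign_upd[OF insert.hyps] using insert.hyps by (simp cong: sum.cong if_cong add: neq)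
    thus ?thesis
      unfolding sign_mean_insert[OF insert.hyps] Q_def by (simp add: algebra_simps)
  qed
  define S where "S = (\<lambda>a x. MAX g\<in>T. exp (a g + (\<Sum>i\<in>I. f g (x i) - e g)))"
  have max_pos: "0 \<le> (MAX g\<in>T. exp (u g :: real))" for u
    using T by (meson Max_image_ge all_not_in_conv exp_ge_zero order_trans)
  have S_pos: "0 \<le> S a x" for a x
    unfolding S_def by (rule max_pos)
  have Q_pos: "0 \<le> Q a x" for a x
    unfolding Q_def sign_mean_def by (intro divide_nonneg_nonneg sum_nonneg max_pos) auto
  have S_meas [measurable]: "S b \<in> borel_measurable (\<Pi>\<^sub>M i\<in>I. \<mu>)" for b
    unfolding S_def using fin by measurable
  have Q_meas [measurable]: "Q b \<in> borel_measurable (\<Pi>\<^sub>M i\<in>I. \<mu>)" for b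
    unfolding Q_def sign_mean_def using fin by measurable
  have half: "(\<integral>\<^sup>+x. ennreal ((A x + B x) / 2) \<partial>N) = (\<integral>\<^sup>+x. ennreal (A x) \<partial>N) / 2 + (\<integral>\<^sup>+x. ennreal (B x) \<partial>N) / 2"
    if [measurable]: "A \<in> borel_measurable N" "B \<in> borel_measurable N" and "\<And>x. 0 \<le> A x" "\<And>x. 0 \<le> B x"
    for A B N
  proof -
    have "(\<integral>\<^sup>+x. ennreal ((A x + B x) / 2) \<partial>N) = (\<integral>\<^sup>+x. ennreal (A x) / 2 + ennreal (B x) / 2 \<partial>N)"
      using that by (intro nn_integral_cong) (simp add: add_divide_distrib ennreal_plus divide_ennreal[symmetric])
    thus ?thesis by (simp add: nn_integral_add nn_integral_divide)
  qed
  have IH: "(\<integral>\<^sup>+x. ennreal (S b x) \<partial>(\<Pi>\<^sub>M i\<in>I. \<mu>)) \<le> (\<integral>\<^sup>+x. ennreal (Q b x) \<partial>(\<Pi>\<^sub>M i\<in>I. \<mu>))" for b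
    unfolding S_def Q_def e_def by (rule insert.IH)
  have swap: "(\<integral>\<^sup>+x. (\<integral>\<^sup>+y. ennreal ((S (\<lambda>g. a g + 2 * f g y) x + S (\<lambda>g. a g - 2 * f g y) x) / 2) \<partial>\<mu>) \<partial>(\<Pi>\<^sub>M i\<in>I. \<mu>))
     = (\<integral>\<^sup>+y. (\<integral>\<^sup>+x. ennreal ((S (\<lambda>g. a g + 2 * f g y) x + S (\<lambda>g. a g - 2 * f g y) x) / 2) \<partial>(\<Pi>\<^sub>M i\<in>I. \<mu>)) \<partial>\<mu>)"
  proof (rule pair_sigma_finite.Fubini'[symmetric])
    show "pair_sigma_finite (\<Pi>\<^sub>M i\<in>I. \<mu>) \<mu>"
      by (simp add: insert.hyps(1) pair_sigma_finite.intro sigma_finite sigma_finite_measure_axioms)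
    show "(\<lambda>(x, y). ennreal ((S (\<lambda>g. a g + 2 * f g y) x + S (\<lambda>g. a g - 2 * f g y) x) / 2))
        \<in> borel_measurable ((\<Pi>\<^sub>M i\<in>I. \<mu>) \<Otimes>\<^sub>M \<mu>)"
      unfolding S_def using fin by measurable
  qed
  have "(\<integral>\<^sup>+x. ennreal (MAX g\<in>T. exp (a g + (\<Sum>i\<in>insert j I. f g (x i) - e g))) \<partial>(\<Pi>\<^sub>M i\<in>insert j I. \<mu>))
      = (\<integral>\<^sup>+x. (\<integral>\<^sup>+y. ennreal (MAX g\<in>T. exp ((a g + (\<Sum>i\<in>I. f g (x i) - e g)) + (f g y - e g))) \<partial>\<mu>) \<partial>(\<Pi>\<^sub>M i\<in>I. \<mu>))"
    using insert.hyps fin T by (subst product_nn_integral_insert) (auto simp: upd[unfolded insert_def] upd algebra_simps simp del: sum.insert fun_upd_apply)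
  also have "\<dots> \<le> (\<integral>\<^sup>+x. (\<integral>\<^sup>+y. ennreal ((S (\<lambda>g. a g + 2 * f g y) x + S (\<lambda>g. a g - 2 * f g y) x) / 2) \<partial>\<mu>) \<partial>(\<Pi>\<^sub>M i\<in>I. \<mu>))"
  proof (rule nn_integral_mono)
    fix x
    show "(\<integral>\<^sup>+y. ennreal (MAX g\<in>T. exp ((a g + (\<Sum>i\<in>I. f g (x i) - e g)) + (f g y - e g))) \<partial>\<mu>)
        \<le> (\<integral>\<^sup>+y. ennreal ((S (\<lambda>g. a g + 2 * f g y) x + S (\<lambda>g. a g - 2 * f g y) x) / 2) \<partial>\<mu>)"
      using symmetrization_step[OF \<open>prob_space \<mu>\<close> T meas bnd, where b = "\<lambda>g. a g + (\<Sum>i\<in>I. f g (x i) - e g)"]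
      by (simp add: S_def e_def algebra_simps)
  qed
  also note swap
  also have "(\<integral>\<^sup>+y. (\<integral>\<^sup>+x. ennreal ((S (\<lambda>g. a g + 2 * f g y) x + S (\<lambda>g. a g - 2 * f g y) x) / 2) \<partial>(\<Pi>\<^sub>M i\<in>I. \<mu>)) \<partial>\<mu>)
     \<le> (\<integral>\<^sup>+y. (\<integral>\<^sup>+x. ennreal ((Q (\<lambda>g. a g + 2 * f g y) x + Q (\<lambda>g. a g - 2 * f g y) x) / 2) \<partial>(\<Pi>\<^sub>M i\<in>I. \<mu>)) \<partial>\<mu>)"
    unfolding half[OF S_meas S_meas S_pos S_pos] half[OF Q_meas Q_meas Q_pos Q_pos]
    by (rule nn_integral_mono) (intro add_mono divide_right_mono_ennreal IH)
  also have "\<dots> = (\<integral>\<^sup>+x. ennreal (sign_mean (insert j I) (\<lambda>\<epsilon>. MAX g\<in>T. exp (a g + (\<Sum>i\<in>insert j I. \<epsilon> i * (2 * f g (x i))))))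
      \<partial>(\<Pi>\<^sub>M i\<in>insert j I. \<mu>))"
  proof (subst product_nn_integral_insert_rev)
    show "(\<lambda>x. ennreal (sign_mean (insert j I) (\<lambda>\<epsilon>. MAX g\<in>T. exp (a g + (\<Sum>i\<in>insert j I. \<epsilon> i * (2 * f g (x i)))))))
        \<in> borel_measurable (\<Pi>\<^sub>M i\<in>insert j I. \<mu>)"
      unfolding sign_mean_def using fin by measurable
  qed (simp_all only: updQ insert.hyps not_False_eq_True)
  finally show ?case by (simp only: e_def)
qed

section \<open>Suprema over neurons\<close>

definition neuron_params :: "nat \<Rightarrow> ((nat \<Rightarrow> real) \<times> real) set" where
  "neuron_params d = {p. l1norm d (fst p) \<le> 1 \<and> \<bar>snd p\<bar> \<le> 1}"

definition affine_map :: "nat \<Rightarrow> (nat \<Rightarrow> real) \<times> real \<Rightarrow> (nat \<Rightarrow> real) \<Rightarrow> real" where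
  "affine_map d p x = dot d (fst p) x + snd p"

text \<open>
  Distance of two neurons, in the norm that controls the affine map on a bounded set of inputs.
\<close>

definition params_dist :: "nat \<Rightarrow> (nat \<Rightarrow> real) \<times> real \<Rightarrow> (nat \<Rightarrow> real) \<times> real \<Rightarrow> real" where
  "params_dist d p q = max (l1norm d (\<lambda>j. fst p j - fst q j)) \<bar>snd p - snd q\<bar>"

lemma abs_dot_le:
  assumes "\<And>j. j < d \<Longrightarrow> \<bar>y j\<bar> \<le> M"
  shows "\<bar>dot d u y\<bar> \<le> l1norm d u * M"
proof -
  have "\<bar>dot d u y\<bar> \<le> (\<Sum>j<d. \<bar>u j * y j\<bar>)"
    unfolding dot_def by (rule sum_abs)
  also have "\<dots> \<le> (\<Sum>j<d. \<bar>u j\<bar> * M)"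
    using assms by (intro sum_mono) (auto simp: abs_mult intro!: mult_left_mono)
  finally show ?thesis by (simp add: l1norm_def sum_distrib_right)
qed

lemma l1norm_nonneg: "0 \<le> l1norm d u"
  unfolding l1norm_def by (rule sum_nonneg) auto

lemma abs_affine_map_le:
  assumes "p \<in> neuron_params d" "\<And>j. j < d \<Longrightarrow> \<bar>y j\<bar> \<le> M" "0 \<le> M"
  shows "\<bar>affine_map d p y\<bar> \<le> M + 1"
proof -
  have "\<bar>dot d (fst p) y\<bar> \<le> l1norm d (fst p) * M"
    by (rule abs_dot_le) (rule assms(2))
  also have "\<dots> \<le> 1 * M"
    using assms by (intro mult_right_mono) (auto simp: neuron_params_def)
  finally have "\<bar>dot d (fst p) y\<bar> \<le> 1 * M" .
  thus ?thesis using assms(1) by (auto simp: affine_map_def neuron_params_def)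
qed

lemma exp_add_le_mean: "exp (p + q) \<le> (exp (2 * p) + exp (2 * q)) / 2" for p q :: real
  using convex_onD[OF convex_on_exp[of 1], of "1/2" "2 * p" "2 * q"] by (simp add: field_simps)

lemma exp_abs_le: "exp \<bar>u\<bar> \<le> exp u + exp (- u)" for u :: real
  by (cases "u \<ge> 0") auto

text \<open>
  A linear functional on an \<open>l\<^sub>1\<close>-ball is maximal at a vertex, so the maximum over \<open>W\<close>, whatever its size, is
  dominated by the maximum over the \<open>d\<close> coordinates with both signs, and this maximum of exponentials by
  their sum. The offset \<open>v\<close> is treated like one more
  coordinate, with the constant input 1.
\<close>

lemma linear_sign_mean_le:
  assumes I: "finite I" and d: "d \<ge> 1" and W: "finite W" "W \<noteq> {}"
    and x: "\<And>i j. i \<in> I \<Longrightarrow> j < d \<Longrightarrow> \<bar>x i j\<bar> \<le> M" and M: "0 \<le> M"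
    and \<tau>: "0 \<le> \<tau>" and u: "\<And>p. p \<in> W \<Longrightarrow> l1norm d (u p) \<le> r" and v: "\<And>p. p \<in> W \<Longrightarrow> \<bar>v p\<bar> \<le> r"
  shows "sign_mean I (\<lambda>\<epsilon>. MAX p\<in>W. exp (\<Sum>i\<in>I. \<epsilon> i * (\<tau> * (dot d (u p) (x i) + v p))))
       \<le> (real d + 1) * exp (2 * \<tau>\<^sup>2 * real (card I) * (r * (M + 1))\<^sup>2)"
proof -
  have r: "0 \<le> r" using W(2) v by (meson abs_ge_zero all_not_in_conv order_trans)
  define Z where "Z = (\<lambda>\<epsilon>.
     (\<Sum>j<d. (exp (\<Sum>i\<in>I. \<epsilon> i * (2 * \<tau> * r * x i j)) + exp (\<Sum>i\<in>I. \<epsilon> i * (- (2 * \<tau> * r * x i j)))) / 2)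
     + (exp (\<Sum>i\<in>I. \<epsilon> i * (2 * \<tau> * r)) + exp (\<Sum>i\<in>I. \<epsilon> i * (- (2 * \<tau> * r)))) / 2)"
  have dom: "(MAX p\<in>W. exp (\<Sum>i\<in>I. \<epsilon> i * (\<tau> * (dot d (u p) (x i) + v p)))) \<le> Z \<epsilon>" for \<epsilon>
  proof (rule Max_image_le[OF W])
    fix p assume p: "p \<in> W"
    define S where "S = (\<lambda>j. \<Sum>i\<in>I. \<epsilon> i * x i j)"
    define S0 where "S0 = (\<Sum>i\<in>I. \<epsilon> i)"
    have "(MAX j\<in>{..<d}. \<bar>S j\<bar>) \<in> (\<lambda>j. \<bar>S j\<bar>) ` {..<d}"
      using d by (intro Max_in) (auto simp: lessThan_empty_iff)
    then obtain m where m: "m < d" "(MAX j\<in>{..<d}. \<bar>S j\<bar>) = \<bar>S m\<bar>" by auto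
    have m_max: "\<bar>S j\<bar> \<le> \<bar>S m\<bar>" if "j < d" for j
      using Max_image_ge[of "{..<d}" j "\<lambda>j. \<bar>S j\<bar>"] that m(2) by simp
    have "(\<Sum>i\<in>I. \<epsilon> i * (\<tau> * (dot d (u p) (x i) + v p))) = \<tau> * (\<Sum>i\<in>I. \<epsilon> i * dot d (u p) (x i)) + \<tau> * (v p * S0)"
      by (simp add: S0_def sum_distrib_left sum.distrib algebra_simps)
    also have "(\<Sum>i\<in>I. \<epsilon> i * dot d (u p) (x i)) = (\<Sum>i\<in>I. \<Sum>j<d. u p j * (\<epsilon> i * x i j))"
      by (simp add: dot_def sum_distrib_left mult_ac)
    also have "\<dots> = dot d (u p) S"
      unfolding dot_def S_def sum_distrib_left by (rule sum.swap)
    finally have eq: "(\<Sum>i\<in>I. \<epsilon> i * (\<tau> * (dot d (u p) (x i) + v p))) = \<tau> * dot d (u p) S + \<tau> * (v p * S0)" .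
    have "\<bar>dot d (u p) S\<bar> \<le> l1norm d (u p) * \<bar>S m\<bar>"
      by (rule abs_dot_le) (rule m_max)
    also have "\<dots> \<le> r * \<bar>S m\<bar>"
      by (intro mult_right_mono u p) auto
    finally have b1: "2 * (\<tau> * dot d (u p) S) \<le> \<bar>2 * \<tau> * r * S m\<bar>"
      using \<tau> r mult_left_mono[of "dot d (u p) S" "r * \<bar>S m\<bar>" "2 * \<tau>"] by (simp add: abs_mult mult_ac)
    have "v p * S0 \<le> r * \<bar>S0\<bar>"
      using mult_right_mono[OF v[OF p], of "\<bar>S0\<bar>"] abs_ge_self[of "v p * S0"] by (simp add: abs_mult)
    hence b2: "2 * (\<tau> * (v p * S0)) \<le> \<bar>2 * \<tau> * r * S0\<bar>"
      using \<tau> r mult_left_mono[of "v p * S0" "r * \<bar>S0\<bar>" "2 * \<tau>"] by (simp add: abs_mult mult_ac)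
    have e1: "exp (2 * (\<tau> * dot d (u p) S)) \<le> exp (2 * \<tau> * r * S m) + exp (- (2 * \<tau> * r * S m))"
      using b1 by (intro order_trans[OF _ exp_abs_le]) simp
    have e2: "exp (2 * (\<tau> * (v p * S0))) \<le> exp (2 * \<tau> * r * S0) + exp (- (2 * \<tau> * r * S0))"
      using b2 by (intro order_trans[OF _ exp_abs_le]) simp
    have "exp (\<tau> * dot d (u p) S + \<tau> * (v p * S0))
        \<le> (exp (2 * (\<tau> * dot d (u p) S)) + exp (2 * (\<tau> * (v p * S0)))) / 2"
      by (rule exp_add_le_mean)
    also have "\<dots> \<le> (exp (2 * \<tau> * r * S m) + exp (- (2 * \<tau> * r * S m))) / 2
         + (exp (2 * \<tau> * r * S0) + exp (- (2 * \<tau> * r * S0))) / 2"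
      by (subst add_divide_distrib, intro add_mono divide_right_mono e1 e2) auto
    also have "\<dots> \<le> (\<Sum>j<d. (exp (2 * \<tau> * r * S j) + exp (- (2 * \<tau> * r * S j))) / 2)
         + (exp (2 * \<tau> * r * S0) + exp (- (2 * \<tau> * r * S0))) / 2"
      using m(1) by (intro add_right_mono member_le_sum[where f = "\<lambda>j. (exp (2 * \<tau> * r * S j) + exp (- (2 * \<tau> * r * S j))) / 2"])
        (auto intro: add_nonneg_nonneg)
    also have "\<dots> = Z \<epsilon>"
    proof -
      have "(\<Sum>i\<in>I. \<epsilon> i * (c * x i j)) = c * S j" "(\<Sum>i\<in>I. \<epsilon> i * - (c * x i j)) = - (c * S j)" for c j
        by (simp_all add: S_def sum_distrib_left sum_negf mult_ac)
      moreover have "(\<Sum>i\<in>I. \<epsilon> i * c) = c * S0" "(\<Sum>i\<in>I. \<epsilon> i * - c) = - (c * S0)" for c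
        by (simp_all add: S0_def sum_distrib_right[symmetric] sum_negf)
      ultimately show ?thesis by (simp only: Z_def)
    qed
    finally show "exp (\<Sum>i\<in>I. \<epsilon> i * (\<tau> * (dot d (u p) (x i) + v p))) \<le> Z \<epsilon>"
      using eq by simp
  qed
  define b where "b = exp (2 * \<tau>\<^sup>2 * real (card I) * (r * (M + 1))\<^sup>2)"
  have mgf: "sign_mean I (\<lambda>\<epsilon>. exp (\<Sum>i\<in>I. \<epsilon> i * t i)) \<le> b"
    if "\<And>i. i \<in> I \<Longrightarrow> \<bar>t i\<bar> \<le> 2 * \<tau> * r * (M + 1)" for t
  proof -
    have "sign_mean I (\<lambda>\<epsilon>. exp (\<Sum>i\<in>I. \<epsilon> i * t i)) \<le> exp (real (card I) * (2 * \<tau> * r * (M + 1))\<^sup>2 / 2)"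
      by (rule sign_mean_exp_uniform_le[OF I]) (rule that)
    also have "real (card I) * (2 * \<tau> * r * (M + 1))\<^sup>2 / 2 = 2 * \<tau>\<^sup>2 * real (card I) * (r * (M + 1))\<^sup>2"
      by (simp only: power_mult_distrib) simp
    finally show ?thesis by (simp only: b_def)
  qed
  have x1: "\<bar>2 * \<tau> * r * x i j\<bar> \<le> 2 * \<tau> * r * (M + 1)" if "i \<in> I" "j < d" for i j
    using x[OF that] \<tau> r by (auto simp: abs_mult intro!: mult_left_mono)
  have x2: "\<bar>2 * \<tau> * r\<bar> \<le> 2 * \<tau> * r * (M + 1)"
    using M \<tau> r mult_left_mono[of 1 "M + 1" "2 * \<tau> * r"] by simp
  have "sign_mean I (\<lambda>\<epsilon>. MAX p\<in>W. exp (\<Sum>i\<in>I. \<epsilon> i * (\<tau> * (dot d (u p) (x i) + v p)))) \<le> sign_mean I Z"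
    by (intro sign_mean_mono dom)
  also have "\<dots> \<le> (\<Sum>j<d. (b + b) / 2) + (b + b) / 2"
    unfolding Z_def sign_mean_add sign_mean_sum sign_mean_divide
    by (intro add_mono sum_mono divide_right_mono mgf) (use x1 x2 in auto)
  also have "\<dots> = (real d + 1) * b"
    by (simp add: algebra_simps)
  finally show ?thesis by (simp add: b_def)
qed

text \<open>
  Each neuron is its centre in the net \<open>N\<close> plus an increment. The centres are finitely many fixed
  functions bounded by \<open>B\<close>. The increments around one centre vanish with the difference of the affine
  maps and are 1-Lipschitz in it, so contraction makes them linear, and on the scale \<open>r\<close> of the net the
  linear functionals are bounded by \<open>r (M + 1) \<le> B\<close>. So centres and increments have the same
  variance proxy, although the affine maps themselves may be much larger than \<open>B\<close>.
\<close>

lemma neuron_sign_mean_le: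
  assumes I: "finite I" and d: "d \<ge> 1" and W: "finite W" "W \<noteq> {}" "W \<subseteq> neuron_params d"
    and x: "\<And>i j. i \<in> I \<Longrightarrow> j < d \<Longrightarrow> \<bar>x i j\<bar> \<le> M" and M: "0 \<le> M"
    and N: "finite N" "N \<subseteq> neuron_params d" and net: "\<And>p. p \<in> W \<Longrightarrow> \<exists>c\<in>N. params_dist d p c \<le> r"
    and lip: "\<And>s t. \<bar>\<phi> s - \<phi> t\<bar> \<le> \<bar>s - t\<bar>" and \<phi>: "\<And>s. \<bar>s\<bar> \<le> M + 1 \<Longrightarrow> \<bar>\<phi> s\<bar> \<le> B"
    and r: "0 \<le> r" "r * (M + 1) \<le> B" and \<tau>: "0 \<le> \<tau>"
  shows "sign_mean I (\<lambda>\<epsilon>. MAX p\<in>W. exp (\<Sum>i\<in>I. \<epsilon> i * (\<tau> * \<phi> (affine_map d p (x i)))))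
       \<le> real (card N) * ((real d + 1) * exp (8 * \<tau>\<^sup>2 * real (card I) * B\<^sup>2))"
proof -
  define b where "b = exp (8 * \<tau>\<^sup>2 * real (card I) * B\<^sup>2)"
  define Wc where "Wc = (\<lambda>c. insert c {p \<in> W. params_dist d p c \<le> r})"
  define \<Delta> where "\<Delta> = (\<lambda>c p y. \<phi> (affine_map d p y) - \<phi> (affine_map d c y))"
  have Wc: "finite (Wc c)" "Wc c \<noteq> {}" for c
    using W(1) by (auto simp: Wc_def)
  have B: "0 \<le> B" using r M by (intro order_trans[OF mult_nonneg_nonneg r(2)]) auto
  have Wc_dist: "params_dist d p c \<le> r" if "p \<in> Wc c" for p c
    using that r by (auto simp: Wc_def params_dist_def l1norm_def)
  define Z where "Z = (\<lambda>c \<epsilon>. (exp (\<Sum>i\<in>I. \<epsilon> i * (2 * \<tau> * \<phi> (affine_map d c (x i))))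
     + (MAX p\<in>Wc c. exp (0 + (\<Sum>i\<in>I. \<epsilon> i * (2 * \<tau> * \<Delta> c p (x i)))))) / 2)"
  have Z_nonneg: "0 \<le> Z c \<epsilon>" for c \<epsilon>
  proof -
    have "0 \<le> (MAX p\<in>Wc c. exp (0 + (\<Sum>i\<in>I. \<epsilon> i * (2 * \<tau> * \<Delta> c p (x i)))))"
      using Wc[of c] by (meson Max_image_ge all_not_in_conv exp_ge_zero order_trans)
    thus ?thesis by (simp add: Z_def)
  qed
  have dom: "(MAX p\<in>W. exp (\<Sum>i\<in>I. \<epsilon> i * (\<tau> * \<phi> (affine_map d p (x i))))) \<le> (\<Sum>c\<in>N. Z c \<epsilon>)" for \<epsilon>
  proof (rule Max_image_le[OF W(1,2)])
    fix p assume p: "p \<in> W"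
    then obtain c where c: "c \<in> N" "params_dist d p c \<le> r" using net by blast
    have pc: "p \<in> Wc c" using p c by (simp add: Wc_def)
    have "exp (\<Sum>i\<in>I. \<epsilon> i * (\<tau> * \<phi> (affine_map d p (x i))))
        = exp ((\<Sum>i\<in>I. \<epsilon> i * (\<tau> * \<phi> (affine_map d c (x i)))) + (\<Sum>i\<in>I. \<epsilon> i * (\<tau> * \<Delta> c p (x i))))"
      by (simp add: \<Delta>_def sum.distrib[symmetric] algebra_simps)
    also have "\<dots> \<le> (exp (2 * (\<Sum>i\<in>I. \<epsilon> i * (\<tau> * \<phi> (affine_map d c (x i))))) + exp (2 * (\<Sum>i\<in>I. \<epsilon> i * (\<tau> * \<Delta> c p (x i))))) / 2"
      by (rule exp_add_le_mean)
    also have "\<dots> = (exp (\<Sum>i\<in>I. \<epsilon> i * (2 * \<tau> * \<phi> (affine_map d c (x i)))) + exp (0 + (\<Sum>i\<in>I. \<epsilon> i * (2 * \<tau> * \<Delta> c p (x i))))) / 2"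
      by (simp add: sum_distrib_left mult_ac)
    also have "\<dots> \<le> Z c \<epsilon>"
      unfolding Z_def using Wc pc by (intro divide_right_mono add_left_mono Max_image_ge) auto
    also have "\<dots> \<le> (\<Sum>c\<in>N. Z c \<epsilon>)"
      by (rule member_le_sum) (use c N Z_nonneg in auto)
    finally show "exp (\<Sum>i\<in>I. \<epsilon> i * (\<tau> * \<phi> (affine_map d p (x i)))) \<le> \<dots>" .
  qed
  have Z_mean: "sign_mean I (Z c) \<le> (real d + 1) * b" if c: "c \<in> N" for c
  proof -
    have "sign_mean I (\<lambda>\<epsilon>. exp (\<Sum>i\<in>I. \<epsilon> i * (2 * \<tau> * \<phi> (affine_map d c (x i))))) \<le> exp (real (card I) * (2 * \<tau> * B)\<^sup>2 / 2)"
    proof (rule sign_mean_exp_uniform_le[OF I])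
      fix i assume "i \<in> I"
      hence "\<bar>\<phi> (affine_map d c (x i))\<bar> \<le> B"
        using c N x M by (intro \<phi> abs_affine_map_le) auto
      thus "\<bar>2 * \<tau> * \<phi> (affine_map d c (x i))\<bar> \<le> 2 * \<tau> * B"
        using \<tau> by (simp add: abs_mult mult_left_mono)
    qed
    also have "\<dots> \<le> b"
      by (auto simp: b_def power_mult_distrib intro!: mult_right_mono)
    finally have center: "sign_mean I (\<lambda>\<epsilon>. exp (\<Sum>i\<in>I. \<epsilon> i * (2 * \<tau> * \<phi> (affine_map d c (x i))))) \<le> b" .
    let ?u = "\<lambda>p j. fst p j - fst c j" and ?v = "\<lambda>p. snd p - snd c"
    have aff: "dot d (?u p) y + ?v p = affine_map d p y - affine_map d c y" for p y
      by (simp add: affine_map_def dot_def left_diff_distrib sum_subtractf)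
    have "sign_mean I (\<lambda>\<epsilon>. MAX p\<in>Wc c. exp (0 + (\<Sum>i\<in>I. \<epsilon> i * (2 * \<tau> * \<Delta> c p (x i)))))
        \<le> sign_mean I (\<lambda>\<epsilon>. MAX p\<in>Wc c. exp (0 + (\<Sum>i\<in>I. \<epsilon> i * (2 * \<tau> * (dot d (?u p) (x i) + ?v p)))))"
    proof (rule contraction[OF I Wc])
      fix i p q
      have "\<bar>\<Delta> c p (x i) - \<Delta> c q (x i)\<bar> \<le> \<bar>(dot d (?u p) (x i) + ?v p) - (dot d (?u q) (x i) + ?v q)\<bar>"
        unfolding aff \<Delta>_def using lip[of "affine_map d p (x i)" "affine_map d q (x i)"] by simp
      from mult_left_mono[OF this, of "2 * \<tau>"] \<tau>
      show "\<bar>2 * \<tau> * \<Delta> c p (x i) - 2 * \<tau> * \<Delta> c q (x i)\<bar>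
          \<le> \<bar>2 * \<tau> * (dot d (?u p) (x i) + ?v p) - 2 * \<tau> * (dot d (?u q) (x i) + ?v q)\<bar>"
        unfolding right_diff_distrib[symmetric] abs_mult by simp
      have "\<bar>\<Delta> c p (x i)\<bar> \<le> \<bar>dot d (?u p) (x i) + ?v p\<bar>"
        unfolding aff \<Delta>_def by (rule lip)
      from mult_left_mono[OF this, of "2 * \<tau>"] \<tau>
      show "\<bar>2 * \<tau> * \<Delta> c p (x i)\<bar> \<le> \<bar>2 * \<tau> * (dot d (?u p) (x i) + ?v p)\<bar>"
        unfolding abs_mult by simp
    qed
    also have "\<dots> \<le> (real d + 1) * exp (2 * (2 * \<tau>)\<^sup>2 * real (card I) * (r * (M + 1))\<^sup>2)"
      unfolding add_0 by (rule linear_sign_mean_le[OF I d Wc x M])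
        (use Wc_dist \<tau> in \<open>auto simp: params_dist_def\<close>)
    also have "\<dots> \<le> (real d + 1) * b"
    proof -
      have "(r * (M + 1))\<^sup>2 \<le> B\<^sup>2" using r M by (intro power_mono) auto
      thus ?thesis unfolding b_def by (intro mult_left_mono) (auto simp: power_mult_distrib intro!: mult_left_mono)
    qed
    finally have incr: "sign_mean I (\<lambda>\<epsilon>. MAX p\<in>Wc c. exp (0 + (\<Sum>i\<in>I. \<epsilon> i * (2 * \<tau> * \<Delta> c p (x i))))) \<le> (real d + 1) * b" .
    have "sign_mean I (Z c) \<le> (b + (real d + 1) * b) / 2"
      unfolding Z_def sign_mean_divide sign_mean_add
      by (intro divide_right_mono add_mono center incr) auto
    also have "\<dots> \<le> (real d + 1) * b"
      by (simp add: b_def field_simps)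
    finally show ?thesis .
  qed
  have "sign_mean I (\<lambda>\<epsilon>. MAX p\<in>W. exp (\<Sum>i\<in>I. \<epsilon> i * (\<tau> * \<phi> (affine_map d p (x i))))) \<le> sign_mean I (\<lambda>\<epsilon>. \<Sum>c\<in>N. Z c \<epsilon>)"
    by (intro sign_mean_mono dom)
  also have "\<dots> = (\<Sum>c\<in>N. sign_mean I (Z c))"
    by (rule sign_mean_sum)
  also have "\<dots> \<le> (\<Sum>c\<in>N. (real d + 1) * b)"
    by (intro sum_mono Z_mean)
  finally show ?thesis by (simp add: b_def)
qed

section \<open>Suprema over networks\<close>

text \<open>
  The normal form of a member of \<open>nn_star\<close>: the constraint \<open>a\<^sub>4 = 0\<close> makes the linear term vanish.
\<close>

definition network :: "nat \<Rightarrow> nat \<Rightarrow> (real \<Rightarrow> real) \<Rightarrow> (nat \<Rightarrow> real) \<Rightarrow> (nat \<Rightarrow> (nat \<Rightarrow> real) \<times> real) \<Rightarrow> real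
    \<Rightarrow> (nat \<Rightarrow> real) \<Rightarrow> real" where
  "network d k \<phi> \<beta> p b0 x = (\<Sum>i=1..k. \<beta> i * \<phi> (affine_map d (p i) x)) + b0"

lemma l1norm_le_0_imp_dot: "l1norm d u \<le> 0 \<Longrightarrow> dot d u x = 0"
proof -
  assume "l1norm d u \<le> 0"
  hence "(\<Sum>j<d. \<bar>u j\<bar>) = 0" by (metis l1norm_def l1norm_nonneg order_antisym)
  hence "u j = 0" if "j < d" for j using that by (simp add: sum_nonneg_eq_0_iff)
  thus ?thesis by (simp add: dot_def)
qed

lemma nn_star_iff:
  "g \<in> nn_star d k \<phi> \<longleftrightarrow> (\<exists>\<beta> p b0. (\<forall>i\<in>{1..k}. p i \<in> neuron_params d \<and> \<bar>\<beta> i\<bar> \<le> 1) \<and> \<bar>b0\<bar> \<le> 1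
      \<and> g = network d k \<phi> \<beta> p b0)" (is "_ \<longleftrightarrow> ?R")
proof
  assume "g \<in> nn_star d k \<phi>"
  then obtain \<beta> w b w0 b0 where 1: "\<forall>i\<in>{1..k}. l1norm d (w i) \<le> 1 \<and> \<bar>b i\<bar> \<le> 1 \<and> \<bar>\<beta> i\<bar> \<le> 1"
    "\<bar>b0\<bar> \<le> 1" "l1norm d w0 \<le> 0"
    and g: "g = (\<lambda>x. (\<Sum>i=1..k. \<beta> i * \<phi> (dot d (w i) x + b i)) + dot d w0 x + b0)"
    unfolding nn_star_def nn_class_def by blast
  have "g = network d k \<phi> \<beta> (\<lambda>i. (w i, b i)) b0"
    using 1(3) by (simp add: g network_def affine_map_def l1norm_le_0_imp_dot fun_eq_iff)
  thus ?R using 1 by (intro exI[of _ \<beta>] exI[of _ "\<lambda>i. (w i, b i)"] exI[of _ b0]) (simp add: neuron_params_def)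
next
  assume ?R
  then obtain \<beta> p b0 where 1: "\<forall>i\<in>{1..k}. p i \<in> neuron_params d \<and> \<bar>\<beta> i\<bar> \<le> 1" "\<bar>b0\<bar> \<le> 1"
    and g: "g = network d k \<phi> \<beta> p b0" by blast
  show "g \<in> nn_star d k \<phi>"
    unfolding nn_star_def nn_class_def mem_Collect_eq
    by (rule exI[of _ \<beta>], rule exI[of _ "\<lambda>i. fst (p i)"], rule exI[of _ "\<lambda>i. snd (p i)"], rule exI[of _ "\<lambda>_. 0"], rule exI[of _ b0])
      (use 1 in \<open>auto simp: g network_def affine_map_def neuron_params_def l1norm_def dot_def fun_eq_iff\<close>)
qed

text \<open>
  The signed sum of a network is at most \<open>k\<close> times the largest absolute value of the signed sum of a
  neuron plus the absolute value of the sum of the signs, as all outer coefficients are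
  at most 1. The absolute value is resolved by applying the bound for neurons
  to \<open>\<phi>\<close> and to \<open>- \<phi>\<close>.
\<close>

lemma network_sign_mean_le:
  assumes I: "finite I" and d: "d \<ge> 1" and k: "k \<ge> 1" and T: "finite T" "T \<noteq> {}" "T \<subseteq> nn_star d k \<phi>"
    and x: "\<And>i j. i \<in> I \<Longrightarrow> j < d \<Longrightarrow> \<bar>x i j\<bar> \<le> M" and M: "0 \<le> M"
    and N: "finite N" "N \<subseteq> neuron_params d" and net: "\<And>p. p \<in> neuron_params d \<Longrightarrow> \<exists>c\<in>N. params_dist d p c \<le> r"
    and lip: "\<And>s t. \<bar>\<phi> s - \<phi> t\<bar> \<le> \<bar>s - t\<bar>" and \<phi>: "\<And>s. \<bar>s\<bar> \<le> M + 1 \<Longrightarrow> \<bar>\<phi> s\<bar> \<le> B"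
    and r: "0 \<le> r" "r * (M + 1) \<le> B" and \<theta>: "0 \<le> \<theta>"
  shows "sign_mean I (\<lambda>\<epsilon>. MAX g\<in>T. exp (\<Sum>i\<in>I. \<epsilon> i * (\<theta> * g (x i))))
       \<le> 2 * real (card N) * (real d + 1) * exp (32 * \<theta>\<^sup>2 * real (card I) * (real k * B + 1)\<^sup>2)"
proof -
  have "\<forall>g\<in>T. \<exists>\<beta> p b0. (\<forall>i\<in>{1..k}. p i \<in> neuron_params d \<and> \<bar>\<beta> i\<bar> \<le> 1) \<and> \<bar>b0\<bar> \<le> 1 \<and> g = network d k \<phi> \<beta> p b0"
    using T(3) nn_star_iff by blast
  then obtain \<beta> p b0 where par: "\<And>g l. g \<in> T \<Longrightarrow> l \<in> {1..k} \<Longrightarrow> p g l \<in> neuron_params d \<and> \<bar>\<beta> g l\<bar> \<le> (1::real)"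
    "\<And>g. g \<in> T \<Longrightarrow> \<bar>b0 g\<bar> \<le> (1::real) \<and> g = network d k \<phi> (\<beta> g) (p g) (b0 g)"
    by metis
  define W where "W = (\<Union>g\<in>T. p g ` {1..k})"
  have W: "finite W" "W \<noteq> {}" "W \<subseteq> neuron_params d"
    using T k par(1) by (auto simp: W_def)
  have B: "0 \<le> B" using r M by (intro order_trans[OF mult_nonneg_nonneg r(2)]) auto
  define Z1 where "Z1 = (\<lambda>\<epsilon>. MAX q\<in>W. exp (\<Sum>i\<in>I. \<epsilon> i * ((2 * \<theta> * real k) * \<phi> (affine_map d q (x i)))))"
  define Z2 where "Z2 = (\<lambda>\<epsilon>. MAX q\<in>W. exp (\<Sum>i\<in>I. \<epsilon> i * ((2 * \<theta> * real k) * - \<phi> (affine_map d q (x i)))))"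
  define Z3 where "Z3 = (\<lambda>\<epsilon>. exp (\<Sum>i\<in>I. \<epsilon> i * (2 * \<theta>)) + exp (\<Sum>i\<in>I. \<epsilon> i * (- (2 * \<theta>))))"
  have dom: "(MAX g\<in>T. exp (\<Sum>i\<in>I. \<epsilon> i * (\<theta> * g (x i)))) \<le> ((Z1 \<epsilon> + Z2 \<epsilon>) + Z3 \<epsilon>) / 2" for \<epsilon>
  proof (rule Max_image_le[OF T(1,2)])
    fix g assume g: "g \<in> T"
    define S where "S = (\<lambda>q. \<Sum>i\<in>I. \<epsilon> i * \<phi> (affine_map d q (x i)))"
    define S0 where "S0 = (\<Sum>i\<in>I. \<epsilon> i)"
    have "(MAX q\<in>W. \<bar>S q\<bar>) \<in> (\<lambda>q. \<bar>S q\<bar>) ` W"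
      using W by (intro Max_in) auto
    then obtain m where m: "m \<in> W" "(MAX q\<in>W. \<bar>S q\<bar>) = \<bar>S m\<bar>" by auto
    have Sc: "(\<Sum>i\<in>I. \<epsilon> i * (c * \<phi> (affine_map d q (x i)))) = c * S q" for c q
      by (simp add: S_def sum_distrib_left mult_ac)
    have Sc': "(\<Sum>i\<in>I. \<epsilon> i * (c * - \<phi> (affine_map d q (x i)))) = - (c * S q)" for c q
      using Sc[of "- c" q] by simp
    have m_max: "\<bar>S q\<bar> \<le> \<bar>S m\<bar>" if "q \<in> W" for q
      using Max_image_ge[of W q "\<lambda>q. \<bar>S q\<bar>"] that m(2) W(1) by simp
    have g_eq: "g y = (\<Sum>l=1..k. \<beta> g l * \<phi> (affine_map d (p g l) y)) + b0 g" for y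
      using par(2)[OF g] unfolding network_def by metis
    have "\<epsilon> i * (\<theta> * g (x i)) = \<theta> * (\<Sum>l=1..k. \<beta> g l * (\<epsilon> i * \<phi> (affine_map d (p g l) (x i)))) + \<theta> * (b0 g * \<epsilon> i)" for i
    proof -
      have "(\<Sum>l=1..k. \<beta> g l * (\<epsilon> i * \<phi> (affine_map d (p g l) (x i)))) = \<epsilon> i * (\<Sum>l=1..k. \<beta> g l * \<phi> (affine_map d (p g l) (x i)))"
        by (simp add: sum_distrib_left mult_ac)
      thus ?thesis by (subst g_eq) (simp only: distrib_left mult_ac)
    qed
    hence "(\<Sum>i\<in>I. \<epsilon> i * (\<theta> * g (x i)))
        = \<theta> * (\<Sum>i\<in>I. \<Sum>l=1..k. \<beta> g l * (\<epsilon> i * \<phi> (affine_map d (p g l) (x i)))) + \<theta> * (b0 g * S0)"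
      by (simp only: S0_def sum_distrib_left[symmetric] sum.distrib)
    also have "(\<Sum>i\<in>I. \<Sum>l=1..k. \<beta> g l * (\<epsilon> i * \<phi> (affine_map d (p g l) (x i)))) = (\<Sum>l=1..k. \<beta> g l * S (p g l))"
      unfolding S_def sum_distrib_left by (rule sum.swap)
    finally have eq: "(\<Sum>i\<in>I. \<epsilon> i * (\<theta> * g (x i))) = \<theta> * (\<Sum>l=1..k. \<beta> g l * S (p g l)) + \<theta> * (b0 g * S0)" .
    have "(\<Sum>l=1..k. \<beta> g l * S (p g l)) \<le> (\<Sum>l=1..k. 1 * \<bar>S m\<bar>)"
    proof (rule sum_mono)
      fix l assume l: "l \<in> {1..k}"
      have "\<bar>\<beta> g l\<bar> * \<bar>S (p g l)\<bar> \<le> 1 * \<bar>S m\<bar>"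
      proof (rule mult_mono)
        have "p g l \<in> W" using g l unfolding W_def by blast
        thus "\<bar>S (p g l)\<bar> \<le> \<bar>S m\<bar>" by (rule m_max)
      qed (use par(1)[OF g l] in auto)
      thus "\<beta> g l * S (p g l) \<le> 1 * \<bar>S m\<bar>"
        using abs_ge_self[of "\<beta> g l * S (p g l)"] by (simp add: abs_mult)
    qed
    hence b1: "2 * (\<theta> * (\<Sum>l=1..k. \<beta> g l * S (p g l))) \<le> \<bar>2 * \<theta> * real k * S m\<bar>"
      using \<theta> mult_left_mono[of "\<Sum>l=1..k. \<beta> g l * S (p g l)" "real k * \<bar>S m\<bar>" "2 * \<theta>"] by (simp add: abs_mult mult_ac)
    have "\<bar>b0 g\<bar> * \<bar>S0\<bar> \<le> 1 * \<bar>S0\<bar>"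
      using par(2)[OF g] by (intro mult_right_mono) auto
    hence "b0 g * S0 \<le> \<bar>S0\<bar>"
      using abs_ge_self[of "b0 g * S0"] by (simp add: abs_mult)
    hence b2: "2 * (\<theta> * (b0 g * S0)) \<le> \<bar>2 * \<theta> * S0\<bar>"
      using \<theta> mult_left_mono[of "b0 g * S0" "\<bar>S0\<bar>" "2 * \<theta>"] by (simp add: abs_mult mult_ac)
    have "exp (2 * (\<theta> * (\<Sum>l=1..k. \<beta> g l * S (p g l)))) \<le> exp (2 * \<theta> * real k * S m) + exp (- (2 * \<theta> * real k * S m))"
      using b1 by (intro order_trans[OF _ exp_abs_le]) simp
    also have "\<dots> \<le> Z1 \<epsilon> + Z2 \<epsilon>"
    proof (rule add_mono)
      show "exp (2 * \<theta> * real k * S m) \<le> Z1 \<epsilon>"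
        using Max_image_ge[OF W(1) m(1), of "\<lambda>q. exp (2 * \<theta> * real k * S q)"]
        by (simp only: Z1_def Sc)
      show "exp (- (2 * \<theta> * real k * S m)) \<le> Z2 \<epsilon>"
        using Max_image_ge[OF W(1) m(1), of "\<lambda>q. exp (- (2 * \<theta> * real k * S q))"]
        by (simp only: Z2_def Sc')
    qed
    finally have e1: "exp (2 * (\<theta> * (\<Sum>l=1..k. \<beta> g l * S (p g l)))) \<le> Z1 \<epsilon> + Z2 \<epsilon>" .
    have e2: "exp (2 * (\<theta> * (b0 g * S0))) \<le> Z3 \<epsilon>"
    proof -
      have "exp (2 * (\<theta> * (b0 g * S0))) \<le> exp \<bar>2 * \<theta> * S0\<bar>" using b2 by simp
      also have "\<dots> \<le> exp (2 * \<theta> * S0) + exp (- (2 * \<theta> * S0))" by (rule exp_abs_le)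
      also have "\<dots> = Z3 \<epsilon>"
        unfolding Z3_def S0_def sum_distrib_right[symmetric] by (simp add: mult_ac)
      finally show ?thesis .
    qed
    show "exp (\<Sum>i\<in>I. \<epsilon> i * (\<theta> * g (x i))) \<le> ((Z1 \<epsilon> + Z2 \<epsilon>) + Z3 \<epsilon>) / 2"
      unfolding eq by (rule order_trans[OF exp_add_le_mean]) (use e1 e2 in simp)
  qed
  define e where "e = exp (32 * \<theta>\<^sup>2 * real (card I) * (real k * B + 1)\<^sup>2)"
  define K where "K = real (card N) * (real d + 1)"
  have "N \<noteq> {}" using net W by blast
  hence "card N \<ge> 1" using N(1) by (simp add: Suc_leI card_gt_0_iff)
  hence K: "K \<ge> 1" unfolding K_def by (intro mult_ge1_I) auto
  have le_e: "real (card N) * ((real d + 1) * exp (8 * (2 * \<theta> * real k)\<^sup>2 * real (card I) * B\<^sup>2)) \<le> K * e"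
  proof -
    have "(real k * B)\<^sup>2 \<le> (real k * B + 1)\<^sup>2" using B by (intro power_mono) auto
    hence "32 * \<theta>\<^sup>2 * real (card I) * (real k * B)\<^sup>2 \<le> 32 * \<theta>\<^sup>2 * real (card I) * (real k * B + 1)\<^sup>2"
      by (intro mult_left_mono) auto
    moreover have "8 * (2 * \<theta> * real k)\<^sup>2 * real (card I) * B\<^sup>2 = 32 * \<theta>\<^sup>2 * real (card I) * (real k * B)\<^sup>2"
      by (simp add: power_mult_distrib)
    ultimately have "exp (8 * (2 * \<theta> * real k)\<^sup>2 * real (card I) * B\<^sup>2) \<le> e"
      unfolding e_def by (simp only: exp_le_cancel_iff)
    thus ?thesis unfolding K_def mult.assoc by (intro mult_left_mono) auto
  qed
  have m1: "sign_mean I Z1 \<le> K * e"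
    unfolding Z1_def
    by (rule order_trans[OF neuron_sign_mean_le[OF I d W x M N _ lip \<phi> r] le_e]) (use net W \<theta> in auto)
  have m2: "sign_mean I Z2 \<le> K * e"
    unfolding Z2_def
    by (rule order_trans[OF neuron_sign_mean_le[OF I d W x M N, where \<phi> = "\<lambda>s. - \<phi> s" and r = r] le_e])
      (use net W \<theta> lip \<phi> r in \<open>auto simp: abs_minus_commute\<close>)
  have m3: "sign_mean I Z3 \<le> e + e"
  proof -
    have "sign_mean I (\<lambda>\<epsilon>. exp (\<Sum>i\<in>I. \<epsilon> i * t)) \<le> e" if "\<bar>t\<bar> \<le> 2 * \<theta>" for t
    proof -
      have "1\<^sup>2 \<le> (real k * B + 1)\<^sup>2" using B by (intro power_mono) auto
      hence "real (card I) * (2 * \<theta>)\<^sup>2 / 2 \<le> 32 * \<theta>\<^sup>2 * real (card I) * (real k * B + 1)\<^sup>2"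
        using mult_left_mono[of "1/16" "(real k * B + 1)\<^sup>2" "32 * \<theta>\<^sup>2 * real (card I)"]
        by (simp add: power_mult_distrib mult_ac)
      thus ?thesis
        using sign_mean_exp_uniform_le[OF I, of "\<lambda>_. t" "2 * \<theta>"] that unfolding e_def by (meson exp_le_cancel_iff order_trans)
    qed
    from this[of "2 * \<theta>"] this[of "- (2 * \<theta>)"] show ?thesis
      unfolding Z3_def sign_mean_add using \<theta> by (intro add_mono) (simp_all only: abs_minus_cancel abs_of_nonneg mult_nonneg_nonneg zero_le_numeral order_refl)
  qed
  have "e + e \<le> K * e + K * e"
    using mult_right_mono[OF K, of e] by (simp add: e_def)
  have "sign_mean I (\<lambda>\<epsilon>. MAX g\<in>T. exp (\<Sum>i\<in>I. \<epsilon> i * (\<theta> * g (x i)))) \<le> sign_mean I (\<lambda>\<epsilon>. ((Z1 \<epsilon> + Z2 \<epsilon>) + Z3 \<epsilon>) / 2)"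
    by (intro sign_mean_mono dom)
  also have "\<dots> = ((sign_mean I Z1 + sign_mean I Z2) + sign_mean I Z3) / 2"
    by (simp add: sign_mean_add sign_mean_divide)
  also have "\<dots> \<le> 2 * (K * e)"
    using m1 m2 m3 \<open>e + e \<le> K * e + K * e\<close> by simp
  also have "\<dots> = 2 * real (card N) * (real d + 1) * e"
    by (simp only: K_def mult.assoc)
  finally show ?thesis by (simp only: e_def)
qed

section \<open>Nets of neuron parameters\<close>

text \<open>
  The numerator after rounding towards zero to a multiple of \<open>1 / m\<close>. This direction does not increase
  absolute values, so rounded parameters satisfy the same constraints.
\<close>

definition grid_round :: "nat \<Rightarrow> real \<Rightarrow> int" where
  "grid_round m t = (if t \<ge> 0 then \<lfloor>real m * t\<rfloor> else - \<lfloor>real m * - t\<rfloor>)"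

lemma grid_round_abs_le: "real_of_int \<bar>grid_round m t\<bar> \<le> real m * \<bar>t\<bar>"
proof (cases "t \<ge> 0")
  case True
  thus ?thesis by (simp add: grid_round_def)
next
  case False
  hence "0 \<le> \<lfloor>real m * - t\<rfloor>" by (simp add: mult_nonneg_nonpos)
  thus ?thesis using False of_int_floor_le[of "real m * - t"] unfolding grid_round_def by simp
qed

lemma grid_round_error: "\<bar>real m * t - real_of_int (grid_round m t)\<bar> \<le> 1"
proof -
  have "\<bar>s - real_of_int \<lfloor>s\<rfloor>\<bar> \<le> 1" for s :: real by linarith
  note floor_error = this
  show ?thesis
  proof (cases "t \<ge> 0")
    case True
    thus ?thesis using floor_error[of "real m * t"] by (simp add: grid_round_def)
  next
    case False
    have "real m * t - real_of_int (grid_round m t) = - (real m * - t - real_of_int \<lfloor>real m * - t\<rfloor>)"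
      using False by (simp add: grid_round_def)
    thus ?thesis using floor_error[of "real m * - t"] by (simp only: abs_minus_cancel)
  qed
qed

lemma grid_round_div_error:
  assumes "m \<ge> 1"
  shows "\<bar>t - real_of_int (grid_round m t) / real m\<bar> \<le> 1 / real m"
proof -
  have "t - real_of_int (grid_round m t) / real m = (real m * t - real_of_int (grid_round m t)) / real m"
    using assms by (simp add: diff_divide_distrib)
  hence "\<bar>t - real_of_int (grid_round m t) / real m\<bar> = \<bar>real m * t - real_of_int (grid_round m t)\<bar> / real m"
    by (simp only: abs_divide)
  thus ?thesis using grid_round_error[of m t] by (simp add: divide_right_mono)
qed

lemma grid_round_mem:
  assumes "\<bar>t\<bar> \<le> 1"
  shows "grid_round m t \<in> {- int m..int m}"
proof -
  have "real_of_int \<bar>grid_round m t\<bar> \<le> real m"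
    using grid_round_abs_le[of m t] mult_left_mono[OF assms, of "real m"] by simp
  hence "\<bar>grid_round m t\<bar> \<le> int m" by linarith
  thus ?thesis by (simp add: abs_le_iff)
qed

definition grid_point :: "nat \<Rightarrow> (nat \<Rightarrow> int) \<times> int \<Rightarrow> (nat \<Rightarrow> real) \<times> real" where
  "grid_point m z = ((\<lambda>j. real_of_int (fst z j) / real m), real_of_int (snd z) / real m)"

definition int_l1_ball :: "nat \<Rightarrow> nat \<Rightarrow> (nat \<Rightarrow> int) set" where
  "int_l1_ball d m = {z \<in> {..<d} \<rightarrow>\<^sub>E {- int m..int m}. (\<Sum>j<d. nat \<bar>z j\<bar>) \<le> m}"

definition grid_net :: "nat \<Rightarrow> nat \<Rightarrow> ((nat \<Rightarrow> real) \<times> real) set" where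
  "grid_net d m = grid_point m ` (int_l1_ball d m \<times> {- int m..int m})"

lemma finite_int_l1_ball: "finite (int_l1_ball d m)"
proof -
  have "finite ({..<d} \<rightarrow>\<^sub>E {- int m..int m})" by (intro finite_PiE) auto
  thus ?thesis by (rule rev_finite_subset) (auto simp: int_l1_ball_def)
qed

lemma finite_grid_net: "finite (grid_net d m)"
  unfolding grid_net_def using finite_int_l1_ball by auto

lemma geometric_sum_symmetric_le: "(\<Sum>z\<in>{- int m..int m}. (1/2) ^ nat \<bar>z\<bar>) \<le> (3 :: real)"
proof -
  have "(\<Sum>z\<in>{- int m..int m}. (1/2) ^ nat \<bar>z\<bar>) = (3 :: real) - 2 * (1/2) ^ m"
  proof (induction m)
    case (Suc m)
    have "{- int (Suc m)..int (Suc m)} = insert (int (Suc m)) (insert (- int (Suc m)) {- int m..int m})"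
      by auto
    hence "(\<Sum>z\<in>{- int (Suc m)..int (Suc m)}. (1/2) ^ nat \<bar>z\<bar>)
        = (1/2) ^ Suc m + ((1/2) ^ Suc m + (\<Sum>z\<in>{- int m..int m}. (1/2 :: real) ^ nat \<bar>z\<bar>))"
      by (simp only:) (subst sum.insert; simp del: of_nat_Suc)+
    also have "\<dots> = 3 - 2 * (1/2) ^ Suc m"
      unfolding Suc by simp
    finally show ?case .
  qed simp
  thus ?thesis by simp
qed

text \<open>
  Every point \<open>z\<close> of the ball has \<open>1 \<le> 2 ^ (m - |z|\<^sub>1)\<close>. Summed over the surrounding cube the right-hand side
  factorizes into \<open>2 ^ m\<close> and \<open>d\<close> two-sided geometric series of value at most 3. The cube itself
  has \<open>(2 m + 1) ^ d\<close> points, which for \<open>m\<close> of order \<open>d\<close> is larger by a factor \<open>ln d\<close> in the exponent.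
\<close>

lemma card_int_l1_ball_le: "real (card (int_l1_ball d m)) \<le> 3 ^ d * 2 ^ m"
proof -
  define f :: "int \<Rightarrow> real" where "f y = (1/2) ^ nat \<bar>y\<bar>" for y
  have f_nonneg: "0 \<le> f y" for y by (simp add: f_def)
  let ?B = "{..<d} \<rightarrow>\<^sub>E {- int m..int m}"
  have fin: "finite ?B" by (rule finite_PiE) auto
  have "real (card (int_l1_ball d m)) = (\<Sum>z\<in>int_l1_ball d m. 1)" by simp
  also have "\<dots> \<le> (\<Sum>z\<in>int_l1_ball d m. 2 ^ m * (\<Prod>j<d. f (z j)))"
  proof (rule sum_mono)
    fix z assume z: "z \<in> int_l1_ball d m"
    hence "(\<Sum>j<d. nat \<bar>z j\<bar>) \<le> m" by (simp add: int_l1_ball_def)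
    hence "(1/2::real) ^ m \<le> (1/2) ^ (\<Sum>j<d. nat \<bar>z j\<bar>)"
      by (rule power_decreasing) auto
    also have "\<dots> = (\<Prod>j<d. f (z j))"
      unfolding f_def by (rule power_sum)
    finally have "2 ^ m * (1/2::real) ^ m \<le> 2 ^ m * (\<Prod>j<d. f (z j))"
      by (rule mult_left_mono) simp
    moreover have "2 ^ m * (1/2::real) ^ m = 1"
      by (simp add: power_one_over)
    ultimately show "1 \<le> 2 ^ m * (\<Prod>j<d. f (z j))"
      by (simp only:)
  qed
  also have "\<dots> \<le> (\<Sum>z\<in>?B. 2 ^ m * (\<Prod>j<d. f (z j)))"
  proof (rule sum_mono2[OF fin])
    show "int_l1_ball d m \<subseteq> ?B" unfolding int_l1_ball_def by blast
  qed (intro mult_nonneg_nonneg prod_nonneg f_nonneg ballI; simp)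
  also have "\<dots> = 2 ^ m * (\<Prod>j<d. \<Sum>y\<in>{- int m..int m}. f y)"
    unfolding sum_distrib_left[symmetric] by (subst prod_sum_PiE) simp_all
  also have "\<dots> \<le> 2 ^ m * 3 ^ d"
    unfolding prod_constant card_lessThan f_def
    by (intro mult_left_mono power_mono geometric_sum_symmetric_le sum_nonneg) auto
  finally show ?thesis by (simp only: mult.commute)
qed

lemma card_grid_net_le: "real (card (grid_net d m)) \<le> 3 ^ (d + 1) * 4 ^ m"
proof -
  have "card (grid_net d m) \<le> card (int_l1_ball d m \<times> {- int m..int m})"
    unfolding grid_net_def using finite_int_l1_ball by (intro card_image_le) auto
  also have "\<dots> = card (int_l1_ball d m) * (2 * m + 1)"
    by (simp add: card_cartesian_product nat_add_distrib nat_mult_distrib)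
  finally have "real (card (grid_net d m)) \<le> real (card (int_l1_ball d m)) * real (2 * m + 1)"
    by (metis of_nat_le_iff of_nat_mult)
  also have "\<dots> \<le> (3 ^ d * 2 ^ m) * (3 * 2 ^ m)"
  proof (rule mult_mono[OF card_int_l1_ball_le])
    have "m < 2 ^ m" by simp
    hence "2 * m + 1 \<le> 3 * 2 ^ m" by linarith
    hence "real (2 * m + 1) \<le> real (3 * 2 ^ m)" by (simp only: of_nat_le_iff)
    thus "real (2 * m + 1) \<le> 3 * 2 ^ m" by simp
  qed auto
  also have "\<dots> = 3 ^ (d + 1) * 4 ^ m"
  proof -
    have "(2::real) ^ m * 2 ^ m = 4 ^ m" by (simp only: power_mult_distrib[symmetric]) simp
    thus ?thesis by simp
  qed
  finally show ?thesis .
qed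

lemma grid_net_subset:
  assumes "m \<ge> 1"
  shows "grid_net d m \<subseteq> neuron_params d"
proof
  fix c assume "c \<in> grid_net d m"
  then obtain z y where zy: "z \<in> int_l1_ball d m" "y \<in> {- int m..int m}" "c = grid_point m (z, y)"
    unfolding grid_net_def by auto
  have "l1norm d (fst c) = real (\<Sum>j<d. nat \<bar>z j\<bar>) / real m"
    by (simp add: zy grid_point_def l1norm_def sum_divide_distrib)
  also have "\<dots> \<le> 1"
    using zy(1) assms by (simp add: int_l1_ball_def flip: of_nat_sum)
  finally have "l1norm d (fst c) \<le> 1" .
  moreover have "\<bar>real_of_int y\<bar> \<le> real m" using zy(2) by (simp add: abs_le_iff)
  hence "\<bar>snd c\<bar> \<le> 1" using assms by (simp add: zy grid_point_def)
  ultimately show "c \<in> neuron_params d" by (simp add: neuron_params_def)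
qed

lemma grid_net_approx:
  assumes "m \<ge> 1" "d \<ge> 1" "p \<in> neuron_params d"
  shows "\<exists>c\<in>grid_net d m. params_dist d p c \<le> real d / real m"
proof -
  define z where "z = (\<lambda>j\<in>{..<d}. grid_round m (fst p j))"
  define y where "y = grid_round m (snd p)"
  note err = grid_round_div_error[OF assms(1)]
  have l1: "(\<Sum>j<d. \<bar>fst p j\<bar>) \<le> 1" "\<bar>snd p\<bar> \<le> 1"
    using assms(3) by (auto simp: neuron_params_def l1norm_def)
  have "real_of_int (\<Sum>j<d. \<bar>grid_round m (fst p j)\<bar>) \<le> (\<Sum>j<d. real m * \<bar>fst p j\<bar>)"
    unfolding of_int_sum by (intro sum_mono grid_round_abs_le)
  also have "\<dots> \<le> real m * 1"
    unfolding sum_distrib_left[symmetric] by (intro mult_left_mono l1) auto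
  also have "(\<Sum>j<d. \<bar>grid_round m (fst p j)\<bar>) = (\<Sum>j<d. \<bar>z j\<bar>)"
    by (simp add: z_def)
  finally have "real_of_int (\<Sum>j<d. \<bar>z j\<bar>) \<le> real_of_int (int m)"
    by (simp only: mult_1_right of_int_of_nat_eq)
  hence zsum: "(\<Sum>j<d. \<bar>z j\<bar>) \<le> int m"
    by (simp only: of_int_le_iff)
  have zj: "\<bar>z j\<bar> \<le> int m" if "j < d" for j
    using zsum member_le_sum[of j "{..<d}" "\<lambda>j. \<bar>z j\<bar>"] that by simp
  have "int (\<Sum>j<d. nat \<bar>z j\<bar>) \<le> int m" using zsum by simp
  hence "(\<Sum>j<d. nat \<bar>z j\<bar>) \<le> m" by (simp only: of_nat_le_iff)
  hence z: "z \<in> int_l1_ball d m"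
    using zj by (force simp: int_l1_ball_def z_def abs_le_iff)
  have y: "y \<in> {- int m..int m}"
    unfolding y_def by (rule grid_round_mem) (rule l1(2))
  have "l1norm d (\<lambda>j. fst p j - fst (grid_point m (z, y)) j) \<le> (\<Sum>j<d. 1 / real m)"
    unfolding l1norm_def using err by (intro sum_mono) (auto simp: grid_point_def z_def)
  moreover have "\<bar>snd p - snd (grid_point m (z, y))\<bar> \<le> real d / real m"
    using err[of "snd p"] assms(2) divide_right_mono[of 1 "real d" "real m"] by (simp add: grid_point_def y_def)
  ultimately have "params_dist d p (grid_point m (z, y)) \<le> real d / real m"
    by (simp add: params_dist_def)
  thus ?thesis using z y unfolding grid_net_def by blast
qed

section \<open>Uniform approximation and measurability of networks\<close>

lemma network_diff_le:
  assumes lip: "\<And>s t. \<bar>\<phi> s - \<phi> t\<bar> \<le> \<bar>s - t\<bar>" and \<phi>: "\<And>s. \<bar>s\<bar> \<le> M + 1 \<Longrightarrow> \<bar>\<phi> s\<bar> \<le> B"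
    and y: "\<And>j. j < d \<Longrightarrow> \<bar>y j\<bar> \<le> M" and M: "0 \<le> M" and \<eta>: "0 \<le> \<eta>"
    and p: "\<And>i. i \<in> {1..k} \<Longrightarrow> p i \<in> neuron_params d" "\<And>i. i \<in> {1..k} \<Longrightarrow> params_dist d (p i) (q i) \<le> \<eta>"
    and \<beta>: "\<And>i. i \<in> {1..k} \<Longrightarrow> \<bar>\<gamma> i\<bar> \<le> 1" "\<And>i. i \<in> {1..k} \<Longrightarrow> \<bar>\<beta> i - \<gamma> i\<bar> \<le> \<eta>"
    and b: "\<bar>b0 - c0\<bar> \<le> \<eta>"
  shows "\<bar>network d k \<phi> \<beta> p b0 y - network d k \<phi> \<gamma> q c0 y\<bar> \<le> (real k * (B + M + 1) + 1) * \<eta>"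
proof -
  have term_le: "\<bar>\<beta> i * \<phi> (affine_map d (p i) y) - \<gamma> i * \<phi> (affine_map d (q i) y)\<bar> \<le> (B + M + 1) * \<eta>"
    if i: "i \<in> {1..k}" for i
  proof -
    define s t where "s = affine_map d (p i) y" and "t = affine_map d (q i) y"
    have "\<bar>\<phi> s\<bar> \<le> B"
      unfolding s_def by (intro \<phi> abs_affine_map_le p(1) y M i)
    hence 1: "\<bar>\<beta> i - \<gamma> i\<bar> * \<bar>\<phi> s\<bar> \<le> \<eta> * B"
      using \<beta>(2)[OF i] \<eta> by (intro mult_mono) auto
    have "s - t = dot d (\<lambda>j. fst (p i) j - fst (q i) j) y + (snd (p i) - snd (q i))"
      by (simp add: s_def t_def affine_map_def dot_def left_diff_distrib sum_subtractf)
    moreover have "\<bar>dot d (\<lambda>j. fst (p i) j - fst (q i) j) y\<bar> \<le> l1norm d (\<lambda>j. fst (p i) j - fst (q i) j) * M"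
      by (rule abs_dot_le) (rule y)
    moreover have "l1norm d (\<lambda>j. fst (p i) j - fst (q i) j) * M \<le> \<eta> * M"
      using p(2)[OF i] M by (intro mult_right_mono) (auto simp: params_dist_def)
    moreover have "\<bar>snd (p i) - snd (q i)\<bar> \<le> \<eta>"
      using p(2)[OF i] by (simp add: params_dist_def)
    ultimately have "\<bar>s - t\<bar> \<le> \<eta> * M + \<eta>" by linarith
    hence "\<bar>\<phi> s - \<phi> t\<bar> \<le> \<eta> * M + \<eta>" using lip[of s t] by linarith
    hence 2: "\<bar>\<gamma> i\<bar> * \<bar>\<phi> s - \<phi> t\<bar> \<le> 1 * (\<eta> * M + \<eta>)"
      using \<beta>(1)[OF i] by (intro mult_mono) auto
    have "\<beta> i * \<phi> s - \<gamma> i * \<phi> t = (\<beta> i - \<gamma> i) * \<phi> s + \<gamma> i * (\<phi> s - \<phi> t)"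
      by (simp add: algebra_simps)
    hence "\<bar>\<beta> i * \<phi> s - \<gamma> i * \<phi> t\<bar> \<le> \<bar>\<beta> i - \<gamma> i\<bar> * \<bar>\<phi> s\<bar> + \<bar>\<gamma> i\<bar> * \<bar>\<phi> s - \<phi> t\<bar>"
      by (metis abs_mult abs_triangle_ineq)
    also have "\<dots> \<le> (B + M + 1) * \<eta>"
      using 1 2 by (simp add: algebra_simps)
    finally show ?thesis by (simp only: s_def t_def)
  qed
  have "network d k \<phi> \<beta> p b0 y - network d k \<phi> \<gamma> q c0 y
      = (\<Sum>i=1..k. \<beta> i * \<phi> (affine_map d (p i) y) - \<gamma> i * \<phi> (affine_map d (q i) y)) + (b0 - c0)"
    by (simp add: network_def sum_subtractf)
  also have "\<bar>\<dots>\<bar> \<le> (\<Sum>i=1..k. \<bar>\<beta> i * \<phi> (affine_map d (p i) y) - \<gamma> i * \<phi> (affine_map d (q i) y)\<bar>) + \<bar>b0 - c0\<bar>"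
    by (intro order_trans[OF abs_triangle_ineq] add_right_mono sum_abs)
  also have "\<dots> \<le> (\<Sum>i=1..k. (B + M + 1) * \<eta>) + \<eta>"
    by (intro add_mono sum_mono term_le b)
  also have "\<dots> = (real k * (B + M + 1) + 1) * \<eta>"
    by (simp add: algebra_simps)
  finally show ?thesis .
qed

text \<open>
  Rounding all parameters gives a finite set of networks that is dense to any
  given precision \<open>\<eta>\<close> in the uniform norm. All bounds on maxima over a finite set of networks depend on the
  set only through the class, so \<open>\<eta>\<close> can be as small as the argument requires.
\<close>

lemma nn_star_finite_uniform_net:
  assumes d: "d \<ge> 1" and lip: "\<And>s t. \<bar>\<phi> s - \<phi> t\<bar> \<le> \<bar>s - t\<bar>" and \<phi>: "\<And>s. \<bar>s\<bar> \<le> M + 1 \<Longrightarrow> \<bar>\<phi> s\<bar> \<le> B"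
    and M: "0 \<le> M" and B: "0 \<le> B" and \<eta>: "0 < \<eta>"
  obtains T where "finite T" "T \<subseteq> nn_star d k \<phi>"
    "\<And>g. g \<in> nn_star d k \<phi> \<Longrightarrow> \<exists>g'\<in>T. \<forall>y. (\<forall>j<d. \<bar>y j\<bar> \<le> M) \<longrightarrow> \<bar>g y - g' y\<bar> \<le> \<eta>"
proof -
  define c where "c = real k * (B + M + 1) + 1"
  have c: "0 < c" using B M by (simp add: c_def add_nonneg_pos)
  define m where "m = nat \<lceil>real d * c / \<eta>\<rceil>"
  have "0 < real d * c / \<eta>" using c d \<eta> by simp
  hence m: "m \<ge> 1" "real d * c / \<eta> \<le> real m"
    unfolding m_def by linarith+
  hence err: "c * (real d / real m) \<le> \<eta>"
    using \<eta> by (simp add: field_simps)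
  have d1: "1 / real m \<le> real d / real m" using d m by (simp add: divide_right_mono)
  define grid where "grid = (\<lambda>z. real_of_int z / real m) ` {- int m..int m}"
  have grid_le: "\<bar>t\<bar> \<le> 1" if "t \<in> grid" for t
    using that m(1) by (auto simp: grid_def abs_le_iff field_simps)
  define T where "T = (\<lambda>(\<gamma>, q, c0). network d k \<phi> \<gamma> q c0) `
    (({1..k} \<rightarrow>\<^sub>E grid) \<times> ({1..k} \<rightarrow>\<^sub>E grid_net d m) \<times> grid)"
  show ?thesis
  proof (rule that[of T])
    show "finite T"
      unfolding T_def by (intro finite_imageI finite_cartesian_product finite_PiE finite_grid_net) (auto simp: grid_def)
    show "T \<subseteq> nn_star d k \<phi>"
    proof
      fix g assume "g \<in> T"
      then obtain \<gamma> q c0 where "\<gamma> \<in> {1..k} \<rightarrow>\<^sub>E grid" "q \<in> {1..k} \<rightarrow>\<^sub>E grid_net d m" "c0 \<in> grid"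
        and g: "g = network d k \<phi> \<gamma> q c0" unfolding T_def by auto
      thus "g \<in> nn_star d k \<phi>"
        unfolding nn_star_iff using grid_le grid_net_subset[OF m(1), of d] by (intro exI[of _ \<gamma>] exI[of _ q] exI[of _ c0]) (auto simp: PiE_iff)
    qed
  next
    fix g assume "g \<in> nn_star d k \<phi>"
    then obtain \<beta> p b0 where par: "\<And>i. i \<in> {1..k} \<Longrightarrow> p i \<in> neuron_params d \<and> \<bar>\<beta> i\<bar> \<le> 1" "\<bar>b0\<bar> \<le> 1"
      and g: "g = network d k \<phi> \<beta> p b0" unfolding nn_star_iff by blast
    define rd where "rd t = real_of_int (grid_round m t) / real m" for t
    have rd: "rd t \<in> grid" "\<bar>t - rd t\<bar> \<le> real d / real m" if "\<bar>t\<bar> \<le> 1" for t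
      using grid_round_mem[OF that, of m] grid_round_div_error[OF m(1), of t] d1 by (auto simp: rd_def grid_def)
    have "\<forall>i\<in>{1..k}. \<exists>c\<in>grid_net d m. params_dist d (p i) c \<le> real d / real m"
      using grid_net_approx[OF m(1) d] par(1) by blast
    then obtain q where q: "\<And>i. i \<in> {1..k} \<Longrightarrow> q i \<in> grid_net d m \<and> params_dist d (p i) (q i) \<le> real d / real m"
      by metis
    define q' \<gamma> where "q' = (\<lambda>i\<in>{1..k}. q i)" and "\<gamma> = (\<lambda>i\<in>{1..k}. rd (\<beta> i))"
    have "network d k \<phi> \<gamma> q' (rd b0) \<in> T"
      unfolding T_def
      by (rule image_eqI[of _ _ "(\<gamma>, q', rd b0)"]) (use q rd par in \<open>auto simp: q'_def \<gamma>_def\<close>)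
    moreover have "\<bar>g y - network d k \<phi> \<gamma> q' (rd b0) y\<bar> \<le> \<eta>" if y: "\<forall>j<d. \<bar>y j\<bar> \<le> M" for y
    proof -
      have "\<bar>network d k \<phi> \<beta> p b0 y - network d k \<phi> \<gamma> q' (rd b0) y\<bar> \<le> (real k * (B + M + 1) + 1) * (real d / real m)"
        by (rule network_diff_le[OF lip \<phi>])
          (use y M par q rd grid_le in \<open>auto simp: q'_def \<gamma>_def\<close>)
      thus ?thesis using err by (simp add: g c_def)
    qed
    ultimately show "\<exists>g'\<in>T. \<forall>y. (\<forall>j<d. \<bar>y j\<bar> \<le> M) \<longrightarrow> \<bar>g y - g' y\<bar> \<le> \<eta>" by blast
  qed
qed

lemma space_prob_measures:
  assumes "\<mu> \<in> prob_measures d X" "X \<subseteq> euclid d"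
  shows "space \<mu> = X"
proof -
  have "space \<mu> = space (restrict_space (borel_euclid d) X)"
    using assms(1) by (intro sets_eq_imp_space_eq) (simp add: prob_measures_def)
  also have "\<dots> = X"
    using assms(2) by (auto simp: space_restrict_space borel_euclid_def euclid_def space_PiM)
  finally show ?thesis .
qed

lemma nn_star_measurable:
  assumes \<mu>: "\<mu> \<in> prob_measures d X" and g: "g \<in> nn_star d k \<phi>"
    and lip: "\<And>s t. \<bar>\<phi> s - \<phi> t\<bar> \<le> \<bar>s - t\<bar>"
  shows "g \<in> borel_measurable \<mu>"
proof -
  have "1-lipschitz_on UNIV \<phi>"
    using lip by (auto simp: lipschitz_on_def dist_real_def)
  hence [measurable]: "\<phi> \<in> borel_measurable borel"
    by (intro borel_measurable_continuous_onI lipschitz_on_continuous_on)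
  have comp: "(\<lambda>y. y j) \<in> borel_measurable (borel_euclid d)" if "j < d" for j
    unfolding borel_euclid_def using that by (intro measurable_component_singleton) auto
  have dot: "(\<lambda>y. dot d u y) \<in> borel_measurable (borel_euclid d)" for u
    unfolding dot_def using comp by (intro borel_measurable_sum borel_measurable_times) auto
  have [measurable]: "(\<lambda>y. affine_map d p y) \<in> borel_measurable (borel_euclid d)" for p
    unfolding affine_map_def using dot by measurable
  obtain \<beta> p b0 where "g = network d k \<phi> \<beta> p b0" using g unfolding nn_star_iff by blast
  hence "g \<in> borel_measurable (borel_euclid d)"
    unfolding network_def[abs_def] by simp
  hence "g \<in> borel_measurable (restrict_space (borel_euclid d) X)"
    by (rule measurable_restrict_space1)
  thus ?thesis
    using \<mu> by (subst measurable_cong_sets[of \<mu> "restrict_space (borel_euclid d) X"]) (auto simp: prob_measures_def)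
qed

section \<open>Deviations of empirical means over a finite set of networks\<close>

text \<open>
  Chernoff's method for a maximum: symmetrization makes the centred sums a sum with signs,
  contraction replaces \<open>f g\<close> by \<open>\<Lambda> g\<close>, and the hypothesis \<open>mgf\<close> bounds the result.
  The points \<open>g\<close> of the finite set \<open>T\<close> are functions themselves and \<open>f g\<close> is to be thought of as a
  Lipschitz function of \<open>g\<close> that vanishes where \<open>g\<close> does.
\<close>

lemma tail_bound:
  assumes \<mu>: "prob_space \<mu>" and T: "finite T" "T \<noteq> {}" and I: "finite I"
    and meas: "\<And>g. g \<in> T \<Longrightarrow> f g \<in> borel_measurable \<mu>"
    and bnd: "\<And>g y. g \<in> T \<Longrightarrow> y \<in> space \<mu> \<Longrightarrow> \<bar>f g y\<bar> \<le> (K :: real)"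
    and lip: "\<And>g g' y. g \<in> T \<Longrightarrow> g' \<in> T \<Longrightarrow> y \<in> space \<mu> \<Longrightarrow> \<bar>f g y - f g' y\<bar> \<le> \<Lambda> * \<bar>g y - g' y\<bar>"
    and le: "\<And>g y. g \<in> T \<Longrightarrow> y \<in> space \<mu> \<Longrightarrow> \<bar>f g y\<bar> \<le> \<Lambda> * \<bar>g y\<bar>"
    and mgf: "\<And>x \<theta>. (\<And>i. i \<in> I \<Longrightarrow> x i \<in> space \<mu>) \<Longrightarrow> 0 \<le> \<theta> \<Longrightarrow>
        sign_mean I (\<lambda>\<epsilon>. MAX g\<in>T. exp (\<Sum>i\<in>I. \<epsilon> i * (\<theta> * g (x i)))) \<le> A * exp (\<kappa> * \<theta>\<^sup>2)"
    and pos: "0 < \<Lambda>" "0 < \<kappa>" "0 \<le> u" "0 \<le> A"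
  shows "measure (\<Pi>\<^sub>M i\<in>I. \<mu>) {x \<in> space (\<Pi>\<^sub>M i\<in>I. \<mu>). \<exists>g\<in>T. u \<le> (\<Sum>i\<in>I. f g (x i) - (\<integral>y. f g y \<partial>\<mu>))}
      \<le> A * exp (- (u\<^sup>2 / (16 * \<kappa> * \<Lambda>\<^sup>2)))"
proof -
  interpret prob_space \<mu> by fact
  let ?P = "\<Pi>\<^sub>M i\<in>I. \<mu>"
  interpret P: prob_space ?P by (intro prob_space_PiM \<mu>)
  \<comment> \<open>The minimizer of the exponent \<open>4 \<kappa> \<Lambda>\<^sup>2 l\<^sup>2 - l u\<close>.\<close>
  define l where "l = u / (8 * \<kappa> * \<Lambda>\<^sup>2)"
  have l: "0 \<le> l" using pos by (simp add: l_def)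
  define E where "E = {x \<in> space ?P. \<exists>g\<in>T. u \<le> (\<Sum>i\<in>I. f g (x i) - (\<integral>y. f g y \<partial>\<mu>))}"
  define Z where "Z = (\<lambda>x. MAX g\<in>T. exp (0 + (\<Sum>i\<in>I. l * f g (x i) - (\<integral>z. l * f g z \<partial>\<mu>))))"
  note [measurable] = meas
  have Z_meas [measurable]: "Z \<in> borel_measurable ?P"
    unfolding Z_def using T(1) I by measurable
  have E_le: "indicator E x \<le> ennreal (exp (- (l * u)) * Z x)" if "x \<in> space ?P" for x
  proof (cases "x \<in> E")
    case True
    then obtain g where g: "g \<in> T" "u \<le> (\<Sum>i\<in>I. f g (x i) - (\<integral>y. f g y \<partial>\<mu>))"
      by (auto simp: E_def)
    have "l * u \<le> (\<Sum>i\<in>I. l * f g (x i) - (\<integral>z. l * f g z \<partial>\<mu>))"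
      using mult_left_mono[OF g(2) l] by (simp add: sum_distrib_left right_diff_distrib)
    hence "exp (l * u) \<le> Z x"
      unfolding Z_def by (intro order_trans[OF _ Max_image_ge[OF T(1) g(1)]]) simp
    from mult_left_mono[OF this, of "exp (- (l * u))"]
    have "1 \<le> exp (- (l * u)) * Z x" by (simp add: exp_minus)
    thus ?thesis using True by simp
  qed simp
  have sign_le: "sign_mean I (\<lambda>\<epsilon>. MAX g\<in>T. exp (0 + (\<Sum>i\<in>I. \<epsilon> i * (2 * (l * f g (x i)))))) \<le> A * exp (\<kappa> * (2 * l * \<Lambda>)\<^sup>2)"
    if x: "x \<in> space ?P" for x
  proof -
    have xi: "x i \<in> space \<mu>" if "i \<in> I" for i
      using x that by (auto simp: space_PiM)
    have "sign_mean I (\<lambda>\<epsilon>. MAX g\<in>T. exp (0 + (\<Sum>i\<in>I. \<epsilon> i * (2 * (l * f g (x i))))))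
       \<le> sign_mean I (\<lambda>\<epsilon>. MAX g\<in>T. exp (0 + (\<Sum>i\<in>I. \<epsilon> i * ((2 * l * \<Lambda>) * g (x i)))))"
    proof (rule contraction[OF I T])
      fix i g g' assume i: "i \<in> I" and g: "g \<in> T"
      have "2 * l * \<bar>f g (x i)\<bar> \<le> 2 * l * (\<Lambda> * \<bar>g (x i)\<bar>)"
        using l by (intro mult_left_mono le g xi i) auto
      thus "\<bar>2 * (l * f g (x i))\<bar> \<le> \<bar>2 * l * \<Lambda> * g (x i)\<bar>"
        using l pos by (simp add: abs_mult)
      assume g': "g' \<in> T"
      have "2 * l * \<bar>f g (x i) - f g' (x i)\<bar> \<le> 2 * l * (\<Lambda> * \<bar>g (x i) - g' (x i)\<bar>)"
        using l by (intro mult_left_mono lip g g' xi i) auto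
      thus "\<bar>2 * (l * f g (x i)) - 2 * (l * f g' (x i))\<bar> \<le> \<bar>2 * l * \<Lambda> * g (x i) - 2 * l * \<Lambda> * g' (x i)\<bar>"
        unfolding right_diff_distrib[symmetric] using l pos by (simp add: abs_mult)
    qed
    also have "\<dots> \<le> A * exp (\<kappa> * (2 * l * \<Lambda>)\<^sup>2)"
      unfolding add_0 using xi l pos by (intro mgf) auto
    finally show ?thesis .
  qed
  have [measurable]: "E \<in> sets ?P"
    unfolding E_def using T(1) I by measurable
  have "emeasure ?P E = (\<integral>\<^sup>+x. indicator E x \<partial>?P)" by simp
  also have "\<dots> \<le> (\<integral>\<^sup>+x. ennreal (exp (- (l * u))) * ennreal (Z x) \<partial>?P)"
    using E_le by (intro nn_integral_mono) (simp add: ennreal_mult')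
  also have "\<dots> = ennreal (exp (- (l * u))) * (\<integral>\<^sup>+x. ennreal (Z x) \<partial>?P)"
    by (rule nn_integral_cmult) simp
  also have "(\<integral>\<^sup>+x. ennreal (Z x) \<partial>?P)
      \<le> (\<integral>\<^sup>+x. ennreal (sign_mean I (\<lambda>\<epsilon>. MAX g\<in>T. exp (0 + (\<Sum>i\<in>I. \<epsilon> i * (2 * (l * f g (x i))))))) \<partial>?P)"
    unfolding Z_def
  proof (rule symmetrization[OF \<mu> T I])
    show "\<bar>l * f g y\<bar> \<le> l * K" if "g \<in> T" "y \<in> space \<mu>" for g y
      using bnd[OF that] l by (simp add: abs_mult mult_left_mono)
  qed measurable
  also have "\<dots> \<le> (\<integral>\<^sup>+x. ennreal (A * exp (\<kappa> * (2 * l * \<Lambda>)\<^sup>2)) \<partial>?P)"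
    by (intro nn_integral_mono ennreal_leI sign_le)
  also have "\<dots> = ennreal (A * exp (\<kappa> * (2 * l * \<Lambda>)\<^sup>2))"
    by (simp add: P.emeasure_space_1)
  finally have "emeasure ?P E \<le> ennreal (exp (- (l * u)) * (A * exp (\<kappa> * (2 * l * \<Lambda>)\<^sup>2)))"
    using pos by (simp add: ennreal_mult' mult_left_mono)
  hence "measure ?P E \<le> exp (- (l * u)) * (A * exp (\<kappa> * (2 * l * \<Lambda>)\<^sup>2))"
    using pos by (simp add: P.emeasure_eq_measure)
  also have "\<dots> = A * exp (\<kappa> * (2 * l * \<Lambda>)\<^sup>2 - l * u)"
    by (simp add: exp_diff exp_minus field_simps)
  also have "\<kappa> * (2 * l * \<Lambda>)\<^sup>2 - l * u = - (u\<^sup>2 / (16 * \<kappa> * \<Lambda>\<^sup>2))"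
    using pos by (simp add: l_def power_mult_distrib power_divide field_simps power2_eq_square)
  finally show ?thesis unfolding E_def .
qed

lemma nn_star_zero: "(\<lambda>_. 0) \<in> nn_star d k \<phi>"
  unfolding nn_star_iff
  by (intro exI[of _ "\<lambda>_. 0"] exI[of _ "\<lambda>_. (\<lambda>_. 0, 0)"] exI[of _ 0])
    (auto simp: network_def neuron_params_def l1norm_def)

lemma abs_nn_star_le:
  assumes g: "g \<in> nn_star d k \<phi>" and \<phi>: "\<And>s. \<bar>s\<bar> \<le> M + 1 \<Longrightarrow> \<bar>\<phi> s\<bar> \<le> B"
    and y: "\<And>j. j < d \<Longrightarrow> \<bar>y j\<bar> \<le> M" and M: "0 \<le> M"
  shows "\<bar>g y\<bar> \<le> real k * B + 1"
proof -
  obtain \<beta> p b0 where par: "\<And>i. i \<in> {1..k} \<Longrightarrow> p i \<in> neuron_params d \<and> \<bar>\<beta> i\<bar> \<le> 1" "\<bar>b0\<bar> \<le> 1"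
    and g: "g = network d k \<phi> \<beta> p b0" using g unfolding nn_star_iff by blast
  have term_le: "\<bar>\<beta> i * \<phi> (affine_map d (p i) y)\<bar> \<le> B" if i: "i \<in> {1..k}" for i
  proof -
    have "\<bar>\<phi> (affine_map d (p i) y)\<bar> \<le> B"
      using par(1)[OF i] by (intro \<phi> abs_affine_map_le y M) auto
    hence "\<bar>\<beta> i\<bar> * \<bar>\<phi> (affine_map d (p i) y)\<bar> \<le> 1 * B"
      using par(1)[OF i] by (intro mult_mono) auto
    thus ?thesis by (simp add: abs_mult)
  qed
  have "\<bar>g y\<bar> \<le> (\<Sum>i=1..k. \<bar>\<beta> i * \<phi> (affine_map d (p i) y)\<bar>) + \<bar>b0\<bar>"
    unfolding g network_def by (intro order_trans[OF abs_triangle_ineq] add_right_mono sum_abs)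
  also have "\<dots> \<le> (\<Sum>i=1..k. B) + 1"
    by (intro add_mono sum_mono term_le par)
  finally show ?thesis by simp
qed

definition range_on :: "('a \<Rightarrow> real) set \<Rightarrow> 'a set \<Rightarrow> real set" where
  "range_on G X = {g y | g y. g \<in> G \<and> y \<in> X}"

lemma compose_lipschitz_measurable:
  assumes g: "g \<in> borel_measurable \<mu>" "g \<in> G" and X: "space \<mu> = X"
    and \<psi>: "\<Lambda>-lipschitz_on (range_on G X) \<psi>"
  shows "(\<lambda>y. \<psi> (g y)) \<in> borel_measurable \<mu>"
proof -
  have "\<psi> \<in> borel_measurable (restrict_space borel (range_on G X))"
    by (intro borel_measurable_continuous_on_restrict lipschitz_on_continuous_on[OF \<psi>])
  moreover have "g \<in> measurable \<mu> (restrict_space borel (range_on G X))"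
    using g X by (intro measurable_restrict_space2) (auto simp: range_on_def)
  ultimately show ?thesis
    by (rule measurable_compose[rotated])
qed

lemma abs_compose_lipschitz_le:
  fixes \<psi> :: "real \<Rightarrow> real"
  assumes g: "g \<in> G" "y \<in> X" and zero: "(\<lambda>_. 0) \<in> G" and \<psi>: "\<Lambda>-lipschitz_on (range_on G X) \<psi>"
  shows "\<bar>\<psi> (g y) - \<psi> 0\<bar> \<le> \<Lambda> * \<bar>g y\<bar>"
proof -
  have "0 \<in> range_on G X" "g y \<in> range_on G X"
    using g zero unfolding range_on_def by force+
  thus ?thesis
    using lipschitz_onD[OF \<psi>, of "g y" 0] by (simp add: dist_real_def)
qed

lemma compose_lipschitz_integrable:
  fixes \<psi> :: "real \<Rightarrow> real"
  assumes \<mu>: "prob_space \<mu>" and g: "g \<in> borel_measurable \<mu>" "g \<in> G" and zero: "(\<lambda>_. 0) \<in> G"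
    and X: "space \<mu> = X" and \<psi>: "\<Lambda>-lipschitz_on (range_on G X) \<psi>"
    and bnd: "\<And>y. y \<in> X \<Longrightarrow> \<bar>g y\<bar> \<le> K"
  shows "integrable \<mu> (\<lambda>y. \<psi> (g y))"
proof -
  interpret prob_space \<mu> by fact
  show ?thesis
  proof (rule integrable_const_bound[where B = "\<bar>\<psi> 0\<bar> + \<Lambda> * K"])
    show "AE y in \<mu>. norm (\<psi> (g y)) \<le> \<bar>\<psi> 0\<bar> + \<Lambda> * K"
    proof (rule AE_I2)
      fix y assume y: "y \<in> space \<mu>"
      have "\<bar>\<psi> (g y) - \<psi> 0\<bar> \<le> \<Lambda> * \<bar>g y\<bar>"
        using y X by (intro abs_compose_lipschitz_le[OF g(2) _ zero \<psi>]) auto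
      also have "\<dots> \<le> \<Lambda> * K"
        using bnd[of y] y X lipschitz_on_nonneg[OF \<psi>] by (intro mult_left_mono) auto
      finally show "norm (\<psi> (g y)) \<le> \<bar>\<psi> 0\<bar> + \<Lambda> * K" by simp
    qed
  qed (rule compose_lipschitz_measurable[OF g X \<psi>])
qed

text \<open>
  The function \<open>\<psi>\<close> is centred at \<open>\<psi> 0\<close> so that contraction applies; this leaves the
  deviations from the mean unchanged. The two signs \<open>\<sigma>\<close> account for the absolute value.
\<close>

lemma one_sample_deviation:
  fixes X :: "(nat \<Rightarrow> real) set"
  assumes d: "d \<ge> 1" and k: "k \<ge> 1" and X: "X \<subseteq> euclid d" "X \<noteq> {}" and \<mu>: "\<mu> \<in> prob_measures d X"
    and y: "\<And>y j. y \<in> X \<Longrightarrow> j < d \<Longrightarrow> \<bar>y j\<bar> \<le> M" and M: "0 \<le> M"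
    and lip: "\<And>s t. \<bar>\<phi> s - \<phi> t\<bar> \<le> \<bar>s - t\<bar>" and \<phi>: "\<And>s. \<bar>s\<bar> \<le> M + 1 \<Longrightarrow> \<bar>\<phi> s\<bar> \<le> B"
    and N: "finite N" "N \<subseteq> neuron_params d" and net: "\<And>p. p \<in> neuron_params d \<Longrightarrow> \<exists>c\<in>N. params_dist d p c \<le> r"
    and r: "0 \<le> r" "r * (M + 1) \<le> B"
    and T: "finite T" "T \<noteq> {}" "T \<subseteq> nn_star d k \<phi>"
    and \<psi>: "\<Lambda>-lipschitz_on (range_on (nn_star d k \<phi>) X) \<psi>" and \<Lambda>: "0 < \<Lambda>"
    and n: "n \<ge> 1" and u: "0 \<le> u" and C: "real k * B + 1 \<le> 2 * C"
  shows "measure (\<Pi>\<^sub>M i\<in>{1..n}. \<mu>) {x \<in> space (\<Pi>\<^sub>M i\<in>{1..n}. \<mu>).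
           \<exists>g\<in>T. u \<le> \<bar>\<Sum>i=1..n. \<psi> (g (x i)) - (\<integral>y. \<psi> (g y) \<partial>\<mu>)\<bar>}
       \<le> 4 * real (card N) * (real d + 1) * exp (- (u\<^sup>2 / (2048 * real n * C\<^sup>2 * \<Lambda>\<^sup>2)))"
proof -
  let ?G = "nn_star d k \<phi>" and ?P = "\<Pi>\<^sub>M i\<in>{1..n}. \<mu>"
  have prob: "prob_space \<mu>" using \<mu> by (simp add: prob_measures_def)
  interpret prob_space \<mu> by fact
  interpret P: prob_space ?P by (intro prob_space_PiM prob)
  have sp: "space \<mu> = X" by (rule space_prob_measures[OF \<mu> X(1)])
  have B: "0 \<le> B" using r M by (intro order_trans[OF mult_nonneg_nonneg r(2)]) auto
  have "0 \<le> real k * B" using B by simp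
  hence Cpos: "C > 0" using C by linarith
  define A where "A = 2 * real (card N) * (real d + 1)"
  define \<kappa> where "\<kappa> = 128 * real n * C\<^sup>2"
  have \<kappa>: "0 < \<kappa>" using n Cpos by (simp add: \<kappa>_def)
  have A: "0 \<le> A" by (simp add: A_def)
  have \<psi>_0: "\<bar>\<psi> (g y) - \<psi> 0\<bar> \<le> \<Lambda> * \<bar>g y\<bar>" if "g \<in> ?G" "y \<in> X" for g y
    by (rule abs_compose_lipschitz_le[OF that nn_star_zero \<psi>])
  have \<psi>_diff: "\<bar>\<psi> (g y) - \<psi> (g' y)\<bar> \<le> \<Lambda> * \<bar>g y - g' y\<bar>" if "g \<in> ?G" "g' \<in> ?G" "y \<in> X" for g g' y
    using lipschitz_onD[OF \<psi>, of "g y" "g' y"] that by (auto simp: dist_real_def range_on_def)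
  have g_le: "\<bar>g y\<bar> \<le> 2 * C" if "g \<in> ?G" "y \<in> X" for g y
    by (rule order_trans[OF abs_nn_star_le[OF that(1) \<phi>] C]) (use y that M in auto)
  have meas: "(\<lambda>y. \<psi> (g y)) \<in> borel_measurable \<mu>" if "g \<in> ?G" for g
    by (rule compose_lipschitz_measurable[OF nn_star_measurable[OF \<mu> that lip] that sp \<psi>])
  have bnd: "\<bar>\<psi> (g y) - \<psi> 0\<bar> \<le> \<Lambda> * (2 * C)" if "g \<in> ?G" "y \<in> X" for g y
    by (rule order_trans[OF \<psi>_0[OF that]]) (use g_le[OF that] \<Lambda> in auto)
  have int: "integrable \<mu> (\<lambda>y. \<psi> (g y))" if "g \<in> ?G" for g
    by (rule compose_lipschitz_integrable[OF prob nn_star_measurable[OF \<mu> that lip] that nn_star_zero sp \<psi> g_le[OF that]])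
  define F where "F = (\<lambda>\<sigma> :: real. {x \<in> space ?P. \<exists>g\<in>T. u \<le> (\<Sum>i=1..n. \<sigma> * (\<psi> (g (x i)) - \<psi> 0) - (\<integral>y. \<sigma> * (\<psi> (g y) - \<psi> 0) \<partial>\<mu>))})"
  have F: "measure ?P (F \<sigma>) \<le> A * exp (- (u\<^sup>2 / (16 * \<kappa> * \<Lambda>\<^sup>2)))" if \<sigma>: "\<bar>\<sigma>\<bar> = 1" for \<sigma>
    unfolding F_def
  proof (rule tail_bound[OF prob T(1,2) _ _ _ _ _ _ \<Lambda> \<kappa> u A, where K = "\<Lambda> * (2 * C)"])
    fix g g' y assume g: "g \<in> T" "g' \<in> T" and y: "y \<in> space \<mu>"
    show "\<bar>\<sigma> * (\<psi> (g y) - \<psi> 0) - \<sigma> * (\<psi> (g' y) - \<psi> 0)\<bar> \<le> \<Lambda> * \<bar>g y - g' y\<bar>"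
      using \<psi>_diff[of g g' y] g y T sp \<sigma> unfolding right_diff_distrib[symmetric] abs_mult by auto
  next
    fix g y assume g: "g \<in> T" and y: "y \<in> space \<mu>"
    have gG: "g \<in> ?G" "y \<in> X" using g y T sp by auto
    show "\<bar>\<sigma> * (\<psi> (g y) - \<psi> 0)\<bar> \<le> \<Lambda> * \<bar>g y\<bar>" "\<bar>\<sigma> * (\<psi> (g y) - \<psi> 0)\<bar> \<le> \<Lambda> * (2 * C)"
      using \<psi>_0[OF gG] bnd[OF gG] \<sigma> by (simp_all add: abs_mult)
  next
    fix g assume "g \<in> T"
    hence [measurable]: "(\<lambda>y. \<psi> (g y)) \<in> borel_measurable \<mu>" using T meas by auto
    show "(\<lambda>y. \<sigma> * (\<psi> (g y) - \<psi> 0)) \<in> borel_measurable \<mu>" by measurable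
  next
    fix x and \<theta> :: real assume x: "\<And>i. i \<in> {1..n} \<Longrightarrow> x i \<in> space \<mu>" and \<theta>: "0 \<le> \<theta>"
    have "sign_mean {1..n} (\<lambda>\<epsilon>. MAX g\<in>T. exp (\<Sum>i=1..n. \<epsilon> i * (\<theta> * g (x i))))
       \<le> 2 * real (card N) * (real d + 1) * exp (32 * \<theta>\<^sup>2 * real (card {1..n}) * (real k * B + 1)\<^sup>2)"
      by (rule network_sign_mean_le[OF _ d k T _ M N net lip \<phi> r \<theta>]) (use x y sp in auto)
    also have "\<dots> \<le> A * exp (\<kappa> * \<theta>\<^sup>2)"
    proof -
      have "(real k * B + 1)\<^sup>2 \<le> (2 * C)\<^sup>2" using C \<open>0 \<le> real k * B\<close> by (intro power_mono) auto
      hence "32 * \<theta>\<^sup>2 * real n * (real k * B + 1)\<^sup>2 \<le> 32 * \<theta>\<^sup>2 * real n * (2 * C)\<^sup>2"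
        by (intro mult_left_mono) auto
      also have "\<dots> = \<kappa> * \<theta>\<^sup>2" by (simp add: \<kappa>_def power_mult_distrib)
      finally show ?thesis unfolding A_def by (intro mult_left_mono) auto
    qed
    finally show "sign_mean {1..n} (\<lambda>\<epsilon>. MAX g\<in>T. exp (\<Sum>i=1..n. \<epsilon> i * (\<theta> * g (x i)))) \<le> A * exp (\<kappa> * \<theta>\<^sup>2)" .
  qed simp
  have F_sets: "F \<sigma> \<in> sets ?P" for \<sigma>
  proof -
    have [measurable]: "g \<in> T \<Longrightarrow> (\<lambda>y. \<psi> (g y)) \<in> borel_measurable \<mu>" for g using T meas by auto
    show ?thesis unfolding F_def using T(1) by measurable
  qed
  have sub: "{x \<in> space ?P. \<exists>g\<in>T. u \<le> \<bar>\<Sum>i=1..n. \<psi> (g (x i)) - (\<integral>y. \<psi> (g y) \<partial>\<mu>)\<bar>} \<subseteq> F 1 \<union> F (-1)"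
  proof
    fix x assume "x \<in> {x \<in> space ?P. \<exists>g\<in>T. u \<le> \<bar>\<Sum>i=1..n. \<psi> (g (x i)) - (\<integral>y. \<psi> (g y) \<partial>\<mu>)\<bar>}"
    then obtain g where x: "x \<in> space ?P" and g: "g \<in> T" and le: "u \<le> \<bar>\<Sum>i=1..n. \<psi> (g (x i)) - (\<integral>y. \<psi> (g y) \<partial>\<mu>)\<bar>"
      by blast
    define S where "S = (\<Sum>i=1..n. \<psi> (g (x i)) - (\<integral>y. \<psi> (g y) \<partial>\<mu>))"
    have "(\<integral>y. \<sigma> * (\<psi> (g y) - \<psi> 0) \<partial>\<mu>) = \<sigma> * ((\<integral>y. \<psi> (g y) \<partial>\<mu>) - \<psi> 0)" for \<sigma>
      using int[of g] g T by (auto simp: prob_space)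
    hence eq: "(\<Sum>i=1..n. \<sigma> * (\<psi> (g (x i)) - \<psi> 0) - (\<integral>y. \<sigma> * (\<psi> (g y) - \<psi> 0) \<partial>\<mu>)) = \<sigma> * S" for \<sigma>
      unfolding S_def sum_distrib_left by (intro sum.cong) (auto simp: algebra_simps)
    have in_F: "x \<in> F \<sigma>" if "u \<le> \<sigma> * S" for \<sigma>
      unfolding F_def mem_Collect_eq by (intro conjI x bexI[OF _ g]) (simp only: eq that)
    have "u \<le> 1 * S \<or> u \<le> (-1) * S" using le unfolding S_def[symmetric] by auto
    thus "x \<in> F 1 \<union> F (-1)" using in_F by blast
  qed
  have "measure ?P {x \<in> space ?P. \<exists>g\<in>T. u \<le> \<bar>\<Sum>i=1..n. \<psi> (g (x i)) - (\<integral>y. \<psi> (g y) \<partial>\<mu>)\<bar>} \<le> measure ?P (F 1 \<union> F (-1))"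
    by (intro P.finite_measure_mono sub sets.Un F_sets)
  also have "\<dots> \<le> measure ?P (F 1) + measure ?P (F (-1))"
    by (intro measure_Un_le F_sets)
  also have "\<dots> \<le> A * exp (- (u\<^sup>2 / (16 * \<kappa> * \<Lambda>\<^sup>2))) + A * exp (- (u\<^sup>2 / (16 * \<kappa> * \<Lambda>\<^sup>2)))"
    by (intro add_mono F) auto
  also have "\<dots> = 4 * real (card N) * (real d + 1) * exp (- (u\<^sup>2 / (16 * \<kappa> * \<Lambda>\<^sup>2)))"
    by (simp add: A_def)
  also have "16 * \<kappa> * \<Lambda>\<^sup>2 = 2048 * real n * C\<^sup>2 * \<Lambda>\<^sup>2"
    by (simp add: \<kappa>_def)
  finally show ?thesis .
qed

section \<open>Deviations of both samples over the whole class\<close>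

lemma centered_sum_diff_le:
  assumes \<mu>: "prob_space \<mu>" and int: "integrable \<mu> f" "integrable \<mu> f'"
    and le: "\<And>y. y \<in> space \<mu> \<Longrightarrow> \<bar>f y - f' y\<bar> \<le> (\<rho> :: real)" and x: "\<And>i. i \<in> I \<Longrightarrow> x i \<in> space \<mu>"
  shows "\<bar>(\<Sum>i\<in>I. f (x i) - (\<integral>y. f y \<partial>\<mu>)) - (\<Sum>i\<in>I. f' (x i) - (\<integral>y. f' y \<partial>\<mu>))\<bar> \<le> real (card I) * (2 * \<rho>)"
proof -
  interpret prob_space \<mu> by fact
  have "\<bar>(\<integral>y. f y \<partial>\<mu>) - (\<integral>y. f' y \<partial>\<mu>)\<bar> = \<bar>\<integral>y. f y - f' y \<partial>\<mu>\<bar>"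
    using int by simp
  also have "\<dots> \<le> (\<integral>y. \<bar>f y - f' y\<bar> \<partial>\<mu>)" by (rule integral_abs_bound)
  also have "\<dots> \<le> \<rho>"
    using int le by (intro integral_le_const AE_I2) auto
  finally have e: "\<bar>(\<integral>y. f y \<partial>\<mu>) - (\<integral>y. f' y \<partial>\<mu>)\<bar> \<le> \<rho>" .
  have "\<bar>\<Sum>i\<in>I. (f (x i) - (\<integral>y. f y \<partial>\<mu>)) - (f' (x i) - (\<integral>y. f' y \<partial>\<mu>))\<bar> \<le> (\<Sum>i\<in>I. 2 * \<rho>)"
  proof (rule order_trans[OF sum_abs], rule sum_mono)
    fix i assume "i \<in> I"
    thus "\<bar>(f (x i) - (\<integral>y. f y \<partial>\<mu>)) - (f' (x i) - (\<integral>y. f' y \<partial>\<mu>))\<bar> \<le> 2 * \<rho>"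
      using e le[OF x[of i]] by linarith
  qed
  thus ?thesis by (simp add: sum_subtractf)
qed

text \<open>
  Only finitely many networks matter, at the price of lowering the level from \<open>3 t / 4\<close> to \<open>t / 2\<close>. Then
  one of the two samples contributes at least \<open>t / 4\<close>, whose square turns the constant 2048 for one sample
  into \<open>32768 = 16 * 2048\<close>. The event \<open>E\<close> may fail to be measurable, in which case its \<open>measure\<close> is 0.
\<close>

lemma two_sample_deviation:
  fixes X :: "(nat \<Rightarrow> real) set"
  assumes d: "d \<ge> 1" and k: "k \<ge> 1" and X: "X \<subseteq> euclid d" "X \<noteq> {}"
    and \<mu>: "\<mu> \<in> prob_measures d X" and \<nu>: "\<nu> \<in> prob_measures d X"
    and y: "\<And>y j. y \<in> X \<Longrightarrow> j < d \<Longrightarrow> \<bar>y j\<bar> \<le> M" and M: "0 \<le> M"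
    and lip: "\<And>s t. \<bar>\<phi> s - \<phi> t\<bar> \<le> \<bar>s - t\<bar>" and \<phi>: "\<And>s. \<bar>s\<bar> \<le> M + 1 \<Longrightarrow> \<bar>\<phi> s\<bar> \<le> B"
    and N: "finite N" "N \<subseteq> neuron_params d" and net: "\<And>p. p \<in> neuron_params d \<Longrightarrow> \<exists>c\<in>N. params_dist d p c \<le> r"
    and r: "0 \<le> r" "r * (M + 1) \<le> B"
    and H: "L-lipschitz_on (range_on (nn_star d k \<phi>) X) H"
    and n: "n \<ge> 1" and t: "0 < t" and C: "real k * B + 1 \<le> 2 * C"
    and E: "E \<subseteq> {(xs, ys) \<in> space (sample_measure n \<mu> \<nu>). \<exists>g\<in>nn_star d k \<phi>. 3 / 4 * t
        \<le> \<bar>1 / real n * (\<Sum>i=1..n. g (xs i) - H (g (ys i))) - ((\<integral>y. g y \<partial>\<mu>) - (\<integral>y. H (g y) \<partial>\<nu>))\<bar>}"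
  shows "measure (sample_measure n \<mu> \<nu>) E
       \<le> 8 * real (card N) * (real d + 1) * exp (- (real n * t\<^sup>2 / (32768 * C\<^sup>2 * (L + 1)\<^sup>2)))"
proof (cases "E \<in> sets (sample_measure n \<mu> \<nu>)")
  case False
  thus ?thesis by (simp add: measure_notin_sets)
next
  case True
  let ?G = "nn_star d k \<phi>" and ?P = "\<Pi>\<^sub>M i\<in>{1..n}. \<mu>" and ?Q = "\<Pi>\<^sub>M i\<in>{1..n}. \<nu>"
  have prob: "prob_space \<mu>" "prob_space \<nu>" using \<mu> \<nu> by (auto simp: prob_measures_def)
  interpret P: prob_space ?P by (intro prob_space_PiM prob)
  interpret Q: prob_space ?Q by (intro prob_space_PiM prob)
  interpret PQ: pair_prob_space ?P ?Q ..
  have sp: "space \<mu> = X" "space \<nu> = X"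
    using space_prob_measures X(1) \<mu> \<nu> by auto
  have B: "0 \<le> B" using r M by (intro order_trans[OF mult_nonneg_nonneg r(2)]) auto
  define \<Lambda> where "\<Lambda> = L + 1"
  have L: "0 \<le> L" by (rule lipschitz_on_nonneg[OF H])
  hence \<Lambda>: "0 < \<Lambda>" by (simp add: \<Lambda>_def)
  have H': "\<Lambda>-lipschitz_on (range_on ?G X) H"
    by (rule lipschitz_on_mono[OF H]) (auto simp: \<Lambda>_def)
  have id: "\<Lambda>-lipschitz_on (range_on ?G X) (\<lambda>z. z)"
    using L \<Lambda> mult_right_mono[of 1 \<Lambda>] by (auto simp: lipschitz_on_def dist_real_def \<Lambda>_def)
  \<comment> \<open>Replacing \<open>g\<close> by a network at distance \<open>\<eta>\<close> changes the deviation by at most \<open>2 \<Lambda> \<eta> = t / 4\<close>.\<close>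
  define \<eta> where "\<eta> = t / (8 * \<Lambda>)"
  have \<eta>: "0 < \<eta>" using t \<Lambda> by (simp add: \<eta>_def)
  obtain T where T: "finite T" "T \<subseteq> ?G"
    and T_net: "\<And>g. g \<in> ?G \<Longrightarrow> \<exists>g'\<in>T. \<forall>y. (\<forall>j<d. \<bar>y j\<bar> \<le> M) \<longrightarrow> \<bar>g y - g' y\<bar> \<le> \<eta>"
    using nn_star_finite_uniform_net[OF d lip \<phi> M B \<eta>] by metis
  have T_ne: "T \<noteq> {}" using T_net[OF nn_star_zero] by blast
  have g_le: "\<bar>g y\<bar> \<le> real k * B + 1" if "g \<in> ?G" "y \<in> X" for g y
    by (rule abs_nn_star_le[OF that(1) \<phi>]) (use y that M in auto)
  have int_\<mu>: "integrable \<mu> (\<lambda>y. g y)" if "g \<in> ?G" for g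
    by (rule compose_lipschitz_integrable[OF prob(1) nn_star_measurable[OF \<mu> that lip] that nn_star_zero sp(1) id])
      (use g_le that in auto)
  have int_\<nu>: "integrable \<nu> (\<lambda>y. H (g y))" if "g \<in> ?G" for g
    by (rule compose_lipschitz_integrable[OF prob(2) nn_star_measurable[OF \<nu> that lip] that nn_star_zero sp(2) H])
      (use g_le that in auto)
  define u where "u = real n * t / 4"
  have u: "0 \<le> u" using t by (simp add: u_def)
  define S1 where "S1 g x = (\<Sum>i=1..n. g (x i) - (\<integral>y. g y \<partial>\<mu>))" for g :: "(nat \<Rightarrow> real) \<Rightarrow> real" and x
  define S2 where "S2 g x = (\<Sum>i=1..n. H (g (x i)) - (\<integral>y. H (g y) \<partial>\<nu>))" for g :: "(nat \<Rightarrow> real) \<Rightarrow> real" and x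
  define F1 where "F1 = {x \<in> space ?P. \<exists>g\<in>T. u \<le> \<bar>S1 g x\<bar>}"
  define F2 where "F2 = {x \<in> space ?Q. \<exists>g\<in>T. u \<le> \<bar>S2 g x\<bar>}"
  define b where "b = 4 * real (card N) * (real d + 1) * exp (- (u\<^sup>2 / (2048 * real n * C\<^sup>2 * \<Lambda>\<^sup>2)))"
  have F1: "measure ?P F1 \<le> b"
    unfolding F1_def S1_def b_def
    by (rule one_sample_deviation[where \<psi> = "\<lambda>z. z",
          OF d k X \<mu> _ M lip \<phi> N net r T(1) T_ne T(2) id \<Lambda> n u C]) (use y in auto)
  have F2: "measure ?Q F2 \<le> b"
    unfolding F2_def S2_def b_def
    by (rule one_sample_deviation[where \<psi> = H,
          OF d k X \<nu> _ M lip \<phi> N net r T(1) T_ne T(2) H' \<Lambda> n u C]) (use y in auto)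
  have meas1 [measurable]: "g \<in> T \<Longrightarrow> (\<lambda>y. g y) \<in> borel_measurable \<mu>" for g
    using nn_star_measurable[OF \<mu> _ lip] T(2) by auto
  have meas2 [measurable]: "g \<in> T \<Longrightarrow> (\<lambda>y. H (g y)) \<in> borel_measurable \<nu>" for g
    using int_\<nu> T(2) by (auto intro: borel_measurable_integrable)
  have F_sets [measurable]: "F1 \<in> sets ?P" "F2 \<in> sets ?Q"
    unfolding F1_def F2_def S1_def S2_def using T(1) by measurable
  have rect: "F1 \<times> space ?Q \<in> sets (?P \<Otimes>\<^sub>M ?Q)" "space ?P \<times> F2 \<in> sets (?P \<Otimes>\<^sub>M ?Q)"
    by (intro pair_measureI F_sets sets.top)+
  have "E \<subseteq> F1 \<times> space ?Q \<union> space ?P \<times> F2"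
  proof
    fix z assume "z \<in> E"
    obtain xs ys where z: "z = (xs, ys)" by (cases z)
    with \<open>z \<in> E\<close> E obtain g where xs: "xs \<in> space ?P" and ys: "ys \<in> space ?Q" and g: "g \<in> ?G"
      and large: "3 / 4 * t \<le> \<bar>1 / real n * (\<Sum>i=1..n. g (xs i) - H (g (ys i))) - ((\<integral>y. g y \<partial>\<mu>) - (\<integral>y. H (g y) \<partial>\<nu>))\<bar>"
      unfolding sample_measure_def space_pair_measure by blast
    have xs': "xs i \<in> X" "ys i \<in> X" if "i \<in> {1..n}" for i
      using xs ys that sp by (auto simp: space_PiM)
    obtain g' where g': "g' \<in> T" and close: "\<And>y. (\<forall>j<d. \<bar>y j\<bar> \<le> M) \<Longrightarrow> \<bar>g y - g' y\<bar> \<le> \<eta>"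
      using T_net[OF g] by blast
    have g'G: "g' \<in> ?G" using g' T by blast
    have closeX: "\<bar>g y - g' y\<bar> \<le> \<eta>" if "y \<in> X" for y
      using close y that by blast
    have closeH: "\<bar>H (g y) - H (g' y)\<bar> \<le> L * \<eta>" if "y \<in> X" for y
    proof -
      have "\<bar>H (g y) - H (g' y)\<bar> \<le> L * \<bar>g y - g' y\<bar>"
        using lipschitz_onD[OF H, of "g y" "g' y"] g g'G that by (auto simp: dist_real_def range_on_def)
      also have "\<dots> \<le> L * \<eta>" using closeX[OF that] L by (intro mult_left_mono) auto
      finally show ?thesis .
    qed
    have d1: "\<bar>S1 g xs - S1 g' xs\<bar> \<le> real (card {1..n}) * (2 * \<eta>)"
      unfolding S1_def by (rule centered_sum_diff_le[OF prob(1) int_\<mu>[OF g] int_\<mu>[OF g'G]]) (use closeX xs' sp in auto)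
    have d2: "\<bar>S2 g ys - S2 g' ys\<bar> \<le> real (card {1..n}) * (2 * (L * \<eta>))"
      unfolding S2_def by (rule centered_sum_diff_le[OF prob(2) int_\<nu>[OF g] int_\<nu>[OF g'G]]) (use closeH xs' sp in auto)
    have small: "real n * (2 * \<eta>) + real n * (2 * (L * \<eta>)) = u"
    proof -
      have "real n * (2 * \<eta>) + real n * (2 * (L * \<eta>)) = 2 * real n * (\<Lambda> * \<eta>)"
        by (simp add: \<Lambda>_def algebra_simps)
      also have "\<Lambda> * \<eta> = t / 8" using \<Lambda> by (simp add: \<eta>_def)
      finally show ?thesis by (simp add: u_def)
    qed
    have "1 / real n * (\<Sum>i=1..n. g (xs i) - H (g (ys i))) - ((\<integral>y. g y \<partial>\<mu>) - (\<integral>y. H (g y) \<partial>\<nu>)) = (S1 g xs - S2 g ys) / real n"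
      using n by (simp add: S1_def S2_def sum_subtractf field_simps)
    hence "3 / 4 * t \<le> \<bar>S1 g xs - S2 g ys\<bar> / real n"
      using large by (simp only: abs_divide abs_of_nat)
    hence "3 * u \<le> \<bar>S1 g xs - S2 g ys\<bar>"
      using n by (simp add: u_def field_simps)
    hence "u \<le> \<bar>S1 g' xs\<bar> \<or> u \<le> \<bar>S2 g' ys\<bar>"
      using d1 d2 small by simp linarith
    thus "z \<in> F1 \<times> space ?Q \<union> space ?P \<times> F2"
      using xs ys g' by (auto simp: z F1_def F2_def)
  qed
  hence "measure (?P \<Otimes>\<^sub>M ?Q) E \<le> measure (?P \<Otimes>\<^sub>M ?Q) (F1 \<times> space ?Q \<union> space ?P \<times> F2)"
    by (rule PQ.P.finite_measure_mono) (intro sets.Un rect)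
  also have "\<dots> \<le> measure (?P \<Otimes>\<^sub>M ?Q) (F1 \<times> space ?Q) + measure (?P \<Otimes>\<^sub>M ?Q) (space ?P \<times> F2)"
    by (intro measure_Un_le rect)
  also have "measure (?P \<Otimes>\<^sub>M ?Q) (F1 \<times> space ?Q) = measure ?P F1"
    unfolding measure_def by (subst Q.emeasure_pair_measure_Times) (simp_all only: F_sets sets.top Q.emeasure_space_1 mult_1_right)
  also have "measure (?P \<Otimes>\<^sub>M ?Q) (space ?P \<times> F2) = measure ?Q F2"
    unfolding measure_def by (subst Q.emeasure_pair_measure_Times) (simp_all only: F_sets sets.top P.emeasure_space_1 mult_1_left)
  also have "measure ?P F1 + measure ?Q F2 \<le> b + b"
    by (intro add_mono F1 F2)
  also have "\<dots> = 8 * real (card N) * (real d + 1) * exp (- (real n * t\<^sup>2 / (32768 * C\<^sup>2 * (L + 1)\<^sup>2)))"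
  proof -
    have "u\<^sup>2 / (2048 * real n * C\<^sup>2 * \<Lambda>\<^sup>2) = real n * t\<^sup>2 / (32768 * C\<^sup>2 * (L + 1)\<^sup>2)"
      using n by (simp add: u_def \<Lambda>_def power_mult_distrib power_divide power2_eq_square mult_ac)
    thus ?thesis by (simp add: b_def)
  qed
  finally show ?thesis by (simp only: sample_measure_def)
qed

section \<open>Activations\<close>

lemma relu_lipschitz: "\<bar>relu s - relu t\<bar> \<le> \<bar>s - t\<bar>"
  by (auto simp: relu_def)

lemma abs_relu_le: "\<bar>s\<bar> \<le> M \<Longrightarrow> \<bar>relu s\<bar> \<le> M"
  by (auto simp: relu_def)

lemma abs_sigmoid_le: "\<bar>sigmoid s\<bar> \<le> 1"
proof -
  have "1 \<le> 1 + exp (- s)" by simp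
  hence "inverse (1 + exp (- s)) \<le> 1" by (rule inverse_le_1_iff[THEN iffD2, OF disjI2])
  moreover have "0 \<le> inverse (1 + exp (- s))" by (simp add: add_nonneg_nonneg)
  ultimately show ?thesis by (simp add: sigmoid_def)
qed

lemma sigmoid_lipschitz: "\<bar>sigmoid s - sigmoid t\<bar> \<le> \<bar>s - t\<bar>"
proof -
  have "norm (sigmoid s - sigmoid t) \<le> 1 * norm (s - t)"
  proof (rule field_differentiable_bound[of UNIV sigmoid "\<lambda>z. exp (- z) / (1 + exp (- z))\<^sup>2"])
    fix z :: real
    have "1 + exp (- z) > 0" by (simp add: add_pos_pos)
    thus "(sigmoid has_field_derivative exp (- z) / (1 + exp (- z))\<^sup>2) (at z within UNIV)"
      unfolding sigmoid_def[abs_def]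
      by (auto intro!: derivative_eq_intros simp: power2_eq_square divide_inverse)
    have "exp (- z) \<le> (1 + exp (- z))\<^sup>2"
      by (simp add: power2_eq_square algebra_simps add_nonneg_nonneg)
    thus "norm (exp (- z) / (1 + exp (- z))\<^sup>2) \<le> 1"
      using \<open>1 + exp (- z) > 0\<close> by simp
  qed auto
  thus ?thesis by simp
qed

lemma nat_plus_one_le_exp: "real d + 1 \<le> exp (real d)"
  using exp_ge_add_one_self[of "real d"] by linarith

text \<open>
  For the rectifier the bound \<open>B = M + 1\<close> is as large as the affine maps, so one centre, the zero
  neuron, is enough.
\<close>

lemma zero_net:
  shows "{(\<lambda>_. 0, 0)} \<subseteq> neuron_params d" "p \<in> neuron_params d \<Longrightarrow> params_dist d p (\<lambda>_. 0, 0) \<le> 1"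
  by (auto simp: neuron_params_def params_dist_def l1norm_def)

text \<open>
  For the sigmoid \<open>B = 1\<close>, so the radius has to be \<open>1 / (M + 1)\<close>. Rounding changes each
  of the \<open>d\<close> coordinates by up to \<open>1 / m\<close>, which requires \<open>m\<close> of order \<open>d (M + 1)\<close>.
\<close>

lemma fine_net:
  assumes d: "d \<ge> 1" and M: "0 \<le> M"
  obtains N where "finite N" "N \<subseteq> neuron_params d" "\<And>p. p \<in> neuron_params d \<Longrightarrow> \<exists>c\<in>N. params_dist d p c \<le> 1 / (M + 1)"
    "real (card N) * (real d + 1) \<le> exp (9 * real d * (M + 1))"
proof -
  define j where "j = nat \<lceil>M + 1\<rceil>"
  have j: "M + 1 \<le> real j" "real j \<le> M + 2" "j \<ge> 1"
    using M by (simp_all add: j_def) linarith+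
  define m where "m = d * j"
  have m: "m \<ge> 1" using d j by (simp add: m_def)
  have "real d / real m = 1 / real j" using d by (simp add: m_def)
  also have "\<dots> \<le> 1 / (M + 1)" using j M by (intro divide_left_mono) auto
  finally have r: "real d / real m \<le> 1 / (M + 1)" .
  show ?thesis
  proof (rule that[of "grid_net d m"])
    show "finite (grid_net d m)" "grid_net d m \<subseteq> neuron_params d"
      using finite_grid_net grid_net_subset[OF m] by auto
    show "\<exists>c\<in>grid_net d m. params_dist d p c \<le> 1 / (M + 1)" if "p \<in> neuron_params d" for p
      using grid_net_approx[OF m d that] r by (meson order_trans)
    have e1: "(3::real) \<le> exp 2" "(4::real) \<le> exp 2"
      using exp_lower_Taylor_quadratic[of 2] by auto
    have "real (card (grid_net d m)) \<le> 3 ^ (d + 1) * 4 ^ m" by (rule card_grid_net_le)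
    also have "\<dots> \<le> exp 2 ^ (d + 1) * exp 2 ^ m"
      using e1 by (intro mult_mono power_mono) auto
    also have "\<dots> = exp (2 * real (d + 1) + 2 * real m)"
      by (simp only: exp_add exp_of_nat2_mult)
    finally have "real (card (grid_net d m)) * (real d + 1) \<le> exp (2 * real (d + 1) + 2 * real m) * exp (real d)"
      by (intro mult_mono nat_plus_one_le_exp) auto
    also have "\<dots> = exp (3 * real d + 2 + 2 * real m)"
      by (simp add: mult_exp_exp)
    also have "\<dots> \<le> exp (9 * real d * (M + 1))"
    proof -
      have "real m \<le> real d * (M + 2)" using j by (simp add: m_def mult_left_mono)
      moreover have "real d * M \<ge> 0" using M by simp
      ultimately show ?thesis using d by (simp add: algebra_simps)
    qed
    finally show "real (card (grid_net d m)) * (real d + 1) \<le> exp (9 * real d * (M + 1))" .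
  qed
qed

section \<open>Absorbing the size of the net\<close>

text \<open>
  The constant \<open>e\<close> enters as \<open>e\<^sup>2 / (32768 C\<^sup>2 \<Lambda>\<^sup>2) = 32768 k\<^sup>2 d (M + 1) / C\<close>. As \<open>C \<le> 2 k B\<close>, this is
  at least of order \<open>d (M + 1) / B\<close>, which bounds the logarithm of the prefactor \<open>K\<close> for both activations.
\<close>

lemma net_absorbed:
  fixes C B M \<Lambda> \<delta> K :: real
  assumes "d \<ge> 1" "k \<ge> 1" and K: "0 \<le> K" "K \<le> exp (9 * real d * (M + 1) / B)"
    and B: "1 \<le> B" and M: "0 \<le> M" and C: "0 < C" "C \<le> real k * B + 1" and \<Lambda>: "0 < \<Lambda>" and \<delta>: "0 \<le> \<delta>" and n: "n \<ge> 1"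
    and e: "e = 32768 * real k * sqrt (real d * (M + 1)) * \<Lambda> * sqrt C"
    and t: "t = \<delta> + e * (1 / sqrt (real n))"
  shows "8 * K * exp (- (real n * t\<^sup>2 / (32768 * C\<^sup>2 * \<Lambda>\<^sup>2))) \<le> 32768 * exp (- (real n * \<delta>\<^sup>2 / (32768 * C\<^sup>2 * \<Lambda>\<^sup>2)))"
proof -
  define D where "D = 32768 * C\<^sup>2 * \<Lambda>\<^sup>2"
  have D: "0 < D" using C \<Lambda> by (simp add: D_def)
  have e0: "0 \<le> e" using M C \<Lambda> by (simp add: e)
  have "\<delta>\<^sup>2 + (e * (1 / sqrt (real n)))\<^sup>2 \<le> t\<^sup>2"
    unfolding t power2_sum using \<delta> e0 by simp
  hence "real n * \<delta>\<^sup>2 + e\<^sup>2 \<le> real n * t\<^sup>2"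
    using n mult_left_mono[of "\<delta>\<^sup>2 + (e * (1 / sqrt (real n)))\<^sup>2" "t\<^sup>2" "real n"]
    by (simp add: power_mult_distrib power_divide distrib_left)
  hence 1: "real n * \<delta>\<^sup>2 / D + e\<^sup>2 / D \<le> real n * t\<^sup>2 / D"
    using D by (simp add: add_divide_distrib[symmetric] divide_right_mono)
  have e2: "e\<^sup>2 = 32768\<^sup>2 * (real k)\<^sup>2 * (real d * (M + 1)) * \<Lambda>\<^sup>2 * C"
    using M C by (simp add: e power_mult_distrib)
  have "e\<^sup>2 / D = 32768 * (real k)\<^sup>2 * (real d * (M + 1)) / C"
    unfolding e2 D_def using C \<Lambda> by (simp add: power2_eq_square field_simps)
  also have "\<dots> \<ge> 9 * real d * (M + 1) / B"
  proof -
    have kB: "1 * 1 \<le> real k * B" using assms by (intro mult_mono) auto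
    hence "C \<le> 2 * real k * B" using C by simp
    also have "\<dots> \<le> 2 * (real k)\<^sup>2 * B"
      using assms(2) B by (simp add: power2_eq_square)
    finally have "C \<le> 2 * ((real k)\<^sup>2 * B)" by simp
    hence "9 * C \<le> 32768 * ((real k)\<^sup>2 * B)" using C(1) by linarith
    hence "9 * C \<le> 32768 * (real k)\<^sup>2 * B" by simp
    hence "9 * C * (real d * (M + 1)) \<le> 32768 * (real k)\<^sup>2 * B * (real d * (M + 1))"
      using M by (intro mult_right_mono) auto
    thus ?thesis using B C by (simp add: field_simps)
  qed
  finally have "K \<le> exp (e\<^sup>2 / D)"
    using K(2) by (meson exp_le_cancel_iff order_trans)
  hence "K * exp (- (real n * t\<^sup>2 / D)) \<le> exp (e\<^sup>2 / D) * exp (- (real n * t\<^sup>2 / D))"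
    by (intro mult_right_mono) auto
  also have "\<dots> = exp (e\<^sup>2 / D - real n * t\<^sup>2 / D)"
    by (simp add: mult_exp_exp)
  also have "\<dots> \<le> exp (- (real n * \<delta>\<^sup>2 / D))"
    using 1 by (intro exp_le_cancel_iff[THEN iffD2]) linarith
  finally have "8 * (K * exp (- (real n * t\<^sup>2 / D))) \<le> 32768 * exp (- (real n * \<delta>\<^sup>2 / D))"
    using exp_ge_zero[of "- (real n * \<delta>\<^sup>2 / D)"] by linarith
  thus ?thesis by (simp add: D_def)
qed

section \<open>Suprema and expectations in the extended reals\<close>

lemma ereal_expectation_eq_integral:
  assumes "integrable \<mu> f"
  shows "ereal_expectation \<mu> (\<lambda>x. ereal (f x)) = ereal (\<integral>x. f x \<partial>\<mu>)"
proof -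
  have fin: "(\<integral>\<^sup>+x. ennreal (f x) \<partial>\<mu>) < \<infinity>" "(\<integral>\<^sup>+x. ennreal (- f x) \<partial>\<mu>) < \<infinity>"
    using assms integrableD(2)[OF assms] integrableD(2)[of \<mu> "\<lambda>x. - f x"] by (auto simp: real_integrable_def less_top)
  have conv: "enn2ereal a = ereal (enn2real a)" if "a < \<infinity>" for a
    using that by (cases a) (auto simp: enn2real_def enn2ereal_ennreal less_top)
  show ?thesis
    unfolding ereal_expectation_def uminus_ereal.simps(1) e2ennreal_ereal
    by (simp only: conv[OF fin(1)] conv[OF fin(2)] real_lebesgue_integral_def[OF assms] ereal_minus(1))
qed

lemma ereal_expectation_cong:
  assumes "\<And>x. x \<in> space \<mu> \<Longrightarrow> f x = f' x"
  shows "ereal_expectation \<mu> f = ereal_expectation \<mu> f'"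
  unfolding ereal_expectation_def using assms by (simp cong: nn_integral_cong)

lemma SUP_ereal_bounded:
  assumes "G \<noteq> {}" "\<And>g. g \<in> G \<Longrightarrow> \<bar>a g\<bar> \<le> (K :: real)"
  shows "(SUP g\<in>G. ereal (a g)) = ereal (SUP g\<in>G. a g)"
proof (rule ereal_SUP[symmetric])
  have "(SUP g\<in>G. ereal (a g)) \<le> ereal K"
    using assms(2) by (intro SUP_least) (auto simp: abs_le_iff)
  moreover obtain g where g: "g \<in> G" using assms(1) by blast
  have "ereal (- K) \<le> (SUP g\<in>G. ereal (a g))"
    using assms(2)[OF g] by (intro SUP_upper2[OF g]) auto
  ultimately show "\<bar>SUP g\<in>G. ereal (a g)\<bar> \<noteq> \<infinity>" by auto
qed

lemma SUP_diff_le: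
  assumes ne: "G \<noteq> {}" and a: "\<And>g. g \<in> G \<Longrightarrow> \<bar>a g\<bar> \<le> (K :: real)" and b: "\<And>g. g \<in> G \<Longrightarrow> \<bar>b g\<bar> \<le> K"
    and diff: "\<And>g. g \<in> G \<Longrightarrow> \<bar>a g - b g\<bar> \<le> \<rho>"
  shows "\<bar>(SUP g\<in>G. a g) - (SUP g\<in>G. b g)\<bar> \<le> \<rho>"
proof -
  have bdd: "bdd_above (a ` G)" "bdd_above (b ` G)"
    using a b by (auto intro!: bdd_aboveI2[where M = K] simp: abs_le_iff)
  have "a g \<le> (SUP g\<in>G. b g) + \<rho>" if "g \<in> G" for g
    using cSUP_upper[OF that bdd(2)] diff[OF that] by linarith
  hence "(SUP g\<in>G. a g) \<le> (SUP g\<in>G. b g) + \<rho>" by (rule cSUP_least[OF ne])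
  moreover have "b g \<le> (SUP g\<in>G. a g) + \<rho>" if "g \<in> G" for g
    using cSUP_upper[OF that bdd(1)] diff[OF that] by linarith
  hence "(SUP g\<in>G. b g) \<le> (SUP g\<in>G. a g) + \<rho>" by (rule cSUP_least[OF ne])
  ultimately show ?thesis by linarith
qed

section \<open>The divergence and its estimator\<close>

lemma nn_star_scale:
  assumes "g \<in> nn_star d k \<phi>" "\<bar>a\<bar> \<le> 1"
  shows "(\<lambda>y. a * g y) \<in> nn_star d k \<phi>"
proof -
  obtain \<beta> p b0 where par: "\<And>i. i \<in> {1..k} \<Longrightarrow> p i \<in> neuron_params d \<and> \<bar>\<beta> i\<bar> \<le> 1" "\<bar>b0\<bar> \<le> 1"
    and g: "g = network d k \<phi> \<beta> p b0" using assms(1) unfolding nn_star_iff by blast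
  have "(\<lambda>y. a * g y) = network d k \<phi> (\<lambda>i. a * \<beta> i) p (a * b0)"
    by (simp add: g network_def fun_eq_iff distrib_left sum_distrib_left mult.assoc)
  thus ?thesis
    unfolding nn_star_iff using par assms(2)
    by (intro exI[of _ "\<lambda>i. a * \<beta> i"] exI[of _ p] exI[of _ "a * b0"]) (auto simp: abs_mult mult_le_one)
qed

text \<open>
  The class is closed under multiplication by factors in \<open>[-1, 1]\<close>, so its set of values is symmetric and
  star-shaped about 0, hence an interval. This is what turns the bound on \<open>h'\<close> at values of networks
  into a Lipschitz bound for \<open>h\<close>.
\<close>

lemma convex_range_on_nn_star: "convex (range_on (nn_star d k \<phi>) X)"
proof -
  let ?J = "range_on (nn_star d k \<phi>) X"
  have scale: "a * z \<in> ?J" if "z \<in> ?J" "\<bar>a\<bar> \<le> 1" for a z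
    using that nn_star_scale[of _ d k \<phi> a] unfolding range_on_def by fastforce
  have "z \<in> ?J" if s: "s \<in> ?J" and t: "t \<in> ?J" and z: "s \<le> z" "z \<le> t" for s t z
  proof (cases "z \<ge> 0")
    case True
    show ?thesis
    proof (cases "t = 0")
      case False
      thus ?thesis using scale[OF t, of "z / t"] True z by simp
    qed (use True z t in simp)
  next
    case False
    thus ?thesis using scale[OF s, of "z / s"] z by simp
  qed
  hence "is_interval ?J" unfolding is_interval_1 by blast
  thus ?thesis by (simp add: is_interval_convex)
qed

text \<open>
  The member \<open>f\<close> and the point \<open>y\<close> guarantee that the supremum is not over the empty set, where
  it would be \<open>- \<infinity>\<close>.
\<close>

lemma C_upper_abs_finite:
  assumes "C_upper (abs_funs F) X < \<infinity>" "f \<in> F" "y \<in> X"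
  obtains K where "C_upper (abs_funs F) X = ereal K" "0 \<le> K" "\<And>f y. f \<in> F \<Longrightarrow> y \<in> X \<Longrightarrow> \<bar>f y\<bar> \<le> K"
    "\<And>K'. (\<And>f y. f \<in> F \<Longrightarrow> y \<in> X \<Longrightarrow> \<bar>f y\<bar> \<le> K') \<Longrightarrow> K \<le> K'"
proof -
  let ?C = "C_upper (abs_funs F) X"
  have le: "ereal \<bar>f y\<bar> \<le> ?C" if "f \<in> F" "y \<in> X" for f y
    unfolding C_upper_def abs_funs_def
    by (rule SUP_upper2[of "(y, \<lambda>x. \<bar>f x\<bar>)"]) (use that in auto)
  have "0 \<le> ?C" using le[OF assms(2,3)] by (rule order_trans[rotated]) simp
  then obtain K where K: "?C = ereal K" "0 \<le> K"
    using assms(1) by (cases ?C) auto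
  show ?thesis
  proof (rule that[of K])
    fix K' assume "\<And>f y. f \<in> F \<Longrightarrow> y \<in> X \<Longrightarrow> \<bar>f y\<bar> \<le> K'"
    hence "?C \<le> ereal K'"
      unfolding C_upper_def abs_funs_def by (intro SUP_least) auto
    thus "K \<le> K'" using K by simp
  qed (use K le in auto)
qed

text \<open>
  Both quantities are suprema over \<open>G\<close> of bounded real families, and suprema are 1-Lipschitz in
  the uniform norm. The factor \<open>3 / 4\<close> makes up for the fact that the supremum of the differences may not be
  attained; any factor below 1 would do.
\<close>

lemma estimator_deviation:
  fixes H :: "real \<Rightarrow> real"
  assumes G: "G \<noteq> {}" and space: "space \<mu> = X" "space \<nu> = X" and prob: "prob_space \<mu>" "prob_space \<nu>"
    and int: "\<And>g. g \<in> G \<Longrightarrow> integrable \<mu> g" "\<And>g. g \<in> G \<Longrightarrow> integrable \<nu> (\<lambda>y. H (g y))"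
    and bnd: "\<And>g y. g \<in> G \<Longrightarrow> y \<in> X \<Longrightarrow> \<bar>g y\<bar> \<le> K" "\<And>g y. g \<in> G \<Longrightarrow> y \<in> X \<Longrightarrow> \<bar>H (g y)\<bar> \<le> K"
    and h: "\<And>g y. g \<in> G \<Longrightarrow> y \<in> X \<Longrightarrow> h (g y) = ereal (H (g y))" and n: "n \<ge> 1"
    and z: "(xs, ys) \<in> space (sample_measure n \<mu> \<nu>)"
  shows "\<bar>divergence_est h G n xs ys - divergence h G \<mu> \<nu>\<bar> \<noteq> \<infinity>"
    and "0 < t \<Longrightarrow> ereal t \<le> \<bar>divergence_est h G n xs ys - divergence h G \<mu> \<nu>\<bar> \<Longrightarrow>
      \<exists>g\<in>G. 3 / 4 * t \<le> \<bar>1 / real n * (\<Sum>i=1..n. g (xs i) - H (g (ys i))) - ((\<integral>y. g y \<partial>\<mu>) - (\<integral>y. H (g y) \<partial>\<nu>))\<bar>"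
proof -
  define a where "a g = 1 / real n * (\<Sum>i=1..n. g (xs i) - H (g (ys i)))" for g
  define b where "b g = (\<integral>y. g y \<partial>\<mu>) - (\<integral>y. H (g y) \<partial>\<nu>)" for g
  have zX: "xs i \<in> X" "ys i \<in> X" if "i \<in> {1..n}" for i
    using z that space by (auto simp: sample_measure_def space_pair_measure space_PiM)
  have a_le: "\<bar>a g\<bar> \<le> 2 * K" if g: "g \<in> G" for g
  proof -
    have "\<bar>\<Sum>i=1..n. g (xs i) - H (g (ys i))\<bar> \<le> (\<Sum>i=1..n. 2 * K)"
    proof (rule order_trans[OF sum_abs], rule sum_mono)
      fix i assume "i \<in> {1..n}"
      thus "\<bar>g (xs i) - H (g (ys i))\<bar> \<le> 2 * K"
        using bnd[OF g zX(1)[of i]] bnd[OF g zX(2)[of i]] by linarith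
    qed
    thus ?thesis using n by (simp add: a_def abs_mult field_simps)
  qed
  have integral_le: "\<bar>\<integral>y. f y \<partial>\<rho>\<bar> \<le> K" if "prob_space \<rho>" "integrable \<rho> f" "\<And>y. y \<in> space \<rho> \<Longrightarrow> \<bar>f y\<bar> \<le> K"
    for f :: "'a \<Rightarrow> real" and \<rho>
  proof -
    interpret prob_space \<rho> by fact
    have "\<bar>\<integral>y. f y \<partial>\<rho>\<bar> \<le> (\<integral>y. \<bar>f y\<bar> \<partial>\<rho>)" by (rule integral_abs_bound)
    also have "\<dots> \<le> K" using that by (intro integral_le_const AE_I2) auto
    finally show ?thesis .
  qed
  have b_le: "\<bar>b g\<bar> \<le> 2 * K" if g: "g \<in> G" for g
  proof -
    have "\<bar>\<integral>y. g y \<partial>\<mu>\<bar> \<le> K" by (rule integral_le[OF prob(1) int(1)[OF g]]) (use bnd g space in auto)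
    moreover have "\<bar>\<integral>y. H (g y) \<partial>\<nu>\<bar> \<le> K" by (rule integral_le[OF prob(2) int(2)[OF g]]) (use bnd g space in auto)
    ultimately show ?thesis unfolding b_def by linarith
  qed
  have "divergence_est h G n xs ys = (SUP g\<in>G. ereal (a g))"
    unfolding divergence_est_def
  proof (rule SUP_cong)
    fix g assume g: "g \<in> G"
    have "(\<Sum>i=1..n. ereal (g (xs i)) - h (g (ys i))) = (\<Sum>i=1..n. ereal (g (xs i) - H (g (ys i))))"
      by (rule sum.cong) (use h[OF g zX(2)] in auto)
    also have "\<dots> = ereal (\<Sum>i=1..n. g (xs i) - H (g (ys i)))" by (rule sum_ereal)
    finally show "ereal (1 / real n) * (\<Sum>i=1..n. ereal (g (xs i)) - h (g (ys i))) = ereal (a g)"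
      by (simp add: a_def)
  qed simp
  also have "\<dots> = ereal (SUP g\<in>G. a g)" by (rule SUP_ereal_bounded[OF G a_le])
  finally have est: "divergence_est h G n xs ys = ereal (SUP g\<in>G. a g)" .
  have "divergence h G \<mu> \<nu> = (SUP g\<in>G. ereal (b g))"
    unfolding divergence_def
  proof (rule SUP_cong)
    fix g assume g: "g \<in> G"
    have "ereal_expectation \<nu> (\<lambda>y. h (g y)) = ereal_expectation \<nu> (\<lambda>y. ereal (H (g y)))"
      using h[OF g] space by (intro ereal_expectation_cong) auto
    thus "ereal_expectation \<mu> (\<lambda>x. ereal (g x)) - ereal_expectation \<nu> (\<lambda>y. h (g y)) = ereal (b g)"
      using int[OF g] by (simp add: ereal_expectation_eq_integral b_def)
  qed simp
  also have "\<dots> = ereal (SUP g\<in>G. b g)" by (rule SUP_ereal_bounded[OF G b_le])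
  finally have div: "divergence h G \<mu> \<nu> = ereal (SUP g\<in>G. b g)" .
  show "\<bar>divergence_est h G n xs ys - divergence h G \<mu> \<nu>\<bar> \<noteq> \<infinity>"
    by (simp add: est div)
  assume t: "0 < t" and large: "ereal t \<le> \<bar>divergence_est h G n xs ys - divergence h G \<mu> \<nu>\<bar>"
  have "\<exists>g\<in>G. 3 / 4 * t \<le> \<bar>a g - b g\<bar>"
  proof (rule ccontr)
    assume "\<not> ?thesis"
    hence "\<bar>(SUP g\<in>G. a g) - (SUP g\<in>G. b g)\<bar> \<le> 3 / 4 * t"
      by (intro SUP_diff_le[OF G a_le b_le]) (auto simp: not_le intro: less_imp_le)
    moreover have "t \<le> \<bar>(SUP g\<in>G. a g) - (SUP g\<in>G. b g)\<bar>"
      using large by (simp add: est div)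
    ultimately show False using t by linarith
  qed
  thus "\<exists>g\<in>G. 3 / 4 * t \<le> \<bar>1 / real n * (\<Sum>i=1..n. g (xs i) - H (g (ys i))) - ((\<integral>y. g y \<partial>\<mu>) - (\<integral>y. H (g y) \<partial>\<nu>))\<bar>"
    by (simp only: a_def b_def)
qed

lemma abs_le_supnorm_set:
  assumes "y \<in> X" "j < d"
  shows "ereal \<bar>y j\<bar> \<le> supnorm_set d X"
proof -
  have "ereal \<bar>y j\<bar> \<le> (SUP j\<in>{..<d}. ereal \<bar>y j\<bar>)" using assms(2) by (intro SUP_upper) auto
  also have "\<dots> \<le> supnorm_set d X" unfolding supnorm_set_def by (rule SUP_upper[OF assms(1)])
  finally show ?thesis .
qed

text \<open>
  Collects what the two activations have in common: a bound \<open>B\<close>, a net of matching radius \<open>r\<close> with few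
  elements, and the fact that \<open>k B + 1\<close> is comparable with \<open>C\<close>. The lower bound on \<open>C\<close> comes from a network with all
  outer coefficients equal to 1. Its neurons are the constant \<open>1 / 2\<close> for the sigmoid, and take the value
  \<open>\<bar>y j\<bar> + 1\<close> at a given point \<open>y\<close> for the rectifier.
\<close>

lemma activation_net:
  assumes \<phi>: "\<phi> \<in> {sigmoid, relu}" and d: "d \<ge> 1" and k: "k \<ge> 1" and X: "X \<noteq> {}" and G: "G = nn_star d k \<phi>"
    and sup: "supnorm_set d X = ereal M" and bound: "\<forall>g\<in>G. \<forall>y\<in>X. \<bar>g y\<bar> \<le> C"
  obtains B r N where "0 \<le> M" "1 \<le> B" "\<And>s. \<bar>s\<bar> \<le> M + 1 \<Longrightarrow> \<bar>\<phi> s\<bar> \<le> B" "0 \<le> r" "r * (M + 1) \<le> B"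
    "finite N" "N \<subseteq> neuron_params d" "\<And>p. p \<in> neuron_params d \<Longrightarrow> \<exists>c\<in>N. params_dist d p c \<le> r"
    "real (card N) * (real d + 1) \<le> exp (9 * real d * (M + 1) / B)" "real k * B + 1 \<le> 2 * C"
proof -
  have C: "\<bar>g y\<bar> \<le> C" if "g \<in> G" "y \<in> X" for g y
    using bound that by blast
  have y_le: "\<bar>y j\<bar> \<le> M" if "y \<in> X" "j < d" for y j
    using abs_le_supnorm_set[OF that] sup by simp
  obtain y0 where y0: "y0 \<in> X" using X by blast
  have M: "0 \<le> M" using y_le[OF y0, of 0] d by linarith
  consider "\<phi> = sigmoid" | "\<phi> = relu" using \<phi> by blast
  thus ?thesis
  proof cases
    case 1
    have "network d k \<phi> (\<lambda>_. 1) (\<lambda>_. (\<lambda>_. 0, 0)) 1 \<in> G"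
      unfolding G nn_star_iff by (intro exI conjI) (auto simp: neuron_params_def l1norm_def)
    from C[OF this y0] have "real k / 2 + 1 \<le> C"
      by (simp add: network_def affine_map_def dot_def 1 sigmoid_def)
    moreover obtain N where N: "finite N" "N \<subseteq> neuron_params d" "\<And>p. p \<in> neuron_params d \<Longrightarrow> \<exists>c\<in>N. params_dist d p c \<le> 1 / (M + 1)"
        "real (card N) * (real d + 1) \<le> exp (9 * real d * (M + 1))"
      using fine_net[OF d M] by metis
    ultimately show ?thesis
      by (intro that[of 1 "1 / (M + 1)" N]) (use M 1 abs_sigmoid_le in auto)
  next
    case 2
    have "real k * (\<bar>y j\<bar> + 1) + 1 \<le> C" if y: "y \<in> X" and j: "j < d" for y j
    proof -
      define s :: real where "s = (if y j \<ge> 0 then 1 else -1)"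
      define w :: "nat \<Rightarrow> real" where "w = (\<lambda>i. if i = j then s else 0)"
      have "l1norm d w = 1"
        using j by (simp add: l1norm_def w_def s_def if_distrib[of abs] sum.delta cong: if_cong)
      hence "network d k \<phi> (\<lambda>_. 1) (\<lambda>_. (w, 1)) 1 \<in> G"
        unfolding G nn_star_iff by (intro exI conjI) (auto simp: neuron_params_def)
      moreover have "dot d w y = \<bar>y j\<bar>"
        using j by (simp add: dot_def w_def s_def if_distrib[of "\<lambda>a. a * _"] sum.delta cong: if_cong)
      ultimately show ?thesis
        using C[of "network d k \<phi> (\<lambda>_. 1) (\<lambda>_. (w, 1)) 1" y] y
        by (simp add: network_def affine_map_def 2 relu_def)
    qed
    hence "\<bar>y j\<bar> \<le> (C - 1) / real k - 1" if "y \<in> X" "j < d" for y j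
      using that k by (fastforce simp: field_simps)
    hence "supnorm_set d X \<le> ereal ((C - 1) / real k - 1)"
      unfolding supnorm_set_def by (intro SUP_least) auto
    hence le: "real k * (M + 1) + 1 \<le> C"
      using k by (simp add: sup field_simps)
    have "real d + 1 \<le> exp (9 * real d)"
      by (rule order_trans[OF nat_plus_one_le_exp]) simp
    moreover have "C \<ge> 0" using C[of "\<lambda>_. 0" y0] y0 nn_star_zero G by fastforce
    ultimately show ?thesis
      using M le zero_net[where d = d] 2 abs_relu_le
      by (intro that[of "M + 1" 1 "{(\<lambda>_. 0, 0)}"]) auto
  qed
qed

text \<open>
  The bound for one pair of distributions. The real-valued estimates apply because networks are
  bounded on \<open>X\<close> and \<open>h\<close> is bounded on their values; in particular the deviation is finite, so the
  event is empty when \<open>X\<close> is unbounded and the threshold therefore infinite.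
\<close>

lemma divergence_estimate_tail:
  fixes X :: "(nat \<Rightarrow> real) set" and h :: "real \<Rightarrow> ereal" and h' :: "real \<Rightarrow> real"
  assumes d: "d \<ge> 1" and k: "k \<ge> 1" and X: "X \<subseteq> euclid d" and \<phi>: "\<phi> \<in> {sigmoid, relu}"
    and G: "G = nn_star d k \<phi>" and C_fin: "C_upper (abs_funs G) X < \<infinity>"
    and deriv: "ereal_has_deriv_on h h' (value_interval G X)"
    and L_fin: "C_upper (abs_funs (comp_funs h' G)) X < \<infinity>"
    and n: "n \<ge> 1" and \<delta>: "\<delta> \<ge> 0" and \<mu>: "\<mu> \<in> prob_measures d X" and \<nu>: "\<nu> \<in> prob_measures d X"
  shows "measure (sample_measure n \<mu> \<nu>)
             {(xs, ys) \<in> space (sample_measure n \<mu> \<nu>).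
                \<bar>divergence_est h G n xs ys - divergence h G \<mu> \<nu>\<bar>
                  \<ge> ereal \<delta> + E_const 32768 d k h' G X * ereal (real n powr (-1/2))}
        \<le> 32768 * exp (- (real n * \<delta>^2 / real_of_ereal (V_const 32768 h' G X)))"
    (is "measure ?S ?E \<le> ?rhs")
proof -
  have sp: "space \<mu> = X" "space \<nu> = X" using space_prob_measures X \<mu> \<nu> by auto
  have prob: "prob_space \<mu>" "prob_space \<nu>" using \<mu> \<nu> by (auto simp: prob_measures_def)
  have X_ne: "X \<noteq> {}" using prob_space.not_empty[OF prob(1)] sp by simp
  then obtain y0 where y0: "y0 \<in> X" by blast
  have zero: "(\<lambda>_. 0) \<in> G" unfolding G by (rule nn_star_zero)
  have G_ne: "G \<noteq> {}" using zero by blast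
  obtain C where C: "C_upper (abs_funs G) X = ereal C" "\<And>g y. g \<in> G \<Longrightarrow> y \<in> X \<Longrightarrow> \<bar>g y\<bar> \<le> C"
    and C_least: "\<And>K. (\<And>g y. g \<in> G \<Longrightarrow> y \<in> X \<Longrightarrow> \<bar>g y\<bar> \<le> K) \<Longrightarrow> C \<le> K"
    by (rule C_upper_abs_finite[OF C_fin zero y0]) blast
  have "network d k \<phi> (\<lambda>_. 0) (\<lambda>_. (\<lambda>_. 0, 0)) 1 \<in> G"
    unfolding G nn_star_iff by (intro exI conjI) (auto simp: neuron_params_def l1norm_def)
  from C(2)[OF this y0] have C1: "1 \<le> C" by (simp add: network_def)
  have "h' \<circ> (\<lambda>_. 0) \<in> comp_funs h' G" unfolding comp_funs_def by (rule imageI) (rule zero)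
  then obtain L where L: "C_upper (abs_funs (comp_funs h' G)) X = ereal L" "0 \<le> L"
    and L_le: "\<And>f y. f \<in> comp_funs h' G \<Longrightarrow> y \<in> X \<Longrightarrow> \<bar>f y\<bar> \<le> L"
    using C_upper_abs_finite[OF L_fin _ y0] by metis
  have \<phi>_lip: "\<bar>\<phi> s - \<phi> t\<bar> \<le> \<bar>s - t\<bar>" for s t
    using \<phi> sigmoid_lipschitz relu_lipschitz by auto
  define H where "H z = real_of_ereal (h z)" for z
  let ?J = "range_on G X"
  have J_sub: "?J \<subseteq> value_interval G X"
  proof
    fix z assume "z \<in> ?J"
    then obtain g y where g: "g \<in> G" "y \<in> X" "z = g y" by (auto simp: range_on_def)
    have "C_lower G X \<le> ereal z" unfolding C_lower_def
      by (rule INF_lower2[of "(y, g)"]) (use g in auto)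
    moreover have "ereal z \<le> C_upper G X" unfolding C_upper_def
      by (rule SUP_upper2[of "(y, g)"]) (use g in auto)
    ultimately show "z \<in> value_interval G X" by (simp add: value_interval_def)
  qed
  have h_H: "h z = ereal (H z)" if "z \<in> ?J" for z
  proof -
    have "\<forall>s\<in>value_interval G X. \<bar>h s\<bar> \<noteq> \<infinity>"
      using deriv unfolding ereal_has_deriv_on_def by (rule conjunct1)
    hence "\<bar>h z\<bar> \<noteq> \<infinity>" by (rule bspec) (rule subsetD[OF J_sub that])
    thus ?thesis by (simp add: H_def ereal_real)
  qed
  have hG: "h (g y) = ereal (H (g y))" if "g \<in> G" "y \<in> X" for g y
    using that by (intro h_H) (auto simp: range_on_def)
  have H_lip: "L-lipschitz_on ?J H"
  proof (rule lipschitz_onI)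
    fix s t assume st: "s \<in> ?J" "t \<in> ?J"
    have "norm (H s - H t) \<le> L * norm (s - t)"
    proof (rule field_differentiable_bound[where f' = h' and S = ?J])
      show "convex ?J" unfolding G by (rule convex_range_on_nn_star)
      fix z assume z: "z \<in> ?J"
      have "((\<lambda>s. real_of_ereal (h s)) has_real_derivative h' z) (at z within value_interval G X)"
        using deriv subsetD[OF J_sub z] unfolding ereal_has_deriv_on_def by (elim conjE bspec)
      thus "(H has_field_derivative h' z) (at z within ?J)"
        unfolding H_def[abs_def] by (rule DERIV_subset) (rule J_sub)
      obtain g y where "g \<in> G" "y \<in> X" "z = g y" using z by (auto simp: range_on_def)
      thus "norm (h' z) \<le> L" using L_le[of "h' \<circ> g" y] by (auto simp: comp_funs_def)
    qed (use st in auto)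
    thus "dist (H s) (H t) \<le> L * dist s t" by (simp add: dist_norm)
  qed (rule L)
  define K where "K = \<bar>H 0\<bar> + (L + 1) * C"
  have K1: "\<bar>g y\<bar> \<le> K" if "g \<in> G" "y \<in> X" for g y
  proof -
    have "\<bar>g y\<bar> \<le> C" by (rule C(2)[OF that])
    moreover have "0 \<le> L * C" using L C1 by simp
    ultimately show ?thesis unfolding K_def distrib_right by simp
  qed
  have K2: "\<bar>H (g y)\<bar> \<le> K" if "g \<in> G" "y \<in> X" for g y
  proof -
    have "\<bar>H (g y) - H 0\<bar> \<le> L * \<bar>g y\<bar>" by (rule abs_compose_lipschitz_le[OF that zero H_lip])
    also have "\<dots> \<le> L * C" by (intro mult_left_mono C that L)
    finally show ?thesis using C1 by (simp add: K_def distrib_right)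
  qed
  have id: "1-lipschitz_on ?J (\<lambda>z. z)" by (simp add: lipschitz_on_def)
  have int_\<mu>: "integrable \<mu> g" if g: "g \<in> G" for g
    by (rule compose_lipschitz_integrable[OF prob(1) nn_star_measurable[OF \<mu> g[unfolded G] \<phi>_lip] g zero sp(1) id K1[OF g]])
  have int_\<nu>: "integrable \<nu> (\<lambda>y. H (g y))" if g: "g \<in> G" for g
    by (rule compose_lipschitz_integrable[OF prob(2) nn_star_measurable[OF \<nu> g[unfolded G] \<phi>_lip] g zero sp(2) H_lip K1[OF g]])
  have est_finite: "\<bar>divergence_est h G n xs ys - divergence h G \<mu> \<nu>\<bar> \<noteq> \<infinity>"
    if "(xs, ys) \<in> space ?S" for xs ys
    by (rule estimator_deviation(1)[where K = K and H = H and X = X, OF G_ne sp prob _ _ _ _ _ n that])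
      (use int_\<mu> int_\<nu> K1 K2 hG in blast)+
  have event: "\<exists>g\<in>G. 3 / 4 * t \<le> \<bar>1 / real n * (\<Sum>i=1..n. g (xs i) - H (g (ys i))) - ((\<integral>y. g y \<partial>\<mu>) - (\<integral>y. H (g y) \<partial>\<nu>))\<bar>"
    if "(xs, ys) \<in> space ?S" "0 < t" "ereal t \<le> \<bar>divergence_est h G n xs ys - divergence h G \<mu> \<nu>\<bar>" for xs ys t
    by (rule estimator_deviation(2)[where K = K and H = H and X = X, OF G_ne sp prob _ _ _ _ _ n that])
      (use int_\<mu> int_\<nu> K1 K2 hG in blast)+
  have sup_ge: "0 \<le> supnorm_set d X"
    using d by (intro order_trans[OF _ abs_le_supnorm_set[OF y0, of 0]]) auto
  have npow: "real n powr (-1/2) = 1 / sqrt (real n)"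
    using n by (simp add: powr_minus_divide powr_half_sqrt)
  show ?thesis
  proof (cases "supnorm_set d X = \<infinity>")
    case True
    have "E_const 32768 d k h' G X = \<infinity>"
      using True d k C1 L by (simp add: E_const_def C(1) ereal_sqrt_def)
    hence "ereal \<delta> + E_const 32768 d k h' G X * ereal (real n powr (-1/2)) = \<infinity>"
      using n by (simp add: npow)
    hence "?E = {}"
      using est_finite by auto
    hence "measure ?S ?E = 0" by (simp only: measure_empty)
    also have "0 \<le> ?rhs" by simp
    finally show ?thesis .
  next
    case False
    then obtain M where M: "supnorm_set d X = ereal M"
      using sup_ge by (cases "supnorm_set d X") auto
    have C_bound: "\<forall>g\<in>G. \<forall>y\<in>X. \<bar>g y\<bar> \<le> C" using C(2) by blast
    obtain B r N where M0: "0 \<le> M" and B: "1 \<le> B" and \<phi>_B: "\<And>s. \<bar>s\<bar> \<le> M + 1 \<Longrightarrow> \<bar>\<phi> s\<bar> \<le> B"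
      and r: "0 \<le> r" "r * (M + 1) \<le> B" and N: "finite N" "N \<subseteq> neuron_params d"
      and net: "\<And>p. p \<in> neuron_params d \<Longrightarrow> \<exists>c\<in>N. params_dist d p c \<le> r"
      and card: "real (card N) * (real d + 1) \<le> exp (9 * real d * (M + 1) / B)" and BC: "real k * B + 1 \<le> 2 * C"
      using activation_net[OF \<phi> d k X_ne G M C_bound] by blast
    have y_le: "\<bar>y j\<bar> \<le> M" if "y \<in> X" "j < d" for y j
      using abs_le_supnorm_set[OF that] M by simp
    have CB: "C \<le> real k * B + 1"
    proof (rule C_least)
      fix g y assume g: "g \<in> G" and y: "y \<in> X"
      show "\<bar>g y\<bar> \<le> real k * B + 1"
        by (rule abs_nn_star_le[OF g[unfolded G] \<phi>_B _ M0]) (use y_le[OF y] in auto)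
    qed
    define \<Lambda> where "\<Lambda> = L + 1"
    define e where "e = 32768 * real k * sqrt (real d * (M + 1)) * \<Lambda> * sqrt C"
    define t where "t = \<delta> + e * (1 / sqrt (real n))"
    have E_eq: "E_const 32768 d k h' G X = ereal e"
      using M0 d by (simp add: E_const_def M C(1) L(1) ereal_sqrt_def e_def \<Lambda>_def)
    have V_eq: "real_of_ereal (V_const 32768 h' G X) = 32768 * C\<^sup>2 * \<Lambda>\<^sup>2"
      by (simp add: V_const_def C(1) L(1) \<Lambda>_def)
    have thr: "ereal \<delta> + E_const 32768 d k h' G X * ereal (real n powr (-1/2)) = ereal t"
      unfolding E_eq npow t_def by simp
    have "0 < e" using k d M0 L C1 by (simp add: e_def \<Lambda>_def)
    hence t: "0 < t" using \<delta> n by (simp add: t_def add_nonneg_pos)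
    have "measure ?S ?E \<le> 8 * real (card N) * (real d + 1) * exp (- (real n * t\<^sup>2 / (32768 * C\<^sup>2 * (L + 1)\<^sup>2)))"
    proof (rule two_sample_deviation[OF d k X X_ne \<mu> \<nu> _ M0 \<phi>_lip \<phi>_B N net r H_lip[unfolded G] n t BC])
      show "?E \<subseteq> {(xs, ys) \<in> space ?S. \<exists>g\<in>nn_star d k \<phi>. 3 / 4 * t
        \<le> \<bar>1 / real n * (\<Sum>i=1..n. g (xs i) - H (g (ys i))) - ((\<integral>y. g y \<partial>\<mu>) - (\<integral>y. H (g y) \<partial>\<nu>))\<bar>}"
        using event[OF _ t] unfolding thr G[symmetric] by blast
    qed (use y_le in auto)
    also have "\<dots> = 8 * (real (card N) * (real d + 1)) * exp (- (real n * t\<^sup>2 / (32768 * C\<^sup>2 * \<Lambda>\<^sup>2)))"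
      by (simp add: \<Lambda>_def)
    also have "\<dots> \<le> 32768 * exp (- (real n * \<delta>\<^sup>2 / (32768 * C\<^sup>2 * \<Lambda>\<^sup>2)))"
      by (rule net_absorbed[OF d k _ card B M0 _ CB _ \<delta> n e_def t_def]) (use C1 L in \<open>auto simp: \<Lambda>_def\<close>)
    finally show ?thesis by (simp only: V_eq)
  qed
qed

theorem theorem11:
  shows "\<exists>c::real. c > 0 \<and>
    (\<forall>(d::nat) (k::nat) (X :: (nat \<Rightarrow> real) set) (\<phi> :: real \<Rightarrow> real)
      (h :: real \<Rightarrow> ereal) (h' :: real \<Rightarrow> real) (G :: ((nat \<Rightarrow> real) \<Rightarrow> real) set).
      d \<ge> 1 \<longrightarrow> k \<ge> 1 \<longrightarrow> X \<subseteq> euclid d \<longrightarrow> \<phi> \<in> {sigmoid, relu} \<longrightarrow>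
      G = nn_star d k \<phi> \<longrightarrow>
      C_upper (abs_funs G) X < \<infinity> \<longrightarrow>
      ereal_has_deriv_on h h' (value_interval G X) \<longrightarrow>
      C_upper (abs_funs (comp_funs h' G)) X < \<infinity> \<longrightarrow>
      (\<forall>(n::nat) (\<delta>::real). n \<ge> 1 \<longrightarrow> \<delta> \<ge> 0 \<longrightarrow>
        (SUP (\<mu>, \<nu>) \<in> {(\<mu>, \<nu>). \<mu> \<in> prob_measures d X \<and> \<nu> \<in> prob_measures d X \<and>
                                divergence h G \<mu> \<nu> < \<infinity>}.
           ereal (measure (sample_measure n \<mu> \<nu>)
             {(xs, ys) \<in> space (sample_measure n \<mu> \<nu>).
                \<bar>divergence_est h G n xs ys - divergence h G \<mu> \<nu>\<bar>
                  \<ge> ereal \<delta> + E_const c d k h' G X * ereal (real n powr (-1/2))}))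
        \<le> ereal (c * exp (- (real n * \<delta>^2 / real_of_ereal (V_const c h' G X))))))"
\<comment> \<open>The constant of the two-sample bound; inside \<open>E\<close> and as a prefactor a smaller one would do.\<close>
proof (intro exI[of _ 32768] conjI allI impI)
  fix d k :: nat and X :: "(nat \<Rightarrow> real) set" and \<phi> :: "real \<Rightarrow> real" and h :: "real \<Rightarrow> ereal"
    and h' :: "real \<Rightarrow> real" and G :: "((nat \<Rightarrow> real) \<Rightarrow> real) set" and n :: nat and \<delta> :: real
  assume A: "d \<ge> 1" "k \<ge> 1" "X \<subseteq> euclid d" "\<phi> \<in> {sigmoid, relu}" "G = nn_star d k \<phi>"
    "C_upper (abs_funs G) X < \<infinity>" "ereal_has_deriv_on h h' (value_interval G X)"
    "C_upper (abs_funs (comp_funs h' G)) X < \<infinity>" "n \<ge> 1" "\<delta> \<ge> 0"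
  show "(SUP (\<mu>, \<nu>) \<in> {(\<mu>, \<nu>). \<mu> \<in> prob_measures d X \<and> \<nu> \<in> prob_measures d X \<and> divergence h G \<mu> \<nu> < \<infinity>}.
           ereal (measure (sample_measure n \<mu> \<nu>)
             {(xs, ys) \<in> space (sample_measure n \<mu> \<nu>).
                \<bar>divergence_est h G n xs ys - divergence h G \<mu> \<nu>\<bar>
                  \<ge> ereal \<delta> + E_const 32768 d k h' G X * ereal (real n powr (-1/2))}))
        \<le> ereal (32768 * exp (- (real n * \<delta>^2 / real_of_ereal (V_const 32768 h' G X))))"
    by (intro SUP_least) (use divergence_estimate_tail[OF A] in auto)
qed simp

end
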